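(* Let $F$ be a tract, $\Gamma$ an ordered abelian group, and $M$ a weak (resp. strong) $F[\Gamma]$-matroid of rank $r$ on a finite totally ordered set $E$ with Plücker vector $P\colon\binom Er\to F[\Gamma]$. Then for every $\mathbf u\in(\Gamma\cup\{\infty\})^E$ the initial matroid $M^{\mathbf u}$ is a weak (resp. strong) $F$-matroid. That is: for $\mathbf u\in\Gamma^E$ the function $P^{\mathbf u}\colon\binom Er\to F$ is the Plücker vector of a weak (resp. strong) $F$-matroid; and for general $\mathbf u\in(\Gamma\cup\{\infty\})^E$, $M^{\mathbf u}=(M/Z_{\mathbf u})^{\mathbf u^\circ}+_{co\ell}Z_{\mathbf u}$ is a weak (resp. strong) $F$-matroid.
   Context: Tracts. A tract $F=(F^\times,N_F)$ is a multiplicative abelian group $F^\times$ (identity $1$) together with a subset $N_F$ (the null set) of the group semiring $\mathbb N[F^\times]$ of finite formal sums such that: $0\in N_F$; $1\notin N_F$; there is a unique element $-1\in F^\times$ with $1+(-1)\in N_F$; and if $\sum a_i\in N_F$ then $\sum c a_i\in N_F$ for all $c\in F^\times$. We also write $F=F^\times\cup\{0\}$ with $0\cdot g=0$; zero terms of formal sums are dropped. Tropical extension. $\Gamma$ is a (totally) ordered abelian group, written additively; $\infty$ is larger than every element of $\Gamma$ and absorbing. $F[\Gamma]$ is the tract with group $F^\times\times\Gamma$, zero element $\infty$, and null set consisting of the zero sum and all finite sums $\sum_{i\in I}(a_i,\gamma_i)$ with $\sum_{i\in I_{\min}}a_i\in N_F$, where $I_{\min}=\{i\in I:\gamma_i\le\gamma_j\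 \forall j\in I\}$. Put $\theta(a,\gamma)=a$, $\theta(\infty)=0$, $|(a,\gamma)|=\gamma$, $|\infty|=\infty$. Matroids. Let $0\le r\le|E|$. A strong Plücker vector of rank $r$ on $E$ is a nonzero function $P\colon\binom Er\to F$ with $\sum_{j\in J\setminus I}\operatorname{sign}(j;I,J)P(I+j)P(J-j)\in N_F$ for all $I\in\binom{E}{r-1}$, $J\in\binom{E}{r+1}$, where $\operatorname{sign}(j;I,J)=(-1)^\ell$, $\ell=\#\{j'\in J:j<j'\}+\#\{i\in I:j<i\}$. A weak Plücker vector is a nonzero function whose support is the set of bases of a matroid and which satisfies these relations whenever $|J\setminus I|=3$. A weak (resp. strong) $F$-matroid is an equivalence class of weak (resp. strong) Plücker vectors under scaling by $F^\times$. For $\tau=\{i_0<\dots<i_r\}$ let $(C_\tau)_{i_s}=(-1)^sP(\tau-i_s)$, $0$ elsewhere; the circuits $\mathcal C(M)\subseteq F^E$ are the $F^\times$-multiples of the nonzero $C_\tau$. An $F$-matroid is determined by its set of circuits. Contraction and coloops. For $X\in F^E$, $A\subseteq E$, $X\setminus A\in F^{E\setminus A}$ is the restriction. $\operatorname{MinSupp}(\mathcal X)$ is the set of nonzero elements of $\mathcal X$ of inclusion-minimal support. The contraction $M/A$ of a weak (resp. strong) $F$-matroid is the weak (resp. strong) $F$-matroid on $E\setminus A$ with circuits $\operatorname{MinSupp}\{C\setminus A: C\in\mathcal C(M)\}$ (this exists by Baker–Bowler). For $A$ disjoint from the ground set $E$ of $M$, $M+_{co\ell}A$ is the $F$-matroid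 on $E\sqcup A$ of rank $r+|A|$ with circuits $\mathcal C(M)\times\{(0,\dots,0)\in F^A\}$ (every element of $A$ is a coloop). Initial matroids. For $\mathbf u\in\Gamma^E$ and $P\colon\binom Er\to F[\Gamma]$, $P^{\mathbf u}(I)=\theta(P(I))$ if $|P(I)|-\sum_{i\in I}u_i\le|P(J)|-\sum_{j\in J}u_j$ for all $J\in\binom Er$, and $0$ otherwise; $M^{\mathbf u}$ is represented by $P^{\mathbf u}$ when $P$ is a Plücker vector of $M$. For $\mathbf u\in(\Gamma\cup\{\infty\})^E$ put $Z_{\mathbf u}=\{i:u_i=\infty\}$, $\mathbf u^\circ=\mathbf u\setminus Z_{\mathbf u}\in\Gamma^{E\setminus Z_{\mathbf u}}$, and $M^{\mathbf u}=(M/Z_{\mathbf u})^{\mathbf u^\circ}+_{co\ell}Z_{\mathbf u}$. *)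

theory Defs
  imports "HOL-Algebra.Group" "HOL-Library.Multiset" "HOL-Library.Ramsey"
begin

section \<open>Tracts\<close>

text \<open>
  A formal sum in the group semiring over \<open>\<nat>\<close> is a multiset of group elements; the sum \<open>0\<close> is
  the empty multiset.
\<close>

record 'f tract = "'f monoid" +
  null_set :: "'f multiset set"

locale tract = comm_group F for F (structure) +
  assumes null_set_closed: "X \<in> null_set F \<Longrightarrow> set_mset X \<subseteq> carrier F"
    and zero_in_null_set: "{#} \<in> null_set F"
    and one_notin_null_set: "{#\<one>#} \<notin> null_set F"
    and ex1_neg_one: "\<exists>!e. e \<in> carrier F \<and> {#\<one>, e#} \<in> null_set F"
    and null_set_scale: "\<lbrakk>X \<in> null_set F; c \<in> carrier F\<rbrakk> \<Longrightarrow> image_mset (\<lambda>a. c \<otimes> a) X \<in> null_set F"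

definition neg_one :: "('f, 'm) tract_scheme \<Rightarrow> 'f" where
  "neg_one F = (THE e. e \<in> carrier F \<and> {#\<one>\<^bsub>F\<^esub>, e#} \<in> null_set F)"

text \<open>
  The set \<open>F = F\<^sup>\<times> \<union> {0}\<close> is modelled by the type \<^typ>\<open>'f option\<close>, with \<^term>\<open>None\<close> as zero.
  Below, functions on a set \<open>E\<close> or on the \<open>r\<close>-subsets of \<open>E\<close> with values in \<open>F\<close> are represented by
  total functions that are \<^term>\<open>None\<close> outside of their domain.
\<close>

definition opt_mult :: "('f, 'm) tract_scheme \<Rightarrow> 'f option \<Rightarrow> 'f option \<Rightarrow> 'f option" where
  "opt_mult F x y = (case (x, y) of (Some a, Some b) \<Rightarrow> Some (a \<otimes>\<^bsub>F\<^esub> b) | _ \<Rightarrow> None)"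

definition scale :: "('f, 'm) tract_scheme \<Rightarrow> 'f \<Rightarrow> ('k \<Rightarrow> 'f option) \<Rightarrow> 'k \<Rightarrow> 'f option" where
  "scale F c X = (\<lambda>k. opt_mult F (Some c) (X k))"

definition formal_sum :: "('j \<Rightarrow> 'f option) \<Rightarrow> 'j set \<Rightarrow> 'f multiset" where
  "formal_sum x A = image_mset (\<lambda>j. the (x j)) (mset_set {j \<in> A. x j \<noteq> None})"

definition supp :: "('k \<Rightarrow> 'f option) \<Rightarrow> 'k set" where
  "supp X = {k. X k \<noteq> None}"


section \<open>The tropical extension\<close>

definition min_part :: "('f \<times> 'g::linorder) multiset \<Rightarrow> ('f \<times> 'g) multiset" where
  "min_part X = filter_mset (\<lambda>x. \<forall>y \<in># X. snd x \<le> snd y) X"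

definition trop_ext :: "('f, 'm) tract_scheme \<Rightarrow> ('f \<times> 'g::linordered_ab_group_add) tract" where
  "trop_ext F =
    \<lparr>carrier = carrier F \<times> UNIV,
     monoid.mult = (\<lambda>(a, \<gamma>) (b, \<delta>). (a \<otimes>\<^bsub>F\<^esub> b, \<gamma> + \<delta>)),
     one = (\<one>\<^bsub>F\<^esub>, 0),
     null_set = {X. set_mset X \<subseteq> carrier F \<times> UNIV \<and>
                    (X = {#} \<or> image_mset fst (min_part X) \<in> null_set F)}\<rparr>"

lemma tract_trop_ext:
  assumes "tract F"
  shows "tract (trop_ext F :: ('f \<times> 'g::linordered_ab_group_add) tract)"
proof -
  interpret F: tract F by fact
  let ?T = "trop_ext F :: ('f \<times> 'g) tract"
  have car: "carrier ?T = carrier F \<times> UNIV" by (simp add: trop_ext_def)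
  have mul: "(a, \<gamma>) \<otimes>\<^bsub>?T\<^esub> (b, \<delta>) = (a \<otimes>\<^bsub>F\<^esub> b, \<gamma> + \<delta>)" for a b \<gamma> \<delta>
    by (simp add: trop_ext_def)
  have one: "\<one>\<^bsub>?T\<^esub> = (\<one>\<^bsub>F\<^esub>, 0)" by (simp add: trop_ext_def)
  have nul: "X \<in> null_set ?T \<longleftrightarrow> set_mset X \<subseteq> carrier F \<times> UNIV \<and>
               (X = {#} \<or> image_mset fst (min_part X) \<in> null_set F)" for X
    by (simp add: trop_ext_def)
  have single: "{#a#} \<notin> null_set F" if "a \<in> carrier F" for a
    using F.null_set_scale[of "{#a#}" "inv\<^bsub>F\<^esub> a"] F.one_notin_null_set that by auto
  have "comm_group ?T"
  proof (rule comm_groupI)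
    fix x assume "x \<in> carrier ?T"
    then obtain a \<gamma> where x: "x = (a, \<gamma>)" "a \<in> carrier F" by (auto simp: car)
    then have "(inv\<^bsub>F\<^esub> a, -\<gamma>) \<in> carrier ?T" "(inv\<^bsub>F\<^esub> a, -\<gamma>) \<otimes>\<^bsub>?T\<^esub> x = \<one>\<^bsub>?T\<^esub>"
      by (auto simp: car mul one)
    then show "\<exists>y\<in>carrier ?T. y \<otimes>\<^bsub>?T\<^esub> x = \<one>\<^bsub>?T\<^esub>" by blast
  qed (auto simp: car mul one F.m_assoc add.assoc intro: F.m_comm add.commute)
  moreover have pair: "{#(\<one>\<^bsub>F\<^esub>, 0), (a, \<gamma>)#} \<in> null_set ?T \<longleftrightarrow>
      a \<in> carrier F \<and> \<gamma> = 0 \<and> {#\<one>\<^bsub>F\<^esub>, a#} \<in> null_set F" for a and \<gamma> :: 'g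
    using single[of a] F.one_notin_null_set
    by (cases \<gamma> "0 :: 'g" rule: linorder_cases) (auto simp: nul min_part_def)
  have "\<exists>!e. e \<in> carrier ?T \<and> {#\<one>\<^bsub>?T\<^esub>, e#} \<in> null_set ?T"
  proof -
    obtain e where e: "e \<in> carrier F" "{#\<one>\<^bsub>F\<^esub>, e#} \<in> null_set F"
      "\<And>e'. e' \<in> carrier F \<Longrightarrow> {#\<one>\<^bsub>F\<^esub>, e'#} \<in> null_set F \<Longrightarrow> e' = e"
      using F.ex1_neg_one by blast
    show ?thesis
    proof (rule ex1I[of _ "(e, 0)"])
      show "(e, 0) \<in> carrier ?T \<and> {#\<one>\<^bsub>?T\<^esub>, (e, 0)#} \<in> null_set ?T"
        using e(1,2) by (simp add: car one pair)
      fix e' assume "e' \<in> carrier ?T \<and> {#\<one>\<^bsub>?T\<^esub>, e'#} \<in> null_set ?T"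
      then show "e' = (e, 0)"
        by (cases e') (simp add: one pair e(3))
    qed
  qed
  moreover have "image_mset (\<lambda>a. c \<otimes>\<^bsub>?T\<^esub> a) X \<in> null_set ?T"
    if X: "X \<in> null_set ?T" and c: "c \<in> carrier ?T" for X c
  proof -
    obtain b \<delta> where c': "c = (b, \<delta>)" "b \<in> carrier F" using c by (auto simp: car)
    have snd_c: "snd (c \<otimes>\<^bsub>?T\<^esub> y) = \<delta> + snd y" and fst_c: "fst (c \<otimes>\<^bsub>?T\<^esub> y) = b \<otimes>\<^bsub>F\<^esub> fst y" for y
      by (cases y; simp add: c' mul)+
    have "image_mset fst (min_part (image_mset (\<lambda>a. c \<otimes>\<^bsub>?T\<^esub> a) X)) =
          image_mset (\<lambda>a. b \<otimes>\<^bsub>F\<^esub> a) (image_mset fst (min_part X))"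
      by (simp add: min_part_def filter_mset_image_mset snd_c fst_c image_mset.compositionality comp_def)
    then show ?thesis using X c' F.null_set_scale by (auto simp: nul mul)
  qed
  moreover have "{#} \<in> null_set ?T" "{#\<one>\<^bsub>?T\<^esub>#} \<notin> null_set ?T"
    using F.one_notin_null_set by (simp_all add: nul one min_part_def)
  moreover have "X \<in> null_set ?T \<Longrightarrow> set_mset X \<subseteq> carrier ?T" for X
    by (simp add: nul car)
  ultimately show ?thesis
    by (intro tract.intro tract_axioms.intro)
qed

text \<open>
  The set \<open>\<Gamma> \<union> {\<infinity>}\<close> is modelled by \<^typ>\<open>'g option\<close>, with \<^term>\<open>None\<close> as \<open>\<infinity>\<close>. In particular the
  zero element of \<open>F[\<Gamma>]\<close> and its absolute value are both written \<^term>\<open>None\<close>. The order is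
  spelled out because \<open>\<infinity>\<close> has to be the largest element.
\<close>

definition angular :: "('f \<times> 'g) option \<Rightarrow> 'f option" where
  "angular = map_option fst"

definition absval :: "('f \<times> 'g) option \<Rightarrow> 'g option" where
  "absval = map_option snd"

fun le_infty :: "'g::linorder option \<Rightarrow> 'g option \<Rightarrow> bool" where
  "le_infty x None \<longleftrightarrow> True"
| "le_infty None (Some b) \<longleftrightarrow> False"
| "le_infty (Some a) (Some b) \<longleftrightarrow> a \<le> b"

definition diff_infty :: "'g::minus option \<Rightarrow> 'g \<Rightarrow> 'g option" where
  "diff_infty x s = map_option (\<lambda>\<gamma>. \<gamma> - s) x"


section \<open>Pluecker vectors and matroids over a tract\<close>

definition matroid_bases :: "'i set \<Rightarrow> 'i set set \<Rightarrow> bool" where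
  "matroid_bases E \<B> \<longleftrightarrow> finite E \<and> \<B> \<noteq> {} \<and> \<B> \<subseteq> Pow E \<and>
     (\<forall>A\<in>\<B>. \<forall>B\<in>\<B>. \<forall>a\<in>A - B. \<exists>b\<in>B - A. insert b (A - {a}) \<in> \<B>)"

definition plucker_function ::
    "('f, 'm) tract_scheme \<Rightarrow> 'i set \<Rightarrow> nat \<Rightarrow> ('i set \<Rightarrow> 'f option) \<Rightarrow> bool" where
  "plucker_function F E r P \<longleftrightarrow>
     supp P \<noteq> {} \<and> supp P \<subseteq> nsets E r \<and> (\<forall>I\<in>supp P. the (P I) \<in> carrier F)"

definition plucker_sign ::
    "('f, 'm) tract_scheme \<Rightarrow> 'i::linorder \<Rightarrow> 'i set \<Rightarrow> 'i set \<Rightarrow> 'f" where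
  "plucker_sign F j I J =
     neg_one F [^]\<^bsub>F\<^esub> (card {j' \<in> J. j < j'} + card {i \<in> I. j < i})"

definition plucker_relation ::
    "('f, 'm) tract_scheme \<Rightarrow> ('i::linorder set \<Rightarrow> 'f option) \<Rightarrow> 'i set \<Rightarrow> 'i set \<Rightarrow> bool" where
  "plucker_relation F P I J \<longleftrightarrow>
     formal_sum (\<lambda>j. opt_mult F (Some (plucker_sign F j I J))
                       (opt_mult F (P (insert j I)) (P (J - {j})))) (J - I) \<in> null_set F"

datatype strength = Weak | Strong

text \<open>
  The condition \<open>card I = r - 1\<close> is written additively, so that there is no relation for \<open>r = 0\<close>.
\<close>

fun plucker_vector ::
    "strength \<Rightarrow> ('f, 'm) tract_scheme \<Rightarrow> 'i::linorder set \<Rightarrow> nat \<Rightarrow> ('i set \<Rightarrow> 'f option) \<Rightarrow> bool" where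
  "plucker_vector Strong F E r P \<longleftrightarrow> plucker_function F E r P \<and>
     (\<forall>I J. I \<subseteq> E \<and> J \<subseteq> E \<and> card I + 1 = r \<and> card J = r + 1 \<longrightarrow> plucker_relation F P I J)"
| "plucker_vector Weak F E r P \<longleftrightarrow> plucker_function F E r P \<and> matroid_bases E (supp P) \<and>
     (\<forall>I J. I \<subseteq> E \<and> J \<subseteq> E \<and> card I + 1 = r \<and> card J = r + 1 \<and> card (J - I) = 3
        \<longrightarrow> plucker_relation F P I J)"

record ('i, 'f) fmatroid =
  ground :: "'i set"
  mrank :: nat
  plucker_class :: "('i set \<Rightarrow> 'f option) set"

definition scaling_class :: "('f, 'm) tract_scheme \<Rightarrow> ('k \<Rightarrow> 'f option) \<Rightarrow> ('k \<Rightarrow> 'f option) set" where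
  "scaling_class F P = {scale F c P | c. c \<in> carrier F}"

definition is_fmatroid :: "strength \<Rightarrow> ('f, 'm) tract_scheme \<Rightarrow> ('i::linorder, 'f) fmatroid \<Rightarrow> bool" where
  "is_fmatroid s F M \<longleftrightarrow> finite (ground M) \<and>
     (\<exists>P. plucker_vector s F (ground M) (mrank M) P \<and> plucker_class M = scaling_class F P)"


section \<open>Circuits, contractions and coloops\<close>

definition circuit_vector ::
    "('f, 'm) tract_scheme \<Rightarrow> ('i::linorder set \<Rightarrow> 'f option) \<Rightarrow> 'i set \<Rightarrow> 'i \<Rightarrow> 'f option" where
  "circuit_vector F P \<tau> = (\<lambda>i. if i \<in> \<tau>
     then opt_mult F (Some (neg_one F [^]\<^bsub>F\<^esub> card {k \<in> \<tau>. k < i})) (P (\<tau> - {i})) else None)"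

definition circuits :: "('f, 'm) tract_scheme \<Rightarrow> ('i::linorder, 'f) fmatroid \<Rightarrow> ('i \<Rightarrow> 'f option) set" where
  "circuits F M =
     {scale F c (circuit_vector F P \<tau>) | c P \<tau>.
        c \<in> carrier F \<and> P \<in> plucker_class M \<and> \<tau> \<in> nsets (ground M) (mrank M + 1) \<and>
        supp (circuit_vector F P \<tau>) \<noteq> {}}"

definition remove_coords :: "('i \<Rightarrow> 'f option) \<Rightarrow> 'i set \<Rightarrow> 'i \<Rightarrow> 'f option" where
  "remove_coords X A = (\<lambda>i. if i \<in> A then None else X i)"

definition min_supp :: "('i \<Rightarrow> 'f option) set \<Rightarrow> ('i \<Rightarrow> 'f option) set" where
  "min_supp \<X> = {X \<in> \<X>. supp X \<noteq> {} \<and> (\<forall>Y\<in>\<X>. supp Y \<noteq> {} \<longrightarrow> \<not> supp Y \<subset> supp X)}"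

definition contraction ::
    "strength \<Rightarrow> ('f, 'm) tract_scheme \<Rightarrow> ('i::linorder, 'f) fmatroid \<Rightarrow> 'i set \<Rightarrow> ('i, 'f) fmatroid" where
  "contraction s F M A = (THE N. is_fmatroid s F N \<and> ground N = ground M - A \<and>
     circuits F N = min_supp ((\<lambda>C. remove_coords C A) ` circuits F M))"

text \<open>
  Since vectors are extended by zero, \<open>\<C>(M) \<times> {0}\<close> is literally \<^term>\<open>circuits F M\<close>.
\<close>

definition add_coloops ::
    "strength \<Rightarrow> ('f, 'm) tract_scheme \<Rightarrow> ('i::linorder, 'f) fmatroid \<Rightarrow> 'i set \<Rightarrow> ('i, 'f) fmatroid" where
  "add_coloops s F M A = (THE N. is_fmatroid s F N \<and> ground N = ground M \<union> A \<and>
     mrank N = mrank M + card A \<and> circuits F N = circuits F M)"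


section \<open>Initial matroids\<close>

definition initial_vector ::
    "'i set \<Rightarrow> nat \<Rightarrow> ('i \<Rightarrow> 'g::linordered_ab_group_add) \<Rightarrow> ('i set \<Rightarrow> ('f \<times> 'g) option) \<Rightarrow>
     'i set \<Rightarrow> 'f option" where
  "initial_vector E r u P = (\<lambda>I.
     if I \<in> nsets E r \<and>
        (\<forall>J\<in>nsets E r. le_infty (diff_infty (absval (P I)) (\<Sum>i\<in>I. u i))
                                (diff_infty (absval (P J)) (\<Sum>j\<in>J. u j)))
     then angular (P I) else None)"

text \<open>
  For finite weights: replacing \<open>P\<close> by another representative rescales \<open>P\<^sup>u\<close>, so the
  union below is over copies of one and the same class.
\<close>

definition initial_matroid_fin ::
    "('f, 'm) tract_scheme \<Rightarrow> ('i::linorder, 'f \<times> 'g::linordered_ab_group_add) fmatroid \<Rightarrow>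
     ('i \<Rightarrow> 'g) \<Rightarrow> ('i, 'f) fmatroid" where
  "initial_matroid_fin F M u =
     \<lparr>ground = ground M, mrank = mrank M,
      plucker_class =
        (\<Union>P\<in>plucker_class M. scaling_class F (initial_vector (ground M) (mrank M) u P))\<rparr>"

definition initial_matroid ::
    "strength \<Rightarrow> ('f, 'm) tract_scheme \<Rightarrow> ('i::linorder, 'f \<times> 'g::linordered_ab_group_add) fmatroid \<Rightarrow>
     ('i \<Rightarrow> 'g option) \<Rightarrow> ('i, 'f) fmatroid" where
  "initial_matroid s F M u =
     (let Z = {i \<in> ground M. u i = None}
      in add_coloops s F
           (initial_matroid_fin F (contraction s (trop_ext F) M Z) (\<lambda>i. the (u i))) Z)"

end

theory Submission
  imports Defs
begin

text \<open>
  The terms of the relation of \<open>P\<^sup>u\<close> at \<open>(I, J)\<close> are either all zero or exactly the terms of minimal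
  absolute value in the relation of \<open>P\<close> at \<open>(I, J)\<close>, so all relations pass to \<open>P\<^sup>u\<close>. For weak Pluecker vectors it remains to see that the support is a matroid: since no single
  term is null, the three-term relations give the local exchange property of a valuated matroid,
  Murota's argument turns it into the global one, and minimizers of a valuated matroid are a matroid.

  For infinite weights, contractions and coloop extensions must be shown to exist and to be unique. The
  three-term relations force circuits of equal support to be proportional, so a weak matroid
  is determined by its circuits. The contraction by \<open>A\<close> is represented by \<open>I \<mapsto> \<plusminus>P(I \<union> B)\<close> for a
  basis \<open>B\<close> of \<open>A\<close>; proportionality of the restricted circuits follows by moving along basis exchanges
  in \<open>M|A \<oplus> M/A\<close>.
\<close>

section \<open>Basis families\<close>

text \<open>If one of the three products in a three-term relation vanishes, the other two agree up
  to sign, because no single term is null. Comparing the circuit vectors of two adjacent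
  \<open>(r+1)\<close>-sets therefore amounts to finding a reason for a product to vanish. Inside
  the matroid itself the reason is that the common support \<open>y\<close> is dependent. For a
  circuit restricted to the complement of \<open>A\<close> this reason fails: \<open>y\<close> may
  be independent and become dependent only after contraction, and the weak axioms offer no longer
  relations. The remedy is to walk only through bases that meet \<open>A\<close> in as many elements
  as possible; a rank count in \<open>A\<close> then excludes the unwanted product. Empty
  \<open>A\<close> gives back the first reason, so one lemma serves both purposes. Existence and
  uniqueness both matter because \<open>contraction\<close> and \<open>add_coloops\<close> are
  definite descriptions. Uniqueness is proved for weak vectors and passes to strong ones, which are
  weak as well.\<close>

lemma finite_obtains_max:
  fixes f :: "'a \<Rightarrow> 'b::linorder"
  assumes "finite S" "S \<noteq> {}"
  obtains x where "x \<in> S" "\<And>y. y \<in> S \<Longrightarrow> f y \<le> f x"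
proof -
  have "Max (f ` S) \<in> f ` S" using assms by (intro Max_in) auto
  then obtain x where "x \<in> S" "f x = Max (f ` S)" by auto
  with assms that show ?thesis by (metis Max_ge finite_imageI imageI)
qed

lemma finite_obtains_min:
  fixes f :: "'a \<Rightarrow> 'b::linorder"
  assumes "finite S" "S \<noteq> {}"
  obtains x where "x \<in> S" "\<And>y. y \<in> S \<Longrightarrow> f x \<le> f y"
  using arg_min_if_finite(1)[OF assms, of f] arg_min_least[OF assms, of _ f] by blast

lemma card_1_obtains:
  assumes "card S = Suc 0" obtains x where "S = {x}"
  using assms card_1_singletonE by auto

locale basis_family =
  fixes E :: "'i set" and \<B> :: "'i set set" and r :: nat
  assumes bases: "matroid_bases E \<B>" and uniform: "\<B> \<subseteq> nsets E r"
begin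

lemma finite_ground: "finite E"
  using bases by (simp add: matroid_bases_def)

lemma basis_nonempty: "\<B> \<noteq> {}"
  using bases by (simp add: matroid_bases_def)

lemma basisD:
  assumes "X \<in> \<B>"
  shows "X \<subseteq> E" "finite X" "card X = r"
  using assms uniform by (auto simp: nsets_def)

lemma finite_bases: "finite \<B>"
  using bases by (meson finite_Pow_iff finite_subset matroid_bases_def)

lemma exchange:
  assumes "A \<in> \<B>" "B \<in> \<B>" "a \<in> A - B"
  obtains b where "b \<in> B - A" "insert b (A - {a}) \<in> \<B>"
  using bases assms unfolding matroid_bases_def by blast

lemma bases_eq_if_subset:
  assumes "A \<in> \<B>" "B \<in> \<B>" "A \<subseteq> B"
  shows "A = B"
  using assms basisD by (metis card_subset_eq)

text \<open>Here the entering element is prescribed instead of the leaving one. Starting from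
  \<open>B\<close>, elements of \<open>C - A\<close> other than \<open>b\<close> are traded for
  elements of \<open>A - C\<close> until \<open>C\<close> is \<open>A\<close> with one element
  replaced by \<open>b\<close>.\<close>

lemma dual_exchange:
  assumes A: "A \<in> \<B>" and B: "B \<in> \<B>" and b: "b \<in> B - A"
  obtains a where "a \<in> A - B" "insert b (A - {a}) \<in> \<B>"
proof -
  have "\<exists>a\<in>A - B. insert b (A - {a}) \<in> \<B>"
    if "C \<in> \<B>" "b \<in> C" "A \<inter> B \<subseteq> C" for C
    using that
  proof (induction "card (C - A)" arbitrary: C rule: less_induct)
    case less
    show ?case
    proof (cases "C - A = {b}")
      case True
      have fin: "finite A" "finite C" "card A = card C" using A less.prems basisD by simp_all
      then have "card (A - C) = card (C - A)"
        by (metis card_le_sym_Diff nle_le)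
      then obtain a where a: "A - C = {a}" using True by (auto elim: card_1_obtains)
      then have "insert b (A - {a}) = C" using True by blast
      \<comment> \<open>The invariant \<open>A \<inter> B \<subseteq> C\<close> enters here: the
        element of \<open>A\<close> missing from \<open>C\<close> cannot lie in
        \<open>B\<close>.\<close>
      moreover have "a \<in> A - B" using a less.prems by blast
      ultimately show ?thesis using less.prems by auto
    next
      case False
      then obtain x where x: "x \<in> C - A" "x \<noteq> b" using b less.prems by blast
      obtain y where y: "y \<in> A - C" "insert y (C - {x}) \<in> \<B>"
        using exchange[OF less.prems(1) A x(1)] .
      have "insert y (C - {x}) - A = (C - A) - {x}" using y by blast
      then have "card (insert y (C - {x}) - A) < card (C - A)"
        using x basisD[OF less.prems(1)] by (metis card_Diff1_less finite_Diff)
      from less.hyps[OF this y(2)] show ?thesis using less.prems x by blast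
    qed
  qed
  then show ?thesis using B b that by blast
qed

text \<open>Each step removes an element of \<open>X - Y\<close> and inserts one of
  \<open>Y - X\<close>, so a common subset \<open>K\<close> of both ends survives along the path.
  Later arguments use this to fix part of a circuit while the basis moves.\<close>

lemma basis_path_induct:
  assumes "X \<in> \<B>" "K \<subseteq> X" "Q X" and Y: "Y \<in> \<B>" "K \<subseteq> Y"
    and step: "\<And>X x z. \<lbrakk>X \<in> \<B>; K \<subseteq> X; Q X; x \<in> X - K; z \<notin> X; insert z (X - {x}) \<in> \<B>\<rbrakk>
      \<Longrightarrow> Q (insert z (X - {x}))"
  shows "Q Y"
  using assms(1-3)
proof (induction "card (X - Y)" arbitrary: X rule: less_induct)
  case less
  show ?case
  proof (cases "X \<subseteq> Y")
    case True
    then show ?thesis using bases_eq_if_subset less.prems Y by blast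
  next
    case False
    then obtain x where x: "x \<in> X - Y" by blast
    obtain z where z: "z \<in> Y - X" "insert z (X - {x}) \<in> \<B>"
      using exchange[OF less.prems(1) Y(1) x] .
    have "insert z (X - {x}) - Y = (X - Y) - {x}" using z by blast
    then have "card (insert z (X - {x}) - Y) < card (X - Y)"
      using x basisD[OF less.prems(1)] by (metis card_Diff1_less finite_Diff)
    moreover have "Q (insert z (X - {x}))"
      using step[OF less.prems, of x z] x z Y by blast
    moreover have "K \<subseteq> insert z (X - {x})" using less.prems x Y by blast
    ultimately show ?thesis using less.hyps z(2) by blast
  qed
qed

text \<open>The elements of \<open>S\<close> are brought in one at a time by exchange against
  \<open>D\<close>. The element pushed out lies in \<open>A\<close>, since otherwise the trace on
  \<open>A\<close> would exceed its maximum, and it lies outside \<open>D\<close>, so nothing of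
  \<open>S\<close> is lost again.\<close>

lemma extend_within:
  assumes G: "G \<in> \<B>" and max: "\<And>X. X \<in> \<B> \<Longrightarrow> card (X \<inter> A) \<le> card (G \<inter> A)"
    and D: "D \<in> \<B>" and S: "S \<subseteq> A \<inter> D"
  obtains G' where "G' \<in> \<B>" "S \<subseteq> G'" "G' - A = G - A" "card (G' \<inter> A) = card (G \<inter> A)"
proof -
  have "\<exists>G'\<in>\<B>. S \<subseteq> G' \<and> G' - A = G - A \<and> card (G' \<inter> A) = card (G \<inter> A)"
    if "H \<in> \<B>" "H - A = G - A" "card (H \<inter> A) = card (G \<inter> A)" for H
    using that
  proof (induction "card (S - H)" arbitrary: H rule: less_induct)
    case less
    show ?case
    proof (cases "S \<subseteq> H")
      case True
      then show ?thesis using less.prems by blast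
    next
      case False
      then obtain e where e: "e \<in> S - H" by blast
      obtain j where j: "j \<in> H - D" "insert e (H - {j}) \<in> \<B>"
        using dual_exchange[OF less.prems(1) D, of e] e S by blast
      let ?H = "insert e (H - {j})"
      have finH: "finite H" using basisD less.prems by blast
      have jA: "j \<in> A"
      proof (rule ccontr)
        assume "j \<notin> A"
        then have "?H \<inter> A = insert e (H \<inter> A)" using e S by blast
        then have "card (?H \<inter> A) = Suc (card (H \<inter> A))" using e finH by simp
        then show False using max[OF j(2)] less.prems by simp
      qed
      then have H: "?H \<inter> A = insert e (H \<inter> A - {j})" using e S by blast
      have "j \<in> H \<inter> A" "e \<notin> H \<inter> A - {j}" using j jA e by blast+
      then have card: "card (?H \<inter> A) = card (H \<inter> A)"
        using finH card_insert_disjoint[of "H \<inter> A - {j}" e] card_Suc_Diff1[of "H \<inter> A" j]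
        unfolding H by (metis finite_Diff finite_Int)
      have diff: "?H - A = G - A" using less.prems e S jA by blast
      have "S - ?H = (S - H) - {e}" using j S by blast
      moreover have "finite (S - H)" using S basisD[OF D] finite_subset by blast
      ultimately have "card (S - ?H) < card (S - H)"
        using card_Diff1_less[of "S - H" e] e by simp
      then show ?thesis using less.hyps[of ?H] j(2) less.prems card diff by simp
    qed
  qed
  then show ?thesis using G that by blast
qed

text \<open>The set is the fundamental circuit of \<open>i\<close> over the basis
  \<open>\<tau> - {i}\<close>. A basis containing it would contain \<open>i\<close>, and bringing
  \<open>i\<close> into \<open>\<tau> - {i}\<close> by dual exchange would remove an element of the
  circuit outside that basis.\<close>

lemma fundamental_circuit_dependent:
  assumes "i \<in> \<tau>" "\<tau> - {i} \<in> \<B>" "B \<in> \<B>"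
  shows "\<not> {j \<in> \<tau>. \<tau> - {j} \<in> \<B>} \<subseteq> B"
proof
  assume sub: "{j \<in> \<tau>. \<tau> - {j} \<in> \<B>} \<subseteq> B"
  then have "i \<in> B - (\<tau> - {i})" using assms by blast
  then obtain a where a: "a \<in> (\<tau> - {i}) - B" "insert i (\<tau> - {i} - {a}) \<in> \<B>"
    using dual_exchange[OF assms(2,3)] by blast
  moreover have "insert i (\<tau> - {i} - {a}) = \<tau> - {a}" using a assms(1) by blast
  ultimately show False using sub by auto
qed

text \<open>Choose a basis \<open>B\<close> with largest trace on \<open>X\<close> and some
  \<open>e\<close> in \<open>X - B\<close>. The fundamental circuit of \<open>e\<close> over
  \<open>B\<close> stays inside \<open>X\<close>: trading an element outside \<open>X\<close> for
  \<open>e\<close> would enlarge the trace.\<close>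

lemma dependent_contains_circuit:
  assumes "X \<subseteq> E" "\<And>B. B \<in> \<B> \<Longrightarrow> \<not> X \<subseteq> B"
  obtains \<tau> where "\<tau> \<in> nsets E (r + 1)" "{j \<in> \<tau>. \<tau> - {j} \<in> \<B>} \<noteq> {}" "{j \<in> \<tau>. \<tau> - {j} \<in> \<B>} \<subseteq> X"
proof -
  obtain B where B: "B \<in> \<B>" "\<And>B'. B' \<in> \<B> \<Longrightarrow> card (B' \<inter> X) \<le> card (B \<inter> X)"
    using finite_obtains_max[OF finite_bases basis_nonempty, of "\<lambda>B. card (B \<inter> X)"] by blast
  then obtain e where e: "e \<in> X - B" using assms by blast
  note fB = basisD[OF B(1)]
  define \<tau> where "\<tau> = insert e B"
  have \<tau>: "\<tau> - {e} = B" "e \<in> \<tau>" using e by (auto simp: \<tau>_def)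
  show ?thesis
  proof
    have "e \<in> E" using e assms(1) by blast
    then show "\<tau> \<in> nsets E (r + 1)" using e fB by (simp add: nsets_def \<tau>_def)
    show "{j \<in> \<tau>. \<tau> - {j} \<in> \<B>} \<noteq> {}" using \<tau> B(1) by blast
    show "{j \<in> \<tau>. \<tau> - {j} \<in> \<B>} \<subseteq> X"
    proof
      fix j assume j: "j \<in> {j \<in> \<tau>. \<tau> - {j} \<in> \<B>}"
      show "j \<in> X"
      proof (rule ccontr)
        assume "j \<notin> X"
        then have "(\<tau> - {j}) \<inter> X = insert e (B \<inter> X)" using e by (auto simp: \<tau>_def)
        moreover have "card (insert e (B \<inter> X)) = Suc (card (B \<inter> X))"
          using e fB(2) by (intro card_insert_disjoint) auto
        moreover have "card ((\<tau> - {j}) \<inter> X) \<le> card (B \<inter> X)" using B(2) j by blast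
        ultimately show False by simp
      qed
    qed
  qed
qed

end

text \<open>Contraction of \<open>K\<close> combined with deletion of everything outside
  \<open>U\<close> and \<open>K\<close>. For the contraction by \<open>A\<close> it is applied with
  \<open>U = E - A\<close> and \<open>K\<close> a basis of \<open>A\<close>; the rest of
  \<open>A\<close> consists of loops once \<open>K\<close> is contracted.\<close>

lemma matroid_bases_minor:
  assumes \<B>: "matroid_bases E \<B>" and U: "U \<subseteq> E" "U \<inter> K = {}"
    and ne: "\<exists>I\<subseteq>U. I \<union> K \<in> \<B>"
  shows "matroid_bases U {I. I \<subseteq> U \<and> I \<union> K \<in> \<B>}"
  unfolding matroid_bases_def
proof (intro conjI ballI)
  show "finite U" using \<B> U finite_subset by (auto simp: matroid_bases_def)
  show "{I. I \<subseteq> U \<and> I \<union> K \<in> \<B>} \<noteq> {}" using ne by blast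
  fix X Y a assume *: "X \<in> {I. I \<subseteq> U \<and> I \<union> K \<in> \<B>}" "Y \<in> {I. I \<subseteq> U \<and> I \<union> K \<in> \<B>}" "a \<in> X - Y"
  then have "a \<in> (X \<union> K) - (Y \<union> K)" using U by blast
  with * \<B> obtain b where b: "b \<in> (Y \<union> K) - (X \<union> K)" "insert b (X \<union> K - {a}) \<in> \<B>"
    unfolding matroid_bases_def by (metis (no_types, lifting) mem_Collect_eq)
  have "insert b (X - {a}) \<union> K = insert b (X \<union> K - {a})" using * U by blast
  with b(2) have "insert b (X - {a}) \<union> K \<in> \<B>" by simp
  moreover have "insert b (X - {a}) \<subseteq> U" "b \<in> Y - X" using b(1) *(1,2) by blast+
  ultimately show "\<exists>b\<in>Y - X. insert b (X - {a}) \<in> {I. I \<subseteq> U \<and> I \<union> K \<in> \<B>}" by blast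
qed blast

section \<open>Valuated matroids\<close>

text \<open>The Dress-Wenzel exchange axiom in the minimum convention, stated for one ordered pair
  so that it can be assumed at distance two and proved for all bases.\<close>

definition valuated_exchange :: "'i set set \<Rightarrow> ('i set \<Rightarrow> 'g::linordered_ab_group_add) \<Rightarrow> 'i set \<Rightarrow> 'i set \<Rightarrow> bool" where
  "valuated_exchange \<B> \<omega> X Y \<longleftrightarrow> (\<forall>a\<in>X - Y. \<exists>b\<in>Y - X.
     insert b (X - {a}) \<in> \<B> \<and> insert a (Y - {b}) \<in> \<B> \<and>
     \<omega> (insert b (X - {a})) + \<omega> (insert a (Y - {b})) \<le> \<omega> X + \<omega> Y)"

lemma add_le_less_cancel:
  fixes p q s t c :: "'g::linordered_ab_group_add"
  assumes "p + q \<le> s + t" "t < q + c"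
  shows "p < s + c"
proof -
  have "(p + q) + t < (s + t) + (q + c)" using assms by (rule add_le_less_mono)
  then have "(q + t) + p < (q + t) + (s + c)" by (simp only: ac_simps)
  then show ?thesis by simp
qed

lemma add_le_less_exchange:
  fixes p q s t u c d :: "'g::linordered_ab_group_add"
  assumes "p + q \<le> s + t" "t < q + d" "u + d \<le> p + c"
  shows "u < s + c"
proof -
  have "p < s + d" using add_le_less_cancel assms(1,2) .
  then have "(u + d) + p < (p + c) + (s + d)" using assms(3) by (rule add_le_less_mono[rotated])
  then have "(d + p) + u < (d + p) + (s + c)" by (simp only: ac_simps)
  then show ?thesis by simp
qed

context basis_family
begin

text \<open>Murota's argument, by induction on the distance. A failure at \<open>a\<close> yields
  prices \<open>c\<close> at which every exchange of \<open>a\<close> into \<open>B\<close> is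
  strictly unfavourable. A cheapest exchange of another element \<open>a0\<close> into
  \<open>B\<close> brings \<open>B\<close> closer to \<open>A\<close>. The induction hypothesis
  there produces a basis \<open>?C\<close> at distance two from \<open>B\<close>, and local exchange
  between \<open>?C\<close> and \<open>B\<close> contradicts the strict inequality, in one case
  together with the choice of \<open>b0\<close>.\<close>

lemma valuated_exchange_if_local:
  fixes \<omega> :: "'i set \<Rightarrow> 'g::linordered_ab_group_add"
  assumes local: "\<And>X Y. \<lbrakk>X \<in> \<B>; Y \<in> \<B>; card (X - Y) = 2\<rbrakk> \<Longrightarrow> valuated_exchange \<B> \<omega> X Y"
    and eps: "(0::'g) < \<epsilon>"
    and "A \<in> \<B>" "B \<in> \<B>"
  shows "valuated_exchange \<B> \<omega> A B"
  using assms(3,4)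
proof (induction "card (A - B)" arbitrary: B rule: less_induct)
  case less
  note A = \<open>A \<in> \<B>\<close> and B = \<open>B \<in> \<B>\<close>
  note fA = basisD[OF A] and fB = basisD[OF B]
  have cards: "card (B - A) = card (A - B)"
    using fA fB by (metis card_le_sym_Diff nle_le)
  show ?case unfolding valuated_exchange_def
  proof (intro ballI, rule ccontr)
    fix a assume a: "a \<in> A - B"
    assume neg: "\<not> (\<exists>b\<in>B - A. insert b (A - {a}) \<in> \<B> \<and> insert a (B - {b}) \<in> \<B> \<and>
        \<omega> (insert b (A - {a})) + \<omega> (insert a (B - {b})) \<le> \<omega> A + \<omega> B)"
    \<comment> \<open>If \<open>insert b (A - {a})\<close> is a basis, the price is its excess over
      \<open>A\<close>, and strictness comes from \<open>neg\<close>. Otherwise the price is chosen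
      so that the inequality holds with slack \<open>\<epsilon>\<close>. The inequality is claimed
      only where \<open>insert a (B - {b})\<close> is a basis.\<close>
    define c where "c b = (if insert b (A - {a}) \<in> \<B> then \<omega> (insert b (A - {a})) - \<omega> A
        else \<omega> B - \<omega> (insert a (B - {b})) + \<epsilon>)" for b
    have c: "\<omega> B < \<omega> (insert a (B - {b})) + c b" if "b \<in> B - A" "insert a (B - {b}) \<in> \<B>" for b
    proof (cases "insert b (A - {a}) \<in> \<B>")
      case True
      then have "\<omega> A + \<omega> B < \<omega> (insert b (A - {a})) + \<omega> (insert a (B - {b}))"
        using neg that not_le by blast
      then show ?thesis using True by (simp add: c_def algebra_simps)
    next
      case False
      then show ?thesis using eps by (simp add: c_def)
    qed
    have "A - B \<noteq> {a}"
    proof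
      assume 1: "A - B = {a}"
      then obtain b where b: "B - A = {b}" using cards by (auto elim: card_1_obtains)
      have "insert b (A - {a}) = B" "insert a (B - {b}) = A" using 1 b by blast+
      then show False using neg A B b by (auto simp: add.commute)
    qed
    then obtain a0 where a0: "a0 \<in> A - B" "a0 \<noteq> a" using a by blast
    define T where "T = {b \<in> B - A. insert a0 (B - {b}) \<in> \<B>}"
    have "T \<noteq> {}" using dual_exchange[OF B A a0(1)] by (auto simp: T_def)
    moreover have "finite T" using fB by (simp add: T_def)
    ultimately obtain b0 where b0: "b0 \<in> T"
      and min: "\<And>b. b \<in> T \<Longrightarrow> \<omega> (insert a0 (B - {b0})) + c b0 \<le> \<omega> (insert a0 (B - {b})) + c b"
      using finite_obtains_min[of T "\<lambda>b. \<omega> (insert a0 (B - {b})) + c b"] by blast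
    let ?B = "insert a0 (B - {b0})"
    have b0': "b0 \<in> B - A" "?B \<in> \<B>" using b0 by (auto simp: T_def)
    have "A - ?B = (A - B) - {a0}" using b0' by blast
    then have "card (A - ?B) < card (A - B)" using a0 fA by (metis card_Diff1_less finite_Diff)
    then have "valuated_exchange \<B> \<omega> A ?B" using less.hyps A b0' by blast
    moreover have "a \<in> A - ?B" using a a0 by blast
    ultimately obtain b where b: "b \<in> ?B - A" "insert b (A - {a}) \<in> \<B>" "insert a (?B - {b}) \<in> \<B>"
      and le: "\<omega> (insert b (A - {a})) + \<omega> (insert a (?B - {b})) \<le> \<omega> A + \<omega> ?B"
      unfolding valuated_exchange_def by blast
    let ?C = "insert a (?B - {b})"
    have bB: "b \<in> B - A" "b \<noteq> b0" using b a0 by auto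
    \<comment> \<open>\<open>?C\<close> arises from \<open>B\<close> by replacing \<open>b0\<close>
      and \<open>b\<close> with \<open>a0\<close> and \<open>a\<close>, so the hypothesis on pairs
      at distance two applies.\<close>
    have "?C - B = {a, a0}" "B - ?C = {b, b0}" using a a0 b0' bB b by blast+
    then have loc: "valuated_exchange \<B> \<omega> ?C B" using a0 by (intro local b B) auto
    then obtain y where y: "y \<in> {b, b0}" "insert y (?C - {a}) \<in> \<B>" "insert a (B - {y}) \<in> \<B>"
       "\<omega> (insert y (?C - {a})) + \<omega> (insert a (B - {y})) \<le> \<omega> ?C + \<omega> B"
      using \<open>?C - B = {a, a0}\<close> \<open>B - ?C = {b, b0}\<close> unfolding valuated_exchange_def by simp blast
    have cb: "c b = \<omega> (insert b (A - {a})) - \<omega> A" using b by (simp add: c_def)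
    then have "\<omega> (insert b (A - {a})) = \<omega> A + c b" by simp
    with le have "\<omega> A + (c b + \<omega> ?C) \<le> \<omega> A + \<omega> ?B" by (simp only: add.assoc)
    \<comment> \<open>The induction hypothesis in terms of prices; both cases below produce the
      opposite strict inequality.\<close>
    then have le': "\<omega> ?C + c b \<le> \<omega> ?B" by (simp add: add.commute)
    show False
    proof (cases "y = b")
      case True
      have eq: "insert b (?C - {a}) = ?B" using a a0 b0' bB b by blast
      have le'': "\<omega> ?B + \<omega> (insert a (B - {b})) \<le> \<omega> ?C + \<omega> B" using y(4) by (simp only: True eq)
      have "\<omega> B < \<omega> (insert a (B - {b})) + c b" using c[of b] bB(1) y(3) True by blast
      from add_le_less_cancel[OF le'' this] le' show False by simp
    next
      case False
      then have y0: "y = b0" using y by blast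
      have eq: "insert b0 (?C - {a}) = insert a0 (B - {b})" using a a0 b0' bB b by blast
      have le'': "\<omega> (insert a0 (B - {b})) + \<omega> (insert a (B - {b0})) \<le> \<omega> ?C + \<omega> B"
        using y(4) by (simp only: y0 eq)
      have lt: "\<omega> B < \<omega> (insert a (B - {b0})) + c b0" using c[of b0] b0'(1) y(3) y0 by blast
      have "insert a0 (B - {b}) \<in> \<B>" using y(2) by (simp only: y0 eq)
      then have "b \<in> T" using bB(1) by (simp add: T_def)
      from add_le_less_exchange[OF le'' lt min[OF this]] le' show False by simp
    qed
  qed
qed

text \<open>Two minimizers exchange into two bases whose values sum to at most twice the minimum, so
  both new bases are minimizers.\<close>

lemma matroid_bases_minimizers:
  fixes \<omega> :: "'i set \<Rightarrow> 'g::linordered_ab_group_add"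
  assumes local: "\<And>X Y. \<lbrakk>X \<in> \<B>; Y \<in> \<B>; card (X - Y) = 2\<rbrakk> \<Longrightarrow> valuated_exchange \<B> \<omega> X Y"
  shows "matroid_bases E {X \<in> \<B>. \<forall>Y\<in>\<B>. \<omega> X \<le> \<omega> Y}" (is "matroid_bases E ?M")
proof (cases "\<exists>\<epsilon>. (0::'g) < \<epsilon>")
  case True
  then obtain \<epsilon> where eps: "(0::'g) < \<epsilon>" by blast
  show ?thesis unfolding matroid_bases_def
  proof (intro conjI ballI)
    show "finite E" by (fact finite_ground)
    show "?M \<subseteq> Pow E" using basisD(1) by blast
    obtain X where "X \<in> \<B>" "\<And>Y. Y \<in> \<B> \<Longrightarrow> \<omega> X \<le> \<omega> Y"
      using finite_obtains_min[OF finite_bases basis_nonempty, of \<omega>] by blast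
    then show "?M \<noteq> {}" by blast
    fix A B a assume "A \<in> ?M" "B \<in> ?M" and a: "a \<in> A - B"
    then have A: "A \<in> \<B>" "\<And>Y. Y \<in> \<B> \<Longrightarrow> \<omega> A \<le> \<omega> Y"
      and B: "B \<in> \<B>" "\<And>Y. Y \<in> \<B> \<Longrightarrow> \<omega> B \<le> \<omega> Y" by simp_all
    have "valuated_exchange \<B> \<omega> A B"
      using valuated_exchange_if_local[OF local eps A(1) B(1)] .
    with a obtain b where b: "b \<in> B - A" "insert b (A - {a}) \<in> \<B>" "insert a (B - {b}) \<in> \<B>"
      and le: "\<omega> (insert b (A - {a})) + \<omega> (insert a (B - {b})) \<le> \<omega> A + \<omega> B"
      unfolding valuated_exchange_def by meson
    have "\<omega> (insert b (A - {a})) + \<omega> B \<le> \<omega> A + \<omega> B"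
      using add_left_mono[OF B(2)[OF b(3)]] le by (rule order_trans)
    then have "\<omega> (insert b (A - {a})) \<le> \<omega> A" by simp
    then have "\<forall>Y\<in>\<B>. \<omega> (insert b (A - {a})) \<le> \<omega> Y" using A(2) order_trans by (intro ballI) fast
    with b(1,2) show "\<exists>b\<in>B - A. insert b (A - {a}) \<in> ?M" by (intro bexI[of _ b]) simp_all
  qed
next
  case False
  \<comment> \<open>Without a positive element to serve as \<open>\<epsilon>\<close> the value group
    is trivial, all values coincide, and every basis is a minimizer.\<close>
  have "x \<le> y" for x y :: 'g
  proof (rule ccontr)
    assume "\<not> x \<le> y"
    then have "0 < x - y" by simp
    then show False using False by blast
  qed
  then have "?M = \<B>" by simp
  then show ?thesis using bases by simp
qed

end

section \<open>Arithmetic in a tract\<close>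

lemma card_filter_insert:
  assumes "finite S" "x \<notin> S"
  shows "card {k \<in> insert x S. Q k} = of_bool (Q x) + card {k \<in> S. Q k}"
proof -
  have "{k \<in> insert x S. Q k} = (if Q x then insert x {k \<in> S. Q k} else {k \<in> S. Q k})" by auto
  then show ?thesis using assms by simp
qed

lemma formal_sum_single:
  assumes "{j \<in> A. f j \<noteq> None} = {a}"
  shows "formal_sum f A = {#the (f a)#}"
  unfolding formal_sum_def assms by simp

lemma supp_scale [simp]: "supp (scale F c X) = supp X"
  by (auto simp: supp_def scale_def opt_mult_def split: option.splits)

lemma opt_mult_None [simp]: "opt_mult F None x = None" "opt_mult F x None = None"
  by (auto simp: opt_mult_def split: option.splits)

lemma opt_mult_Some [simp]: "opt_mult F (Some a) (Some b) = Some (a \<otimes>\<^bsub>F\<^esub> b)"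
  by (simp add: opt_mult_def)

lemma opt_mult_eq_None_iff [simp]: "opt_mult F x y = None \<longleftrightarrow> x = None \<or> y = None"
  by (cases x; cases y) auto

lemma circuit_vector_outside [simp]: "i \<notin> \<tau> \<Longrightarrow> circuit_vector F P \<tau> i = None"
  by (simp add: circuit_vector_def)

lemma supp_circuit_vector: "supp (circuit_vector F P \<tau>) = {i \<in> \<tau>. \<tau> - {i} \<in> supp P}"
  by (auto simp: supp_def circuit_vector_def simp del: not_None_eq)

context tract
begin

abbreviation omult (infixl "\<odot>" 70) where "omult \<equiv> opt_mult F"

abbreviation pm :: "nat \<Rightarrow> 'a option" where "pm n \<equiv> Some (neg_one F [^] n)"

lemma neg_one: "neg_one F \<in> carrier F" "{#\<one>, neg_one F#} \<in> null_set F"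
  using theI'[OF ex1_neg_one] by (simp_all add: neg_one_def)

lemma neg_one_unique: "e \<in> carrier F \<Longrightarrow> {#\<one>, e#} \<in> null_set F \<Longrightarrow> e = neg_one F"
  using ex1_neg_one neg_one by blast

lemma neg_one_pow_closed [simp]: "neg_one F [^] (n::nat) \<in> carrier F"
  by (simp add: neg_one)

lemma null_pair:
  assumes "{#a, b#} \<in> null_set F"
  shows "b = neg_one F \<otimes> a"
proof -
  have ab: "a \<in> carrier F" "b \<in> carrier F" using null_set_closed[OF assms] by auto
  have "{#inv a \<otimes> a, inv a \<otimes> b#} \<in> null_set F"
    using null_set_scale[OF assms, of "inv a"] ab by simp
  then have "inv a \<otimes> b = neg_one F" using ab by (intro neg_one_unique) simp_all
  then show ?thesis using ab by (metis inv_closed inv_solve_left m_comm neg_one(1))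
qed

lemma neg_one_square: "neg_one F \<otimes> neg_one F = \<one>"
proof -
  have "{#neg_one F, \<one>#} \<in> null_set F" using neg_one by (simp add: add_mset_commute)
  from null_pair[OF this] show ?thesis by simp
qed

text \<open>Every sign identity below is reduced by this to the parity of an exponent.\<close>

lemma neg_one_pow_cong:
  fixes m n :: nat
  assumes "even m \<longleftrightarrow> even n"
  shows "neg_one F [^] m = neg_one F [^] n"
proof -
  have eq: "neg_one F [^] k = (if even k then \<one> else neg_one F)" for k :: nat
  proof (induction k)
    case (Suc k)
    then show ?case using neg_one neg_one_square by simp
  qed simp
  show ?thesis unfolding eq assms ..
qed

lemma null_singleton: "{#a#} \<notin> null_set F"
proof
  assume a: "{#a#} \<in> null_set F"
  then have "a \<in> carrier F" using null_set_closed by fastforce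
  then show False using null_set_scale[OF a, of "inv a"] one_notin_null_set by simp
qed

lemma omult_closed:
  "set_option x \<subseteq> carrier F \<Longrightarrow> set_option y \<subseteq> carrier F \<Longrightarrow> set_option (x \<odot> y) \<subseteq> carrier F"
  by (cases x; cases y) auto

lemma omult_assoc:
  "\<lbrakk>set_option x \<subseteq> carrier F; set_option y \<subseteq> carrier F; set_option z \<subseteq> carrier F\<rbrakk>
    \<Longrightarrow> x \<odot> y \<odot> z = x \<odot> (y \<odot> z)"
  by (cases x; cases y; cases z) (auto simp: m_assoc)

lemma omult_comm:
  "\<lbrakk>set_option x \<subseteq> carrier F; set_option y \<subseteq> carrier F\<rbrakk> \<Longrightarrow> x \<odot> y = y \<odot> x"
  by (cases x; cases y) (auto simp: m_comm)

lemma omult_lcomm: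
  "\<lbrakk>set_option x \<subseteq> carrier F; set_option y \<subseteq> carrier F; set_option z \<subseteq> carrier F\<rbrakk>
    \<Longrightarrow> x \<odot> (y \<odot> z) = y \<odot> (x \<odot> z)"
  by (cases x; cases y; cases z) (auto simp: m_lcomm)

lemma omult_one: "set_option x \<subseteq> carrier F \<Longrightarrow> Some \<one> \<odot> x = x"
  by (cases x) auto

lemma pm_pm_omult: "set_option x \<subseteq> carrier F \<Longrightarrow> pm m \<odot> (pm n \<odot> x) = pm (m + n) \<odot> x"
  by (subst omult_assoc[symmetric]) (auto simp: nat_pow_mult neg_one)

lemma pm_even: "even (n::nat) \<Longrightarrow> neg_one F [^] n = \<one>"
  using neg_one_pow_cong[of n 0] by simp

text \<open>Signs are their own inverses, so moving one to the other side adds exponents and avoids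
  subtraction of natural numbers.\<close>

lemma pm_transfer:
  assumes "pm m \<odot> x = pm n \<odot> y" "set_option x \<subseteq> carrier F" "set_option y \<subseteq> carrier F"
  shows "x = pm (m + n) \<odot> y"
proof -
  have "x = pm (m + m) \<odot> x" using assms(2) by (simp add: pm_even omult_one)
  also have "\<dots> = pm m \<odot> (pm m \<odot> x)" using assms(2) by (simp add: pm_pm_omult)
  also have "\<dots> = pm (m + n) \<odot> y" using assms(3) by (simp only: assms(1) pm_pm_omult)
  finally show ?thesis .
qed

text \<open>Turns a vanishing two-by-two minor into a proportionality factor, with \<open>u\<close>
  and \<open>v\<close> as the nonzero pivots.\<close>

lemma omult_cross:
  assumes "x \<odot> Some u = y \<odot> Some v" "u \<in> carrier F" "v \<in> carrier F"
    and "set_option x \<subseteq> carrier F" "set_option y \<subseteq> carrier F"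
  shows "x = Some (v \<otimes> inv u) \<odot> y"
proof (cases x; cases y)
  fix a b assume "x = Some a" "y = Some b"
  with assms have ab: "a \<in> carrier F" "b \<in> carrier F" "a \<otimes> u = b \<otimes> v" by auto
  then have "a = b \<otimes> v \<otimes> inv u" using assms by (metis inv_solve_right m_closed)
  also have "\<dots> = v \<otimes> inv u \<otimes> b" using ab assms by (simp add: m_ac)
  finally show ?thesis using \<open>x = Some a\<close> \<open>y = Some b\<close> by simp
qed (use assms in auto)

lemma scale_scale:
  assumes "c \<in> carrier F" "d \<in> carrier F" "\<And>k. set_option (X k) \<subseteq> carrier F"
  shows "scale F c (scale F d X) = scale F (c \<otimes> d) X"
  using assms omult_assoc[of "Some c" "Some d"] by (simp add: scale_def)

lemma scale_one: "(\<And>k. set_option (X k) \<subseteq> carrier F) \<Longrightarrow> scale F \<one> X = X"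
  by (simp add: scale_def omult_one)

lemma scale_closed:
  "c \<in> carrier F \<Longrightarrow> (\<And>k. set_option (X k) \<subseteq> carrier F) \<Longrightarrow> set_option (scale F c X k) \<subseteq> carrier F"
  by (simp add: scale_def omult_closed)

lemma scale_inverse:
  assumes "c \<in> carrier F" "\<And>k. set_option (X k) \<subseteq> carrier F" "Y = scale F c X"
  shows "X = scale F (inv c) Y"
  using assms by (simp add: scale_scale scale_one)

text \<open>A lone term is never null, so the two candidates are both zero or both present; in the
  latter case uniqueness of \<open>-1\<close> makes them negatives of each other.\<close>

lemma two_term_sum:
  assumes "formal_sum f A \<in> null_set F" "finite A" "a \<in> A" "b \<in> A" "a \<noteq> b"
    and "\<And>j. j \<in> A - {a, b} \<Longrightarrow> f j = None"
  shows "f b = Some (neg_one F) \<odot> f a"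
proof -
  let ?S = "{j \<in> A. f j \<noteq> None}"
  have sub: "?S \<subseteq> {a, b}"
  proof (intro subsetI, rule ccontr)
    fix j assume "j \<in> ?S" "j \<notin> {a, b}"
    then show False using assms(6)[of j] by simp
  qed
  have not_single: "?S \<noteq> {k}" for k
  proof
    assume "?S = {k}"
    from formal_sum_single[OF this] show False using assms(1) null_singleton by simp
  qed
  show ?thesis
  proof (cases "f a = None \<or> f b = None")
    case True
    then have "?S = {a} \<or> ?S = {b} \<or> f a = None \<and> f b = None"
      using sub assms(3,4) by (auto simp del: not_None_eq)
    then show ?thesis using not_single by simp
  next
    case False
    then have "?S = {a, b}" using sub assms(3,4) by (auto simp del: not_None_eq)
    then have "formal_sum f A = {#the (f a), the (f b)#}"
      unfolding formal_sum_def using assms(5) by simp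
    with assms(1) have "the (f b) = neg_one F \<otimes> the (f a)" by (intro null_pair) (simp only:)
    then show ?thesis using False by auto
  qed
qed

end

section \<open>Weak Pluecker vectors\<close>

context tract
begin

lemma plucker_function_closed:
  assumes "plucker_function F E r P"
  shows "set_option (P X) \<subseteq> carrier F"
proof (cases "P X")
  case (Some a)
  then have "X \<in> supp P" by (simp add: supp_def)
  then have "the (P X) \<in> carrier F" using assms unfolding plucker_function_def by blast
  then show ?thesis using Some by simp
qed simp

lemma circuit_vector_closed:
  "plucker_function F E r P \<Longrightarrow> set_option (circuit_vector F P \<tau> i) \<subseteq> carrier F"
  by (simp add: circuit_vector_def omult_closed plucker_function_closed)

text \<open>At index \<open>a\<close> the relation has the term built from \<open>P X\<close> and
  \<open>P Y\<close>, which is nonzero. It cannot be the only one, and the index of a second nonzero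
  term is the required \<open>b\<close>.\<close>

lemma exchange_if_plucker_relation:
  assumes rel: "plucker_relation F P (X - {a}) (insert a Y)"
    and XY: "X \<in> supp P" "Y \<in> supp P" "a \<in> X - Y"
  obtains b where "b \<in> Y - X" "insert b (X - {a}) \<in> supp P" "insert a (Y - {b}) \<in> supp P"
proof -
  let ?I = "X - {a}" and ?J = "insert a Y"
  define f where "f j = Some (plucker_sign F j ?I ?J) \<odot> (P (insert j ?I) \<odot> P (?J - {j}))" for j
  have diff: "?J - ?I = insert a (Y - X)" using XY by blast
  have fa: "insert a ?I = X" "?J - {a} = Y" using XY by auto
  then have "f a \<noteq> None" using XY by (simp add: f_def supp_def)
  moreover have "\<not> {j \<in> ?J - ?I. f j \<noteq> None} = {a}"
  proof
    assume "{j \<in> ?J - ?I. f j \<noteq> None} = {a}"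
    from formal_sum_single[OF this] show False
      using rel null_singleton unfolding plucker_relation_def f_def[symmetric] by simp
  qed
  ultimately obtain b where b: "b \<in> Y - X" "f b \<noteq> None" "b \<noteq> a" unfolding diff by blast
  moreover have "?J - {b} = insert a (Y - {b})" using b by auto
  ultimately show ?thesis using that[of b] by (simp add: f_def supp_def)
qed

lemma weak_if_strong:
  assumes "finite E" and P: "plucker_vector Strong F E r P"
  shows "plucker_vector Weak F E r P"
proof -
  have pf: "plucker_function F E r P" using P by simp
  then have ne: "supp P \<noteq> {}" and sub: "supp P \<subseteq> nsets E r" by (simp_all add: plucker_function_def)
  have rel: "\<lbrakk>I \<subseteq> E; J \<subseteq> E; card I + 1 = r; card J = r + 1\<rbrakk> \<Longrightarrow> plucker_relation F P I J" for I J
    using P by simp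
  have "matroid_bases E (supp P)" unfolding matroid_bases_def
  proof (intro conjI ballI)
    show "supp P \<subseteq> Pow E" using sub by (auto simp: nsets_def)
    fix X Y a assume XY: "X \<in> supp P" "Y \<in> supp P" "a \<in> X - Y"
    then have X: "X \<subseteq> E" "finite X" "card X = r" and Y: "Y \<subseteq> E" "finite Y" "card Y = r"
      using sub by (auto simp: nsets_def)
    have "plucker_relation F P (X - {a}) (insert a Y)"
    proof (rule rel)
      show "card (X - {a}) + 1 = r" using X(2,3) XY(3) card_Suc_Diff1[of X a] by simp
      show "card (insert a Y) = r + 1" using Y(2,3) XY(3) by simp
      show "X - {a} \<subseteq> E" using X(1) by blast
      show "insert a Y \<subseteq> E" using Y(1) X(1) XY(3) by blast
    qed
    then obtain b where "b \<in> Y - X" "insert b (X - {a}) \<in> supp P"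
      using XY by (rule exchange_if_plucker_relation)
    then show "\<exists>b\<in>Y - X. insert b (X - {a}) \<in> supp P" by blast
  next
    show "finite E" by fact
    show "supp P \<noteq> {}" by fact
  qed
  with pf show ?thesis using assms(1) rel by simp
qed

lemma weak_if_plucker_vector:
  assumes "finite E" "plucker_vector s F E r P"
  shows "plucker_vector Weak F E r P"
proof (cases s)
  case Weak
  with assms(2) show ?thesis by (simp only:)
next
  case Strong
  with assms(2) have "plucker_vector Strong F E r P" by (simp only:)
  then show ?thesis by (rule weak_if_strong[OF assms(1)])
qed

end

locale weak_plucker = tract F for F (structure) +
  fixes E :: "'i::linorder set" and r :: nat and P :: "'i set \<Rightarrow> 'a option"
  assumes weak: "plucker_vector Weak F E r P"
begin

lemma pf: "plucker_function F E r P"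
  using weak unfolding plucker_vector.simps by (rule conjunct1)

lemmas P_closed [simp] = plucker_function_closed[OF pf]
lemmas circuit_closed [simp] = circuit_vector_closed[OF pf]

sublocale basis_family E "supp P" r
proof unfold_locales
  show "matroid_bases E (supp P)" using weak unfolding plucker_vector.simps by (elim conjE)
  show "supp P \<subseteq> nsets E r" using pf unfolding plucker_function_def by (elim conjE)
qed

lemma relation:
  "\<lbrakk>I \<subseteq> E; J \<subseteq> E; card I + 1 = r; card J = r + 1; card (J - I) = 3\<rbrakk> \<Longrightarrow> plucker_relation F P I J"
  using weak unfolding plucker_vector.simps by (elim conjE allE[of _ I] allE[of _ J] impE) (intro conjI)

text \<open>Bases at distance two lead to an index set of size three, the case that the weak axioms
  grant.\<close>

lemma local_relation:
  assumes XY: "X \<in> supp P" "Y \<in> supp P" "card (X - Y) = 2" "a \<in> X - Y"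
  shows "plucker_relation F P (X - {a}) (insert a Y)"
proof (rule relation)
  note X = basisD[OF XY(1)] and Y = basisD[OF XY(2)]
  show "card (X - {a}) + 1 = r" using X(2,3) XY(4) card_Suc_Diff1[of X a] by simp
  show "card (insert a Y) = r + 1" using Y(2,3) XY(4) by simp
  show "X - {a} \<subseteq> E" using X(1) by blast
  show "insert a Y \<subseteq> E" using Y(1) X(1) XY(4) by blast
  have "insert a Y - (X - {a}) = insert a (Y - X)" using XY(4) by blast
  moreover have "card (Y - X) = card (X - Y)"
    using X(2,3) Y(2,3) card_le_sym_Diff[of X Y] card_le_sym_Diff[of Y X] by simp
  ultimately show "card (insert a Y - (X - {a})) = 3" using XY(3,4) Y(2) by simp
qed

text \<open>The relation at \<open>insert x S\<close> and at \<open>S\<close> enlarged by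
  \<open>i\<close>, \<open>j\<close>, \<open>z\<close> has terms indexed by \<open>i\<close>,
  \<open>j\<close>, \<open>z\<close>. The assumption \<open>zero\<close> kills the one at
  \<open>z\<close>, so the other two are negatives of each other.\<close>

lemma three_term:
  assumes fin: "finite S" and S: "insert i (insert j (insert x (insert z S))) \<subseteq> E" "card S + 2 = r"
    and dist: "distinct [i, j, x, z]" "{i, j, x, z} \<inter> S = {}"
    and zero: "insert x (insert z S) \<notin> supp P \<or> insert i (insert j S) \<notin> supp P"
  shows "P (insert x (insert j S)) \<odot> P (insert z (insert i S)) =
    pm (of_bool (x < i) + of_bool (x < j) + of_bool (z < i) + of_bool (z < j)) \<odot>
      (P (insert x (insert i S)) \<odot> P (insert z (insert j S)))"
proof -
  define I J where "I = insert x S" and "J = insert z (insert i (insert j S))"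
  define f where "f k = Some (plucker_sign F k I J) \<odot> (P (insert k I) \<odot> P (J - {k}))" for k
  have diff: "J - I = {i, j, z}" using dist by (auto simp: I_def J_def)
  have "plucker_relation F P I J"
    using fin S dist by (intro relation) (simp_all add: diff, auto simp: I_def J_def)
  then have "formal_sum f {i, j, z} \<in> null_set F"
    unfolding plucker_relation_def f_def diff .
  moreover have "J - {z} = insert i (insert j S)" "insert z I = insert x (insert z S)"
    using dist by (auto simp: J_def I_def)
  then have "f z = None" using zero by (auto simp: f_def supp_def)
  ultimately have eq: "f j = Some (neg_one F) \<odot> f i"
    using dist by (intro two_term_sum) auto
  define m n where "m = card {k \<in> J. i < k} + card {k \<in> I. i < k}"
    and "n = card {k \<in> J. j < k} + card {k \<in> I. j < k}"
  have "J - {i} = insert z (insert j S)" "J - {j} = insert z (insert i S)"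
    "insert i I = insert x (insert i S)" "insert j I = insert x (insert j S)"
    using dist by (auto simp: J_def I_def)
  then have f: "f i = pm m \<odot> (P (insert x (insert i S)) \<odot> P (insert z (insert j S)))"
    "f j = pm n \<odot> (P (insert x (insert j S)) \<odot> P (insert z (insert i S)))"
    by (simp_all add: f_def plucker_sign_def m_def n_def)
  have "Some (neg_one F) = pm 1" using neg_one by simp
  with eq have "f j = pm 1 \<odot> f i" by (simp only:)
  then have "pm n \<odot> (P (insert x (insert j S)) \<odot> P (insert z (insert i S))) =
    pm (1 + m) \<odot> (P (insert x (insert i S)) \<odot> P (insert z (insert j S)))"
    unfolding f by (simp only: pm_pm_omult omult_closed P_closed)
  from pm_transfer[OF this] have "P (insert x (insert j S)) \<odot> P (insert z (insert i S)) =
    pm (n + (1 + m)) \<odot> (P (insert x (insert i S)) \<odot> P (insert z (insert j S)))"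
    by (simp only: omult_closed P_closed)
  \<comment> \<open>Both \<open>m\<close> and \<open>n\<close> count elements of \<open>S\<close>
    twice. Exactly one of \<open>i < j\<close> and \<open>j < i\<close> holds, which cancels against
    the extra \<open>1\<close>. Only the positions of \<open>x\<close> and \<open>z\<close> relative
    to \<open>i\<close> and \<open>j\<close> remain.\<close>
  moreover have "even (n + (1 + m)) \<longleftrightarrow>
      even (of_bool (x < i) + of_bool (x < j) + of_bool (z < i) + of_bool (z < j) :: nat)"
  proof -
    have flip: "i < x \<longleftrightarrow> \<not> x < i" "j < x \<longleftrightarrow> \<not> x < j" "i < z \<longleftrightarrow> \<not> z < i" "j < z \<longleftrightarrow> \<not> z < j"
      "i < j \<longleftrightarrow> \<not> j < i" using dist by auto
    have "card {k \<in> insert i (insert j S). Q k} = of_bool (Q i) + (of_bool (Q j) + card {k \<in> S. Q k})" for Q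
      using dist fin card_filter_insert[of S j Q] card_filter_insert[of "insert j S" i Q] by simp
    moreover have "card {k \<in> J. Q k} = of_bool (Q z) + card {k \<in> insert i (insert j S). Q k}" for Q
      unfolding J_def using dist fin by (intro card_filter_insert) auto
    moreover have "card {k \<in> I. Q k} = of_bool (Q x) + card {k \<in> S. Q k}" for Q
      unfolding I_def using dist fin by (intro card_filter_insert) auto
    ultimately have "m = of_bool (i < z) + (of_bool (i < j) + card {k \<in> S. i < k}) + (of_bool (i < x) + card {k \<in> S. i < k})"
      "n = of_bool (j < z) + (of_bool (j < i) + card {k \<in> S. j < k}) + (of_bool (j < x) + card {k \<in> S. j < k})"
      by (simp_all add: m_def n_def)
    then show ?thesis unfolding flip
      by (cases "x < i"; cases "x < j"; cases "z < i"; cases "z < j"; cases "j < i"; simp)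
  qed
  ultimately show ?thesis using neg_one_pow_cong by metis
qed

end

section \<open>Circuits\<close>

text \<open>Circuits read off from a single representative; \<open>circuits_eq_circuit_set\<close>
  shows that the whole scaling class yields the same set.\<close>

definition circuit_set ::
    "('f, 'm) tract_scheme \<Rightarrow> 'i::linorder set \<Rightarrow> nat \<Rightarrow> ('i set \<Rightarrow> 'f option) \<Rightarrow> ('i \<Rightarrow> 'f option) set" where
  "circuit_set F E r P = {scale F c (circuit_vector F P \<tau>) | c \<tau>.
     c \<in> carrier F \<and> \<tau> \<in> nsets E (r + 1) \<and> supp (circuit_vector F P \<tau>) \<noteq> {}}"

lemma (in tract) pm_omult_pm:
  assumes "set_option x \<subseteq> carrier F" "set_option y \<subseteq> carrier F"
  shows "(pm m \<odot> x) \<odot> (pm n \<odot> y) = pm (m + n) \<odot> (x \<odot> y)"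
  using assms neg_one by (cases x; cases y) (auto simp: m_ac simp flip: nat_pow_mult)

section \<open>Bases of largest trace on a set, and comparison of circuit vectors\<close>

context weak_plucker
begin

lemma local_exchange:
  assumes "X \<in> supp P" "Y \<in> supp P" "card (X - Y) = 2" "a \<in> X - Y"
  obtains b where "b \<in> Y - X" "insert b (X - {a}) \<in> supp P" "insert a (Y - {b}) \<in> supp P"
  using exchange_if_plucker_relation[OF local_relation[OF assms] assms(1,2,4)] .

definition max_bases :: "'i set \<Rightarrow> 'i set set" where
  "max_bases A = {D \<in> supp P. \<forall>X\<in>supp P. card (X \<inter> A) \<le> card (D \<inter> A)}"

lemma max_basesD:
  assumes "D \<in> max_bases A"
  shows "D \<in> supp P" "X \<in> supp P \<Longrightarrow> card (X \<inter> A) \<le> card (D \<inter> A)"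
  using assms by (simp_all add: max_bases_def)

lemma max_bases_empty: "max_bases {} = supp P"
  by (simp add: max_bases_def)

lemma max_bases_card_eq: "D \<in> max_bases A \<Longrightarrow> D' \<in> max_bases A \<Longrightarrow> card (D \<inter> A) = card (D' \<inter> A)"
  using max_basesD by (metis nle_le)

lemma obtain_max_basis: obtains G where "G \<in> max_bases A"
proof -
  obtain G where "G \<in> supp P" "\<And>X. X \<in> supp P \<Longrightarrow> card (X \<inter> A) \<le> card (G \<inter> A)"
    using finite_obtains_max[OF finite_bases basis_nonempty, of "\<lambda>X. card (X \<inter> A)"] by blast
  then have "G \<in> max_bases A" by (simp add: max_bases_def)
  then show ?thesis by (rule that)
qed

text \<open>
  These are the bases of \<open>M|A \<oplus> M/A\<close>, the initial matroid of \<open>M\<close> with trivial valuation at the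
  indicator vector of \<open>A\<close>.
\<close>

lemma basis_family_max_bases: "basis_family E (max_bases A) r"
proof
  define \<omega> where "\<omega> D = - int (card (D \<inter> A))" for D
  have val: "valuated_exchange (supp P) \<omega> X Y"
    if XY: "X \<in> supp P" "Y \<in> supp P" "card (X - Y) = 2" for X Y
    unfolding valuated_exchange_def
  proof
    fix a assume a: "a \<in> X - Y"
    obtain b where b: "b \<in> Y - X" "insert b (X - {a}) \<in> supp P" "insert a (Y - {b}) \<in> supp P"
      using local_exchange[OF XY a] .
    have ins: "\<omega> (insert x S) = \<omega> S - of_bool (x \<in> A)" if "finite S" "x \<notin> S" for x S
    proof -
      have "insert x S \<inter> A = {k \<in> insert x S. k \<in> A}" "S \<inter> A = {k \<in> S. k \<in> A}" by auto
      then show ?thesis using card_filter_insert[OF that, of "\<lambda>k. k \<in> A"] by (simp only: \<omega>_def) simp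
    qed
    have "finite X" "finite Y" using basisD XY by auto
    \<comment> \<open>This valuation is modular: the exchanged sets together contain the same
      elements as \<open>X\<close> and \<open>Y\<close>, with multiplicity, so the exchange
      inequality is even an equality.\<close>
    then have "\<omega> (insert b (X - {a})) + \<omega> (insert a (Y - {b})) = \<omega> (insert a (X - {a})) + \<omega> (insert b (Y - {b}))"
      using a b(1) by (subst (1 2 3 4) ins) auto
    also have "\<dots> = \<omega> X + \<omega> Y" using a b(1) by (simp add: insert_absorb)
    finally have "\<omega> (insert b (X - {a})) + \<omega> (insert a (Y - {b})) \<le> \<omega> X + \<omega> Y"
      by (rule eq_refl)
    with b show "\<exists>b\<in>Y - X. insert b (X - {a}) \<in> supp P \<and> insert a (Y - {b}) \<in> supp P \<and>
        \<omega> (insert b (X - {a})) + \<omega> (insert a (Y - {b})) \<le> \<omega> X + \<omega> Y"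
      by blast
  qed
  have eq: "max_bases A = {X \<in> supp P. \<forall>Y\<in>supp P. \<omega> X \<le> \<omega> Y}"
    by (simp add: max_bases_def \<omega>_def)
  show "matroid_bases E (max_bases A)" unfolding eq by (rule matroid_bases_minimizers[OF val])
  show "max_bases A \<subseteq> nsets E r" using uniform by (auto simp: max_bases_def)
qed

text \<open>The four values of \<open>P\<close> in the two surviving products of the three-term
  relation are, up to sign, the coordinates \<open>i\<close> and \<open>j\<close> of the circuit
  vectors on \<open>X\<close> and \<open>Z\<close>. The ratio of these coordinates thus agrees; it
  is stated in cross-multiplied form because coordinates may be zero.\<close>

lemma circuit_vector_adjacent:
  assumes fin: "finite S" and S: "insert i (insert j (insert x (insert z S))) \<subseteq> E" "card S + 2 = r"
    and dist: "distinct [i, j, x, z]" "{i, j, x, z} \<inter> S = {}"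
    and zero: "insert x (insert z S) \<notin> supp P \<or> insert i (insert j S) \<notin> supp P"
    and X: "X = insert i (insert j (insert x S))" and Z: "Z = insert i (insert j (insert z S))"
  shows "circuit_vector F P Z j \<odot> circuit_vector F P X i = circuit_vector F P X j \<odot> circuit_vector F P Z i"
proof -
  let ?l = "\<lambda>k T. card {t \<in> T. t < k}"
  have diff: "X - {j} = insert x (insert i S)" "X - {i} = insert x (insert j S)"
    "Z - {j} = insert z (insert i S)" "Z - {i} = insert z (insert j S)"
    using dist by (auto simp: X Z)
  let ?p = "P (insert x (insert i S)) \<odot> P (insert z (insert j S))"
  let ?n = "of_bool (x < i) + of_bool (x < j) + of_bool (z < i) + of_bool (z < j) :: nat"
  have "circuit_vector F P Z j \<odot> circuit_vector F P X i =
      pm (?l j Z + ?l i X) \<odot> (P (insert x (insert j S)) \<odot> P (insert z (insert i S)))"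
    using omult_comm[of "P (insert x (insert j S))"]
    by (simp add: circuit_vector_def diff pm_omult_pm) (simp add: X Z)
  also have "\<dots> = pm (?l j Z + ?l i X + ?n) \<odot> ?p"
    unfolding three_term[OF fin S dist zero] by (simp only: pm_pm_omult omult_closed P_closed)
  also have "pm (?l j Z + ?l i X + ?n) = pm (?l j X + ?l i Z)"
  proof -
    have "card {k \<in> insert i (insert j S). Q k} = of_bool (Q i) + (of_bool (Q j) + card {k \<in> S. Q k})" for Q
      using dist fin card_filter_insert[of S j Q] card_filter_insert[of "insert j S" i Q] by simp
    moreover have "card {k \<in> insert t (insert i (insert j S)). Q k} = of_bool (Q t) + card {k \<in> insert i (insert j S). Q k}"
      if "t \<in> {x, z}" for t Q
      using dist fin that by (intro card_filter_insert) auto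
    moreover have "X = insert x (insert i (insert j S))" "Z = insert z (insert i (insert j S))"
      by (auto simp: X Z)
    ultimately have l: "?l k X = of_bool (x < k) + (of_bool (i < k) + (of_bool (j < k) + ?l k S))"
      "?l k Z = of_bool (z < k) + (of_bool (i < k) + (of_bool (j < k) + ?l k S))" for k
      by simp_all
    have "even (?l j Z + ?l i X + ?n) \<longleftrightarrow> even (?l j X + ?l i Z)"
      unfolding l by (cases "x < i"; cases "x < j"; cases "z < i"; cases "z < j"; cases "j < i"; cases "i < j"; simp)
    from neg_one_pow_cong[OF this] show ?thesis by simp
  qed
  also have "\<dots> \<odot> ?p = circuit_vector F P X j \<odot> circuit_vector F P Z i"
    by (simp add: circuit_vector_def diff pm_omult_pm) (simp add: X Z)
  finally show ?thesis .
qed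

text \<open>This supplies the vanishing product. If \<open>insert i (X - {x})\<close> is a basis, it
  contains \<open>y\<close>, so its trace on \<open>A\<close> is not maximal. Hence \<open>x\<close>
  lies in \<open>A\<close>, and so does its replacement \<open>z\<close>. As \<open>j\<close> is
  outside \<open>A\<close>, the set \<open>insert z (X - {j})\<close> would have a larger trace than
  \<open>X\<close>.\<close>

lemma not_both_bases:
  assumes y: "y \<inter> A = {}" and i: "i \<in> y" and dep: "\<And>D. D \<in> max_bases A \<Longrightarrow> \<not> y \<subseteq> D"
    and X: "X \<in> max_bases A" "y - {i} \<subseteq> X" and x: "x \<in> X - (y - {i})"
    and z: "z \<notin> X" "insert z (X - {x}) \<in> max_bases A" and j: "j \<in> y - {i}"
  shows "insert z (X - {j}) \<notin> supp P \<or> insert i (X - {x}) \<notin> supp P"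
proof (rule ccontr)
  assume neg: "\<not> ?thesis"
  have fin: "finite X" using basisD(2) max_basesD(1)[OF X(1)] .
  have "\<not> y \<subseteq> X" using dep[OF X(1)] .
  then have iX: "i \<notin> X" using X(2) by blast
  have "y \<subseteq> insert i (X - {x})" using X(2) x by blast
  then have "insert i (X - {x}) \<notin> max_bases A" using dep by blast
  then obtain W where W: "W \<in> supp P" "card (insert i (X - {x}) \<inter> A) < card (W \<inter> A)"
    using neg unfolding max_bases_def by (simp add: not_le) blast
  have XA: "insert i (X - {x}) \<inter> A = X \<inter> A - {x}" using y i by blast
  have "card (X \<inter> A - {x}) < card (X \<inter> A)"
    using W(2) max_basesD(2)[OF X(1) W(1)] unfolding XA by (rule less_le_trans)
  then have "X \<inter> A - {x} \<noteq> X \<inter> A" by (intro notI) (simp only: less_irrefl)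
  then have xA: "x \<in> X \<inter> A" by blast
  have eq: "card (insert z (X - {x}) \<inter> A) = card (X \<inter> A)" using max_bases_card_eq z X by blast
  have zA: "z \<in> A"
  proof (rule ccontr)
    assume "z \<notin> A"
    then have "insert z (X - {x}) \<inter> A = X \<inter> A - {x}" by blast
    moreover have "card (X \<inter> A - {x}) < card (X \<inter> A)" using fin xA by (intro card_Diff1_less) auto
    ultimately show False using eq by simp
  qed
  have "insert z (X - {j}) \<inter> A = insert z (X \<inter> A)" using zA j y by blast
  moreover have "card (insert z (X \<inter> A)) = Suc (card (X \<inter> A))" using z(1) fin by simp
  ultimately show False using max_basesD(2)[OF X(1), of "insert z (X - {j})"] neg by simp
qed

text \<open>Move from \<open>D\<close> to \<open>D'\<close> through bases of maximal trace that
  contain \<open>y - {i}\<close>. Each exchange preserves the ratios of the coordinates in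
  \<open>y\<close>; coordinate \<open>i\<close> is a nonzero pivot because deleting \<open>i\<close>
  leaves a basis. Empty \<open>A\<close> concerns the matroid itself, general \<open>A\<close> its
  contraction.\<close>

lemma circuit_vectors_proportional:
  assumes y: "y \<inter> A = {}" "y \<subseteq> E" and i: "i \<in> y" and dep: "\<And>D. D \<in> max_bases A \<Longrightarrow> \<not> y \<subseteq> D"
    and D: "D \<in> max_bases A" "y - {i} \<subseteq> D" and D': "D' \<in> max_bases A" "y - {i} \<subseteq> D'"
  shows "\<exists>c\<in>carrier F. \<forall>j\<in>y. circuit_vector F P (insert i D') j = scale F c (circuit_vector F P (insert i D)) j"
proof -
  interpret max: basis_family E "max_bases A" r by (rule basis_family_max_bases)
  let ?cv = "\<lambda>X. circuit_vector F P (insert i X)"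
  define Q where "Q X \<longleftrightarrow> (\<exists>c\<in>carrier F. \<forall>j\<in>y. ?cv X j = Some c \<odot> ?cv D j)" for X
  have start: "Q D" unfolding Q_def by (rule bexI[of _ \<one>]) (simp_all add: omult_one)
  have step: "Q (insert z (X - {x}))"
    if X: "X \<in> max_bases A" "y - {i} \<subseteq> X" "Q X" and x: "x \<in> X - (y - {i})"
      and z: "z \<notin> X" "insert z (X - {x}) \<in> max_bases A" for X x z
  proof -
    let ?Z = "insert z (X - {x})"
    have iX: "i \<notin> X" using dep[OF X(1)] X(2) by blast
    have "y - {i} \<subseteq> ?Z" using X(2) x by blast
    then have iZ: "i \<notin> ?Z" using dep[OF z(2)] by blast
    note bX = basisD[OF max_basesD(1)[OF X(1)]] and bZ = basisD[OF max_basesD(1)[OF z(2)]]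
    have ne: "\<exists>u\<in>carrier F. ?cv W i = Some u" if W: "W \<in> max_bases A" "i \<notin> W" for W
    proof -
      have "W \<in> supp P" using max_basesD W by blast
      then obtain p where "P W = Some p" by (auto simp: supp_def)
      moreover have "insert i W - {i} = W" using W by blast
      ultimately show ?thesis using P_closed[of W] by (simp add: circuit_vector_def)
    qed
    obtain u where u: "u \<in> carrier F" "?cv X i = Some u" using ne X iX by blast
    obtain v where v: "v \<in> carrier F" "?cv ?Z i = Some v" using ne z iZ by blast
    have "?cv ?Z j = Some (v \<otimes> inv u) \<odot> ?cv X j" if j: "j \<in> y" for j
    proof -
      have "?cv ?Z j \<odot> ?cv X i = ?cv X j \<odot> ?cv ?Z i"
      proof (cases "j = i")
        case True
        then show ?thesis by (simp add: omult_comm)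
      next
        case False
        define S where "S = X - {x} - {j}"
        have jX: "j \<in> X" "j \<noteq> x" using X(2) x j False by blast+
        have cX: "card (X - {x}) + 1 = r" "card S + 1 = card (X - {x})"
          using bX(2,3) jX x card_Suc_Diff1[of X x] card_Suc_Diff1[of "X - {x}" j] by (simp_all add: S_def)
        have eqs: "insert x (insert z S) = insert z (X - {j})" "insert i (insert j S) = insert i (X - {x})"
          "insert i X = insert i (insert j (insert x S))" "insert i ?Z = insert i (insert j (insert z S))"
          using jX x by (auto simp: S_def)
        show ?thesis
        proof (rule circuit_vector_adjacent[where S = S and x = x and z = z])
          show "finite S" using bX by (simp add: S_def)
          show "insert i (insert j (insert x (insert z S))) \<subseteq> E"
            using bX(1) bZ(1) y(2) i jX x by (auto simp: S_def)
          show "card S + 2 = r" using cX by simp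
          show "distinct [i, j, x, z]" using jX x z iX iZ False by auto
          show "{i, j, x, z} \<inter> S = {}" using z iX by (auto simp: S_def)
          show "insert x (insert z S) \<notin> supp P \<or> insert i (insert j S) \<notin> supp P"
            unfolding eqs(1,2) using y(1) i dep X(1,2) x z
            by (rule not_both_bases) (use j False in simp_all)
        qed (fact eqs)+
      qed
      then show ?thesis using u v by (intro omult_cross) simp_all
    qed
    moreover obtain c where "c \<in> carrier F" "\<And>j. j \<in> y \<Longrightarrow> ?cv X j = Some c \<odot> ?cv D j"
      using X(3) by (auto simp: Q_def)
    ultimately have "?cv ?Z j = Some (v \<otimes> inv u \<otimes> c) \<odot> ?cv D j" if "j \<in> y" for j
      using that u v omult_assoc[of "Some (v \<otimes> inv u)" "Some c" "?cv D j"] by simp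
    then show ?thesis unfolding Q_def using u v \<open>c \<in> carrier F\<close> by (intro bexI[of _ "v \<otimes> inv u \<otimes> c"]) auto
  qed
  have "Q D'"
    using D start D' by (rule max.basis_path_induct) (rule step)
  then show ?thesis by (simp add: Q_def scale_def)
qed

lemma circuit_independent:
  assumes "i \<in> supp (circuit_vector F P \<tau>)"
  shows "\<tau> - {i} \<in> supp P" "supp (circuit_vector F P \<tau>) - {i} \<subseteq> \<tau> - {i}" "i \<in> \<tau>"
  using assms by (auto simp: supp_circuit_vector)

lemma circuit_dependent:
  assumes "supp (circuit_vector F P \<tau>) \<noteq> {}" "B \<in> supp P"
  shows "\<not> supp (circuit_vector F P \<tau>) \<subseteq> B"
  using assms fundamental_circuit_dependent[of _ \<tau> B] by (auto simp: supp_circuit_vector)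

text \<open>Moving between the bases \<open>\<tau> - {i}\<close> and \<open>\<tau>' - {i}\<close>
  with empty \<open>A\<close> gives proportionality on the support of the first vector, and outside
  it both vectors vanish.\<close>

lemma same_support_proportional:
  assumes supp: "supp (circuit_vector F P \<tau>) \<noteq> {}" "\<tau>' - {i} \<in> supp P" "\<tau> \<subseteq> E"
    and i: "i \<in> supp (circuit_vector F P \<tau>)"
    and sub: "supp (circuit_vector F P \<tau>) \<subseteq> \<tau>'"
  obtains c where "c \<in> carrier F" "circuit_vector F P \<tau>' = scale F c (circuit_vector F P \<tau>)"
proof -
  let ?y = "supp (circuit_vector F P \<tau>)"
  have ins: "insert i (\<tau> - {i}) = \<tau>" "insert i (\<tau>' - {i}) = \<tau>'" using i sub circuit_independent(3)[OF i] by auto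
  have "\<exists>c\<in>carrier F. \<forall>j\<in>?y. circuit_vector F P (insert i (\<tau>' - {i})) j =
      scale F c (circuit_vector F P (insert i (\<tau> - {i}))) j"
    by (rule circuit_vectors_proportional[where A = "{}"])
      (use supp i sub circuit_dependent circuit_independent[OF i] in \<open>auto simp: max_bases_empty\<close>)
  then obtain c where c: "c \<in> carrier F"
    "\<And>j. j \<in> ?y \<Longrightarrow> circuit_vector F P \<tau>' j = scale F c (circuit_vector F P \<tau>) j" unfolding ins by blast
  \<comment> \<open>A nonzero coordinate \<open>k\<close> outside \<open>?y\<close> would make
    \<open>\<tau>' - {k}\<close> a basis containing the dependent set \<open>?y\<close>.\<close>
  have "supp (circuit_vector F P \<tau>') \<subseteq> ?y"
  proof
    fix k assume k: "k \<in> supp (circuit_vector F P \<tau>')"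
    show "k \<in> ?y"
    proof (rule ccontr)
      assume "k \<notin> ?y"
      then have "?y \<subseteq> \<tau>' - {k}" using sub by blast
      then show False using circuit_dependent[OF supp(1) circuit_independent(1)[OF k]] by blast
    qed
  qed
  then have "circuit_vector F P \<tau>' j = scale F c (circuit_vector F P \<tau>) j" for j
  proof (cases "j \<in> ?y")
    case False
    with \<open>supp (circuit_vector F P \<tau>') \<subseteq> ?y\<close> have "circuit_vector F P \<tau>' j = None" "circuit_vector F P \<tau> j = None"
      by (auto simp: supp_def)
    then show ?thesis by (simp add: scale_def)
  qed (rule c(2))
  then show ?thesis using that[OF c(1)] by blast
qed

text \<open>Through this equivalence the supports of the circuits determine the independent sets,
  and with them rank and bases.\<close>

lemma independent_iff:
  assumes "Y \<subseteq> E"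
  shows "(\<exists>B\<in>supp P. Y \<subseteq> B) \<longleftrightarrow> \<not> (\<exists>X\<in>circuit_set F E r P. supp X \<subseteq> Y)"
proof
  assume "\<exists>B\<in>supp P. Y \<subseteq> B"
  then obtain B where B: "B \<in> supp P" "Y \<subseteq> B" by blast
  show "\<not> (\<exists>X\<in>circuit_set F E r P. supp X \<subseteq> Y)"
  proof
    assume "\<exists>X\<in>circuit_set F E r P. supp X \<subseteq> Y"
    then obtain X where X: "X \<in> circuit_set F E r P" "supp X \<subseteq> Y" by blast
    then obtain c \<tau> where "X = scale F c (circuit_vector F P \<tau>)" and \<tau>: "supp (circuit_vector F P \<tau>) \<noteq> {}"
      unfolding circuit_set_def by blast
    with X(2) have "supp (circuit_vector F P \<tau>) \<subseteq> Y" by simp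
    with \<tau> show False using circuit_dependent[of \<tau> B] B by blast
  qed
next
  assume none: "\<not> (\<exists>X\<in>circuit_set F E r P. supp X \<subseteq> Y)"
  show "\<exists>B\<in>supp P. Y \<subseteq> B"
  proof (rule ccontr)
    assume "\<not> ?thesis"
    then have dep: "\<not> Y \<subseteq> B" if "B \<in> supp P" for B using that by blast
    obtain \<tau> where \<tau>: "\<tau> \<in> nsets E (r + 1)" "{j \<in> \<tau>. \<tau> - {j} \<in> supp P} \<noteq> {}" "{j \<in> \<tau>. \<tau> - {j} \<in> supp P} \<subseteq> Y"
      by (rule dependent_contains_circuit[OF assms dep])
    then have "scale F \<one> (circuit_vector F P \<tau>) \<in> circuit_set F E r P"
      unfolding circuit_set_def supp_circuit_vector by blast
    moreover have "supp (scale F \<one> (circuit_vector F P \<tau>)) \<subseteq> Y"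
      using \<tau>(3) unfolding supp_scale supp_circuit_vector .
    ultimately show False using none by blast
  qed
qed

end

section \<open>Circuits determine the matroid\<close>

text \<open>Relative to a set \<open>y\<close>, because circuit vectors of a matroid and of its
  contraction can be compared only outside the contracted set.\<close>

definition (in tract) proportional_on :: "'k set \<Rightarrow> ('k \<Rightarrow> 'a option) \<Rightarrow> ('k \<Rightarrow> 'a option) \<Rightarrow> bool" where
  "proportional_on y X Y \<longleftrightarrow> (\<exists>c\<in>carrier F. \<forall>j\<in>y. Y j = scale F c X j)"

context tract
begin

lemma proportional_on_trans:
  assumes "proportional_on y X Y" "proportional_on y Y Z" "\<And>k. set_option (X k) \<subseteq> carrier F"
  shows "proportional_on y X Z"
proof -
  obtain c d where c: "c \<in> carrier F" "\<And>j. j \<in> y \<Longrightarrow> Y j = Some c \<odot> X j"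
    and d: "d \<in> carrier F" "\<And>j. j \<in> y \<Longrightarrow> Z j = Some d \<odot> Y j"
    using assms(1,2) unfolding proportional_on_def scale_def by blast
  have "Z j = Some (d \<otimes> c) \<odot> X j" if "j \<in> y" for j
    using that c d assms(3) omult_assoc[of "Some d" "Some c" "X j"] by simp
  then show ?thesis unfolding proportional_on_def scale_def using c d m_closed by blast
qed

lemma proportional_on_sym:
  assumes "proportional_on y X Y" "\<And>k. set_option (X k) \<subseteq> carrier F"
  shows "proportional_on y Y X"
proof -
  obtain c where c: "c \<in> carrier F" "\<And>j. j \<in> y \<Longrightarrow> Y j = Some c \<odot> X j"
    using assms(1) unfolding proportional_on_def scale_def by blast
  have "X j = Some (inv c) \<odot> Y j" if "j \<in> y" for j
    using that c assms(2) omult_assoc[of "Some (inv c)" "Some c" "X j"] by (simp add: omult_one)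
  then show ?thesis unfolding proportional_on_def scale_def using c inv_closed by blast
qed

lemma proportional_onI: "c \<in> carrier F \<Longrightarrow> (\<And>j. j \<in> y \<Longrightarrow> Y j = Some c \<odot> X j) \<Longrightarrow> proportional_on y X Y"
  by (auto simp: proportional_on_def scale_def)

lemma proportional_on_supp:
  assumes "proportional_on (supp X) X Y" "supp Y = supp X"
  obtains c where "c \<in> carrier F" "Y = scale F c X"
proof -
  obtain c where c: "c \<in> carrier F" "\<And>j. j \<in> supp X \<Longrightarrow> Y j = scale F c X j"
    using assms(1) unfolding proportional_on_def by blast
  have "Y j = scale F c X j" for j
  proof (cases "j \<in> supp X")
    case False
    moreover from this have "j \<notin> supp Y" using assms(2) by simp
    ultimately have "X j = None" "Y j = None" by (simp_all add: supp_def)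
    then show ?thesis by (simp add: scale_def)
  qed (rule c(2))
  then show ?thesis using that c(1) by blast
qed

lemma circuit_setI:
  "\<lbrakk>c \<in> carrier F; \<tau> \<in> nsets E (r + 1); supp (circuit_vector F P \<tau>) \<noteq> {}\<rbrakk>
    \<Longrightarrow> scale F c (circuit_vector F P \<tau>) \<in> circuit_set F E r P"
  unfolding circuit_set_def by blast

lemma circuit_setE:
  assumes "X \<in> circuit_set F E r P"
  obtains c \<tau> where "c \<in> carrier F" "\<tau> \<in> nsets E (r + 1)" "supp (circuit_vector F P \<tau>) \<noteq> {}"
    "X = scale F c (circuit_vector F P \<tau>)"
  using assms unfolding circuit_set_def by blast

lemma circuit_vector_scale:
  assumes "c \<in> carrier F" "\<And>X. set_option (P X) \<subseteq> carrier F"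
  shows "circuit_vector F (scale F c P) \<tau> = scale F c (circuit_vector F P \<tau>)"
  using assms omult_lcomm[of "Some c" "pm n" for n] by (auto simp: circuit_vector_def scale_def)

lemma pm_cancel:
  assumes "pm m \<odot> x = Some c \<odot> (pm m \<odot> y)" "c \<in> carrier F" "set_option x \<subseteq> carrier F" "set_option y \<subseteq> carrier F"
  shows "x = Some c \<odot> y"
proof -
  have "pm m \<odot> x = pm m \<odot> (Some c \<odot> y)" using assms omult_lcomm[of "Some c" "pm m" y] by simp
  from pm_transfer[OF this] show ?thesis using assms(2-4) by (simp add: omult_closed pm_even omult_one)
qed

text \<open>Rank and bases are recovered from the independent sets. The factor \<open>c\<close> is
  fixed at \<open>B0\<close> and carried along exchanges: \<open>X\<close> and its neighbour arise
  from the same set \<open>insert z X\<close> by deleting one element, so their values are, up to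
  sign, two coordinates of one circuit vector.\<close>

lemma circuit_set_determines:
  assumes P: "plucker_vector Weak F E r P" and Q: "plucker_vector Weak F E r' Q"
    and eq: "circuit_set F E r P = circuit_set F E r' Q"
  shows "r = r'" and "\<exists>c\<in>carrier F. Q = scale F c P"
proof -
  interpret P: weak_plucker F E r P by unfold_locales (rule P)
  interpret Q: weak_plucker F E r' Q by unfold_locales (rule Q)
  have indep: "(\<exists>B\<in>supp P. Y \<subseteq> B) \<longleftrightarrow> (\<exists>B\<in>supp Q. Y \<subseteq> B)" if "Y \<subseteq> E" for Y
    unfolding P.independent_iff[OF that] Q.independent_iff[OF that] eq ..
  have PQ: "\<exists>B'\<in>supp Q. B \<subseteq> B'" if B: "B \<in> supp P" for B
    using indep[OF P.basisD(1)[OF B]] B by blast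
  have QP: "\<exists>B'\<in>supp P. B \<subseteq> B'" if B: "B \<in> supp Q" for B
    using indep[OF Q.basisD(1)[OF B]] B by blast
  obtain B0 where B0: "B0 \<in> supp P" using P.basis_nonempty by blast
  show r: "r = r'"
  proof (rule antisym)
    obtain B' where "B' \<in> supp Q" "B0 \<subseteq> B'" using PQ[OF B0] by blast
    then show "r \<le> r'" using card_mono[of B' B0] P.basisD(3)[OF B0] Q.basisD(2,3)[of B'] by simp
    obtain C where C: "C \<in> supp Q" using Q.basis_nonempty by blast
    obtain B' where "B' \<in> supp P" "C \<subseteq> B'" using QP[OF C] by blast
    then show "r' \<le> r" using card_mono[of B' C] Q.basisD(3)[OF C] P.basisD(2,3)[of B'] by simp
  qed
  have sub: "B \<in> supp Q" if B: "B \<in> supp P" for B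
  proof -
    obtain B' where B': "B' \<in> supp Q" "B \<subseteq> B'" using PQ[OF B] by blast
    then have "B = B'" using card_subset_eq[of B' B] P.basisD(3)[OF B] Q.basisD(2,3)[of B'] r by simp
    then show ?thesis using B' by simp
  qed
  have sub': "B \<in> supp P" if B: "B \<in> supp Q" for B
  proof -
    obtain B' where B': "B' \<in> supp P" "B \<subseteq> B'" using QP[OF B] by blast
    then have "B = B'" using card_subset_eq[of B' B] Q.basisD(3)[OF B] P.basisD(2,3)[of B'] r by simp
    then show ?thesis using B' by simp
  qed
  obtain p q where pq: "P B0 = Some p" "Q B0 = Some q" using B0 sub[OF B0] by (auto simp: supp_def)
  have pqc: "p \<in> carrier F" "q \<in> carrier F" using P.P_closed[of B0] Q.P_closed[of B0] pq by simp_all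
  define c where "c = q \<otimes> inv p"
  have c: "c \<in> carrier F" using pqc by (simp add: c_def)
  have "Q X = Some c \<odot> P X" if X: "X \<in> supp P" for X
  proof (rule P.basis_path_induct[of B0 "{}" "\<lambda>X. Q X = Some c \<odot> P X"])
    show "Q B0 = Some c \<odot> P B0" using pqc by (simp add: pq c_def m_assoc)
    fix X x z assume X: "X \<in> supp P" and T: "Q X = Some c \<odot> P X" and x: "x \<in> X - {}"
      and z: "z \<notin> X" "insert z (X - {x}) \<in> supp P"
    define \<tau> where "\<tau> = insert z X"
    have \<tau>: "\<tau> - {z} = X" "\<tau> - {x} = insert z (X - {x})" "z \<in> \<tau>" "x \<in> \<tau>" using z x by (auto simp: \<tau>_def)
    have "z \<in> E" using P.basisD(1)[OF z(2)] by blast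
    then have n\<tau>: "\<tau> \<in> nsets E (r + 1)" using P.basisD[OF X] z(1) by (simp add: nsets_def \<tau>_def)
    have zs: "z \<in> supp (circuit_vector F P \<tau>)" using \<tau> X by (simp add: supp_circuit_vector)
    then have "scale F \<one> (circuit_vector F P \<tau>) \<in> circuit_set F E r P" using n\<tau> by (intro circuit_setI) auto
    then have "circuit_vector F P \<tau> \<in> circuit_set F E r' Q" by (simp add: scale_one eq)
    then obtain d \<tau>' where d: "d \<in> carrier F" "\<tau>' \<in> nsets E (r' + 1)" "supp (circuit_vector F Q \<tau>') \<noteq> {}"
      "circuit_vector F P \<tau> = scale F d (circuit_vector F Q \<tau>')" by (rule circuit_setE)
    have "supp (circuit_vector F Q \<tau>') = supp (circuit_vector F P \<tau>)" by (simp add: d(4))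
    then have s: "z \<in> supp (circuit_vector F Q \<tau>')" "supp (circuit_vector F Q \<tau>') \<subseteq> \<tau>"
      using zs by (simp_all add: supp_circuit_vector)
    \<comment> \<open>Equality of the circuit sets supplies only some \<open>\<tau>'\<close>;
      proportionality of circuits with equal support leads back to \<open>\<tau>\<close>.\<close>
    obtain e where e: "e \<in> carrier F" "circuit_vector F Q \<tau> = scale F e (circuit_vector F Q \<tau>')"
      using Q.same_support_proportional[OF d(3), of \<tau> z] s d(2) sub[OF X] \<tau>(1) by (auto simp: nsets_def)
    have "circuit_vector F Q \<tau>' = scale F (inv d) (circuit_vector F P \<tau>)"
      using d by (intro scale_inverse) simp_all
    then have "circuit_vector F Q \<tau> = scale F (e \<otimes> inv d) (circuit_vector F P \<tau>)"
      using d(1) e by (simp add: scale_scale)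
    moreover define f where "f = e \<otimes> inv d"
    ultimately have f: "circuit_vector F Q \<tau> = scale F f (circuit_vector F P \<tau>)" "f \<in> carrier F"
      using d(1) e by simp_all
    have at: "Q (\<tau> - {k}) = Some f \<odot> P (\<tau> - {k})" if k: "k \<in> \<tau>" for k
    proof -
      have "circuit_vector F Q \<tau> k = scale F f (circuit_vector F P \<tau>) k" by (simp only: f(1))
      then have "pm (card {t \<in> \<tau>. t < k}) \<odot> Q (\<tau> - {k}) = Some f \<odot> (pm (card {t \<in> \<tau>. t < k}) \<odot> P (\<tau> - {k}))"
        using k by (simp only: circuit_vector_def scale_def if_True)
      from pm_cancel[OF this f(2)] show ?thesis by simp
    qed
    obtain a where "P X = Some a" using X by (auto simp: supp_def)
    then have a: "P X = Some a" "a \<in> carrier F" using P.P_closed[of X] by simp_all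
    \<comment> \<open>The factor of the circuit is identified with \<open>c\<close> at coordinate
      \<open>z\<close>, which comes from the nonzero value \<open>P X\<close>.\<close>
    have "f \<otimes> a = c \<otimes> a" using at[OF \<tau>(3)] T a by (simp add: \<tau>)
    then have "f = c" using a f(2) c by simp
    then show "Q (insert z (X - {x})) = Some c \<odot> P (insert z (X - {x}))" using at[OF \<tau>(4)] by (simp add: \<tau>)
  qed (use B0 X in auto)
  moreover have "Q X = Some c \<odot> P X" if "X \<notin> supp P" for X
  proof -
    have "X \<notin> supp Q" using sub' that by blast
    then show ?thesis using that by (simp add: supp_def)
  qed
  ultimately have "Q = scale F c P" unfolding scale_def by blast
  then show "\<exists>c\<in>carrier F. Q = scale F c P" using c by blast
qed

lemma scaling_class_scale:
  assumes "c \<in> carrier F" "\<And>X. set_option (P X) \<subseteq> carrier F"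
  shows "scaling_class F (scale F c P) = scaling_class F P"
proof -
  have sub: "scaling_class F (scale F c P) \<subseteq> scaling_class F P"
    if "c \<in> carrier F" "\<And>X. set_option (P X) \<subseteq> carrier F" for c and P :: "'k \<Rightarrow> 'a option"
  proof
    fix X assume "X \<in> scaling_class F (scale F c P)"
    then obtain d where d: "d \<in> carrier F" "X = scale F d (scale F c P)"
      unfolding scaling_class_def by blast
    then have "X = scale F (d \<otimes> c) P" "d \<otimes> c \<in> carrier F" using that by (simp_all add: scale_scale)
    then show "X \<in> scaling_class F P" unfolding scaling_class_def by blast
  qed
  have "P = scale F (inv c) (scale F c P)" using assms by (intro scale_inverse) simp_all
  then have "scaling_class F P \<subseteq> scaling_class F (scale F c P)"
    using sub[of "inv c" "scale F c P"] assms by (simp add: scale_closed)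
  with sub[OF assms] show ?thesis by (rule antisym)
qed

lemma circuits_eq_circuit_set:
  assumes P: "plucker_function F (ground M) (mrank M) P" and M: "plucker_class M = scaling_class F P"
  shows "circuits F M = circuit_set F (ground M) (mrank M) P"
proof -
  note closed = plucker_function_closed[OF P]
  have sc: "scale F c (circuit_vector F (scale F d P) \<tau>) = scale F (c \<otimes> d) (circuit_vector F P \<tau>)"
    "supp (circuit_vector F (scale F d P) \<tau>) = supp (circuit_vector F P \<tau>)"
    if "c \<in> carrier F" "d \<in> carrier F" for c d \<tau>
    using that closed P by (simp_all add: circuit_vector_scale scale_scale circuit_vector_closed)
  show ?thesis
  proof
    show "circuits F M \<subseteq> circuit_set F (ground M) (mrank M) P"
    proof
      fix X assume "X \<in> circuits F M"
      then obtain c d \<tau> where "c \<in> carrier F" "d \<in> carrier F" "\<tau> \<in> nsets (ground M) (mrank M + 1)"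
        "supp (circuit_vector F (scale F d P) \<tau>) \<noteq> {}" "X = scale F c (circuit_vector F (scale F d P) \<tau>)"
        unfolding circuits_def M scaling_class_def by blast
      then show "X \<in> circuit_set F (ground M) (mrank M) P"
        using circuit_setI[of "c \<otimes> d" \<tau> _ _ P] by (simp add: sc)
    qed
    show "circuit_set F (ground M) (mrank M) P \<subseteq> circuits F M"
    proof
      fix X assume "X \<in> circuit_set F (ground M) (mrank M) P"
      then obtain c \<tau> where "c \<in> carrier F" "\<tau> \<in> nsets (ground M) (mrank M + 1)"
        "supp (circuit_vector F P \<tau>) \<noteq> {}" "X = scale F c (circuit_vector F P \<tau>)" by (rule circuit_setE)
      moreover have "P \<in> plucker_class M"
        unfolding M scaling_class_def using scale_one[of P] closed by (metis (mono_tags, lifting) mem_Collect_eq one_closed)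
      ultimately show "X \<in> circuits F M" unfolding circuits_def by blast
    qed
  qed
qed

text \<open>Gives uniqueness in the definite descriptions; equality of the ranks is itself read off
  from the circuits.\<close>

lemma fmatroid_eqI:
  fixes N N' :: "('i::linorder, 'a) fmatroid"
  assumes N: "is_fmatroid s F N" and N': "is_fmatroid s F N'"
    and ground: "ground N = ground N'" and circuits: "circuits F N = circuits F N'"
  shows "N = N'"
proof -
  obtain P where P: "finite (ground N)" "plucker_vector s F (ground N) (mrank N) P" "plucker_class N = scaling_class F P"
    using N by (auto simp: is_fmatroid_def)
  obtain Q where Q: "finite (ground N')" "plucker_vector s F (ground N') (mrank N') Q" "plucker_class N' = scaling_class F Q"
    using N' by (auto simp: is_fmatroid_def)
  have wP: "plucker_vector Weak F (ground N) (mrank N) P" using P by (intro weak_if_plucker_vector)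
  have wQ: "plucker_vector Weak F (ground N) (mrank N') Q" using Q unfolding ground by (intro weak_if_plucker_vector)
  have pP: "plucker_function F (ground N) (mrank N) P" using wP unfolding plucker_vector.simps by (rule conjunct1)
  have pQ: "plucker_function F (ground N') (mrank N') Q" using wQ unfolding plucker_vector.simps ground by (rule conjunct1)
  have "circuit_set F (ground N) (mrank N) P = circuit_set F (ground N) (mrank N') Q"
    using circuits circuits_eq_circuit_set[OF pP P(3)] circuits_eq_circuit_set[OF pQ Q(3)] ground by simp
  note det = circuit_set_determines[OF wP wQ this]
  then obtain c where c: "c \<in> carrier F" "Q = scale F c P" by blast
  have "plucker_class N' = plucker_class N"
    unfolding P(3) Q(3) c(2) using c(1) plucker_function_closed[OF pP] by (intro scaling_class_scale)
  with det(1) ground show ?thesis by simp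
qed

end

section \<open>Contraction and coloops\<close>

text \<open>For disjoint sets, the number of inversions of the sorted list of \<open>I\<close>
  followed by the sorted list of \<open>B\<close>, hence the sign exponent for sorting their
  concatenation.\<close>

definition inversions :: "'i::linorder set \<Rightarrow> 'i set \<Rightarrow> nat" where
  "inversions I B = (\<Sum>i\<in>I. card {b \<in> B. b < i})"

lemma inversions_insert:
  "finite I \<Longrightarrow> j \<notin> I \<Longrightarrow> inversions (insert j I) B = card {b \<in> B. b < j} + inversions I B"
  by (simp add: inversions_def)

lemma inversions_remove:
  "finite I \<Longrightarrow> j \<in> I \<Longrightarrow> inversions I B = card {b \<in> B. b < j} + inversions (I - {j}) B"
  unfolding inversions_def by (rule sum.remove)

lemma card_filter_disjoint_Un:
  assumes "finite S" "finite T" "S \<inter> T = {}"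
  shows "card {k \<in> S \<union> T. Q k} = card {k \<in> S. Q k} + card {k \<in> T. Q k}"
proof -
  have "{k \<in> S \<union> T. Q k} = {k \<in> S. Q k} \<union> {k \<in> T. Q k}" by blast
  then show ?thesis using assms by (simp only:) (rule card_Un_disjoint, auto)
qed

section \<open>Signs when a block of elements is fixed\<close>

context tract
begin

lemma formal_sum_cong: "(\<And>j. j \<in> A \<Longrightarrow> f j = g j) \<Longrightarrow> formal_sum f A = formal_sum g A"
proof -
  assume eq: "\<And>j. j \<in> A \<Longrightarrow> f j = g j"
  then have S: "{j \<in> A. f j \<noteq> None} = {j \<in> A. g j \<noteq> None}" by auto
  have "j \<in> A" if "j \<in># mset_set {j \<in> A. g j \<noteq> None}" for j
    using that by (cases "finite {j \<in> A. g j \<noteq> None}") auto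
  then have "the (f j) = the (g j)" if "j \<in># mset_set {j \<in> A. g j \<noteq> None}" for j
    using eq that by metis
  then show ?thesis unfolding formal_sum_def S by (rule image_mset_cong)
qed

lemma formal_sum_scale: "formal_sum (\<lambda>j. Some c \<odot> f j) A = image_mset (\<lambda>a. c \<otimes> a) (formal_sum f A)"
proof -
  have "the (Some c \<odot> f j) = c \<otimes> the (f j)" if "j \<in># mset_set {j \<in> A. f j \<noteq> None}" for j
    using that by (cases "finite {j \<in> A. f j \<noteq> None}") auto
  then have "image_mset (\<lambda>j. the (Some c \<odot> f j)) (mset_set {j \<in> A. f j \<noteq> None}) =
      image_mset (\<lambda>j. c \<otimes> the (f j)) (mset_set {j \<in> A. f j \<noteq> None})"
    by (rule image_mset_cong)
  then show ?thesis by (simp add: formal_sum_def image_mset.compositionality comp_def)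
qed

lemma null_set_scale_iff:
  assumes "set_mset X \<subseteq> carrier F" "c \<in> carrier F"
  shows "image_mset (\<lambda>a. c \<otimes> a) X \<in> null_set F \<longleftrightarrow> X \<in> null_set F"
proof
  assume "image_mset (\<lambda>a. c \<otimes> a) X \<in> null_set F"
  from null_set_scale[OF this, of "inv c"] assms
  have "image_mset (\<lambda>a. inv c \<otimes> (c \<otimes> a)) X \<in> null_set F" by (simp add: image_mset.compositionality comp_def)
  moreover have "image_mset (\<lambda>a. inv c \<otimes> (c \<otimes> a)) X = image_mset (\<lambda>a. a) X"
    using assms by (intro image_mset_cong) (auto simp: m_assoc[symmetric])
  ultimately show "X \<in> null_set F" by simp
qed (rule null_set_scale[OF _ assms(2)])

lemma formal_sum_closed:
  assumes "\<And>j. j \<in> A \<Longrightarrow> set_option (f j) \<subseteq> carrier F"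
  shows "set_mset (formal_sum f A) \<subseteq> carrier F"
proof
  fix a assume "a \<in> set_mset (formal_sum f A)"
  then obtain j where "j \<in># mset_set {j \<in> A. f j \<noteq> None}" "a = the (f j)" by (auto simp: formal_sum_def)
  moreover from this have "j \<in> A \<and> f j \<noteq> None" by (cases "finite {j \<in> A. f j \<noteq> None}") auto
  ultimately show "a \<in> carrier F" using assms[of j] by auto
qed

text \<open>
  If \<open>R'\<close> arises from \<open>R\<close> by fixing the elements of \<open>B\<close>, moved to the end of each subset, then
  each relation of \<open>R'\<close> is a signed copy of one of \<open>R\<close>: the exponents at \<open>j\<close> contributed by \<open>B\<close>
  are \<open>#{b < j}\<close>, gained in one factor and lost in the other, and twice \<open>#{b > j}\<close>.
\<close>

lemma plucker_relation_twist:
  assumes fin: "finite U" "finite B" and U: "U \<inter> B = {}" "I \<subseteq> U" "J \<subseteq> U"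
    and R: "\<And>X. X \<subseteq> U \<Longrightarrow> R' X = pm (inversions X B) \<odot> R (X \<union> B)"
    and closed: "\<And>X. set_option (R X) \<subseteq> carrier F"
  shows "plucker_relation F R' I J \<longleftrightarrow> plucker_relation F R (I \<union> B) (J \<union> B)"
proof -
  define f where "f j = Some (plucker_sign F j (I \<union> B) (J \<union> B)) \<odot>
    (R (insert j (I \<union> B)) \<odot> R (J \<union> B - {j}))" for j
  define f' where "f' j = Some (plucker_sign F j I J) \<odot> (R' (insert j I) \<odot> R' (J - {j}))" for j
  let ?c = "neg_one F [^] (inversions I B + inversions J B)"
  note fin' = finite_subset[OF U(2) fin(1)] finite_subset[OF U(3) fin(1)]
  have dis: "J \<inter> B = {}" "I \<inter> B = {}" using U by blast+
  have f_closed: "set_option (f j) \<subseteq> carrier F" for j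
    unfolding f_def plucker_sign_def by (intro omult_closed closed) simp
  have "f' j = Some ?c \<odot> f j" if j: "j \<in> J - I" for j
  proof -
    have sets: "insert j I \<union> B = insert j (I \<union> B)" "J - {j} \<union> B = J \<union> B - {j}" using j dis by blast+
    have sub: "insert j I \<subseteq> U" "J - {j} \<subseteq> U" using j U by blast+
    let ?x = "R (insert j (I \<union> B)) \<odot> R (J \<union> B - {j})"
    let ?s = "card {j' \<in> J. j < j'} + card {i \<in> I. j < i}"
    let ?t = "card {j' \<in> J \<union> B. j < j'} + card {i \<in> I \<union> B. j < i}"
    let ?v = "inversions (insert j I) B + inversions (J - {j}) B"
    have "f' j = pm ?s \<odot> (pm ?v \<odot> ?x)"
      unfolding f'_def plucker_sign_def R[OF sub(1)] R[OF sub(2)] sets using closed by (simp add: pm_omult_pm)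
    also have "\<dots> = pm (?s + ?v) \<odot> ?x" using closed by (intro pm_pm_omult omult_closed)
    also have "?v = inversions I B + inversions J B"
      using inversions_insert[OF fin'(1), of j B] inversions_remove[OF fin'(2), of j B] j by simp
    also have "pm (?s + (inversions I B + inversions J B)) = pm (inversions I B + inversions J B + ?t)"
    proof -
      have t: "?t = ?s + 2 * card {b \<in> B. j < b}"
        using card_filter_disjoint_Un[OF fin'(2) fin(2) dis(1)] card_filter_disjoint_Un[OF fin'(1) fin(2) dis(2)] by (simp only:)
      have "even (?s + (inversions I B + inversions J B)) \<longleftrightarrow> even (inversions I B + inversions J B + ?t)"
        unfolding t by auto
      from neg_one_pow_cong[OF this] show ?thesis by simp
    qed
    also have "\<dots> \<odot> ?x = Some ?c \<odot> f j"
      unfolding f_def plucker_sign_def using closed by (intro pm_pm_omult[symmetric] omult_closed)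
    finally show ?thesis .
  qed
  then have "formal_sum f' (J - I) = formal_sum (\<lambda>j. Some ?c \<odot> f j) (J - I)" by (rule formal_sum_cong)
  also have "\<dots> = image_mset (\<lambda>a. ?c \<otimes> a) (formal_sum f (J - I))" by (rule formal_sum_scale)
  finally have "formal_sum f' (J - I) \<in> null_set F \<longleftrightarrow> formal_sum f (J - I) \<in> null_set F"
    using f_closed by (simp only:) (intro null_set_scale_iff formal_sum_closed, simp_all)
  moreover have "J \<union> B - (I \<union> B) = J - I" using dis by blast
  ultimately show ?thesis unfolding plucker_relation_def f_def f'_def by simp
qed

text \<open>Deleting \<open>i\<close> from \<open>\<tau>\<close> loses the \<open>#{b < i}\<close>
  inversions at \<open>i\<close>, and adding \<open>B\<close> raises the position of
  \<open>i\<close> by the same number. The parities cancel, so the remaining sign does not depend on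
  \<open>i\<close>.\<close>

lemma circuit_vector_twist:
  assumes fin: "finite U" "finite B" and U: "U \<inter> B = {}" "\<tau> \<subseteq> U"
    and R: "\<And>X. X \<subseteq> U \<Longrightarrow> R' X = pm (inversions X B) \<odot> R (X \<union> B)"
    and closed: "\<And>X. set_option (R X) \<subseteq> carrier F"
    and i: "i \<notin> B"
  shows "circuit_vector F R' \<tau> i = pm (inversions \<tau> B) \<odot> circuit_vector F R (\<tau> \<union> B) i"
proof (cases "i \<in> \<tau>")
  case True
  note fin' = finite_subset[OF U(2) fin(1)]
  have dis: "\<tau> \<inter> B = {}" using U by blast
  have sets: "\<tau> - {i} \<union> B = \<tau> \<union> B - {i}" "\<tau> - {i} \<subseteq> U" using i U by blast+
  let ?x = "R (\<tau> \<union> B - {i})"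
  have "circuit_vector F R' \<tau> i = pm (card {k \<in> \<tau>. k < i}) \<odot> (pm (inversions (\<tau> - {i}) B) \<odot> ?x)"
    using True by (simp only: circuit_vector_def R[OF sets(2)] sets(1) if_True)
  also have "\<dots> = pm (card {k \<in> \<tau>. k < i} + inversions (\<tau> - {i}) B) \<odot> ?x"
    using closed by (rule pm_pm_omult)
  also have "pm (card {k \<in> \<tau>. k < i} + inversions (\<tau> - {i}) B) = pm (inversions \<tau> B + card {k \<in> \<tau> \<union> B. k < i})"
  proof -
    have "even (card {k \<in> \<tau>. k < i} + inversions (\<tau> - {i}) B) \<longleftrightarrow> even (inversions \<tau> B + card {k \<in> \<tau> \<union> B. k < i})"
      unfolding card_filter_disjoint_Un[OF fin' fin(2) dis] inversions_remove[OF fin' True, of B] by auto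
    from neg_one_pow_cong[OF this] show ?thesis by simp
  qed
  also have "\<dots> \<odot> ?x = pm (inversions \<tau> B) \<odot> (pm (card {k \<in> \<tau> \<union> B. k < i}) \<odot> ?x)"
    using closed by (rule pm_pm_omult[symmetric])
  finally show ?thesis using True by (simp add: circuit_vector_def)
qed (use i in simp)

end

text \<open>The usual formula with the elements of \<open>B\<close> written after those of
  \<open>I\<close>; the sign compensates for reading the union in increasing order.\<close>

definition contract_vector ::
    "('f, 'm) tract_scheme \<Rightarrow> ('i::linorder set \<Rightarrow> 'f option) \<Rightarrow> 'i set \<Rightarrow> 'i set \<Rightarrow> 'i set \<Rightarrow> 'f option" where
  "contract_vector F P A B = (\<lambda>I. if I \<inter> A = {}
     then opt_mult F (Some (neg_one F [^]\<^bsub>F\<^esub> inversions I B)) (P (I \<union> B)) else None)"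

text \<open>The sign is chosen so that contracting \<open>A\<close> again gives back
  \<open>P\<close>. The twisting lemmas are then applied with \<open>P\<close> as the twisted
  vector.\<close>

definition coloop_vector ::
    "('f, 'm) tract_scheme \<Rightarrow> ('i::linorder set \<Rightarrow> 'f option) \<Rightarrow> 'i set \<Rightarrow> 'i set \<Rightarrow> 'f option" where
  "coloop_vector F P A = (\<lambda>I. if A \<subseteq> I
     then opt_mult F (Some (neg_one F [^]\<^bsub>F\<^esub> inversions (I - A) A)) (P (I - A)) else None)"

lemma supp_contract_vector: "supp (contract_vector F P A B) = {I. I \<inter> A = {} \<and> I \<union> B \<in> supp P}"
  by (auto simp: supp_def contract_vector_def simp del: not_None_eq)

lemma supp_coloop_vector: "supp (coloop_vector F P A) = {I. A \<subseteq> I \<and> I - A \<in> supp P}"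
  by (auto simp: supp_def coloop_vector_def simp del: not_None_eq)

lemma supp_remove_coords [simp]: "supp (remove_coords X A) = supp X - A"
  by (auto simp: supp_def remove_coords_def)

lemma remove_coords_scale: "remove_coords (scale F c X) A = scale F c (remove_coords X A)"
  by (auto simp: remove_coords_def scale_def)

lemma (in tract) plucker_functionI:
  assumes "supp P \<noteq> {}" "supp P \<subseteq> nsets E r" "\<And>X. set_option (P X) \<subseteq> carrier F"
  shows "plucker_function F E r P"
proof -
  have "the (P X) \<in> carrier F" if "X \<in> supp P" for X
    using that assms(3)[of X] by (auto simp: supp_def)
  then show ?thesis using assms unfolding plucker_function_def by blast
qed

section \<open>Contraction by a subset and its circuits\<close>

locale contracted = weak_plucker +
  fixes A G
  assumes A: "A \<subseteq> E" and G: "G \<in> max_bases A"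
begin

text \<open>A trace of maximal size is a basis of \<open>A\<close>, so \<open>card B\<close> is the
  rank of \<open>A\<close> and \<open>r'\<close> the rank of the contraction.\<close>

abbreviation "B \<equiv> G \<inter> A"
abbreviation "P' \<equiv> contract_vector F P A B"
abbreviation "r' \<equiv> r - card B"

lemma G_basis: "G \<in> supp P" "G \<subseteq> E" "finite G" "card G = r"
  using max_basesD(1)[OF G] basisD by auto

lemma finite_B: "finite B" and card_B: "card B \<le> r"
  using G_basis card_mono[of G B] by auto

lemma P'_closed: "set_option (P' X) \<subseteq> carrier F"
  by (simp add: contract_vector_def omult_closed)

lemma P'_twist: "X \<subseteq> E - A \<Longrightarrow> P' X = pm (inversions X B) \<odot> P (X \<union> B)"
proof -
  assume "X \<subseteq> E - A"
  then have "X \<inter> A = {}" by blast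
  then show ?thesis by (simp add: contract_vector_def)
qed

lemma supp_P': "supp P' = {I. I \<subseteq> E - A \<and> I \<union> B \<in> supp P}"
  unfolding supp_contract_vector using basisD(1) by blast

lemma P'_function: "plucker_function F (E - A) r' P'"
proof (rule plucker_functionI[OF _ _ P'_closed])
  have "(G - A) \<union> B = G" by blast
  then have "G - A \<in> supp P'" unfolding supp_P' using G_basis(1,2) by auto
  then show "supp P' \<noteq> {}" by blast
  show "supp P' \<subseteq> nsets (E - A) r'"
  proof
    fix I assume I: "I \<in> supp P'"
    then have sub: "I \<subseteq> E - A" and bas: "I \<union> B \<in> supp P" by (auto simp: supp_P')
    have "I \<inter> B = {}" using sub by blast
    moreover have "finite I" using basisD(2)[OF bas] by simp
    ultimately have "card I + card B = r" using card_Un_disjoint[of I B] finite_B basisD(3)[OF bas] by simp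
    then show "I \<in> nsets (E - A) r'" using sub \<open>finite I\<close> by (simp add: nsets_def)
  qed
qed

lemma P'_relation:
  assumes "I \<subseteq> E - A" "J \<subseteq> E - A" "plucker_relation F P (I \<union> B) (J \<union> B)"
  shows "plucker_relation F P' I J"
proof -
  have "plucker_relation F P' I J \<longleftrightarrow> plucker_relation F P (I \<union> B) (J \<union> B)"
    by (rule plucker_relation_twist[where U = "E - A"])
      (use finite_ground finite_B P'_twist assms in auto)
  then show ?thesis using assms(3) by simp
qed

lemma P'_cards:
  assumes "I \<subseteq> E - A" "J \<subseteq> E - A" "card I + 1 = r'" "card J = r' + 1"
  shows "I \<union> B \<subseteq> E" "J \<union> B \<subseteq> E" "card (I \<union> B) + 1 = r" "card (J \<union> B) = r + 1"
    "J \<union> B - (I \<union> B) = J - I"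
proof -
  have dis: "I \<inter> B = {}" "J \<inter> B = {}" using assms by blast+
  have fin: "finite I" "finite J"
    using assms(1,2) finite_ground finite_subset[of _ "E - A"] by auto
  show "card (I \<union> B) + 1 = r" "card (J \<union> B) = r + 1"
    using card_Un_disjoint[OF fin(1) finite_B dis(1)] card_Un_disjoint[OF fin(2) finite_B dis(2)] assms(3,4) card_B
    by simp_all
  show "I \<union> B \<subseteq> E" "J \<union> B \<subseteq> E" using assms(1,2) A by blast+
  show "J \<union> B - (I \<union> B) = J - I" using dis by blast
qed

lemma P'_bases: "matroid_bases (E - A) (supp P')"
proof -
  have "(G - A) \<union> B = G" by blast
  then have "\<exists>I\<subseteq>E - A. I \<union> B \<in> supp P" using G_basis(1,2) by (intro exI[of _ "G - A"]) auto
  then show ?thesis unfolding supp_P' using bases by (intro matroid_bases_minor) auto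
qed

lemma plucker_vector_contract:
  assumes "plucker_vector s F E r P"
  shows "plucker_vector s F (E - A) r' P'"
proof (cases s)
  case Weak
  have "plucker_relation F P' I J"
    if "I \<subseteq> E - A" "J \<subseteq> E - A" "card I + 1 = r'" "card J = r' + 1" "card (J - I) = 3" for I J
  proof -
    note c = P'_cards[OF that(1-4)]
    show ?thesis using relation[OF c(1-4)] c(5) that(5) by (intro P'_relation that) simp
  qed
  then show ?thesis unfolding Weak plucker_vector.simps using P'_function P'_bases by blast
next
  case Strong
  have rel: "plucker_relation F P I J" if "I \<subseteq> E" "J \<subseteq> E" "card I + 1 = r" "card J = r + 1" for I J
    using assms that unfolding Strong plucker_vector.simps by blast
  have "plucker_relation F P' I J"
    if "I \<subseteq> E - A" "J \<subseteq> E - A" "card I + 1 = r'" "card J = r' + 1" for I J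
    using P'_cards[OF that] by (intro P'_relation that rel)
  then show ?thesis unfolding Strong plucker_vector.simps using P'_function by blast
qed

sublocale P': weak_plucker F "E - A" r' P'
  by unfold_locales (rule plucker_vector_contract[OF weak])

lemma max_basis_of_contraction: "I \<in> supp P' \<Longrightarrow> I \<union> B \<in> max_bases A"
proof -
  assume "I \<in> supp P'"
  then have I: "I \<subseteq> E - A" "I \<union> B \<in> supp P" by (auto simp: supp_P')
  have eq: "(I \<union> B) \<inter> A = G \<inter> A" using I by blast
  have "card (X \<inter> A) \<le> card ((I \<union> B) \<inter> A)" if "X \<in> supp P" for X
    unfolding eq using max_basesD(2)[OF G that] .
  then show ?thesis using I(2) by (simp add: max_bases_def)
qed

lemma extend_max_basis:
  assumes "D \<in> max_bases A" "D' \<in> supp P" "S \<subseteq> A \<inter> D'"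
  obtains D'' where "D'' \<in> max_bases A" "S \<subseteq> D''" "D'' - A = D - A"
proof -
  obtain D'' where D'': "D'' \<in> supp P" "S \<subseteq> D''" "D'' - A = D - A" "card (D'' \<inter> A) = card (D \<inter> A)"
    using extend_within[OF max_basesD[OF assms(1)] assms(2,3)] .
  then have "D'' \<in> max_bases A" unfolding max_bases_def using max_basesD(2)[OF assms(1)] by simp
  then show ?thesis using that D'' by blast
qed

text \<open>The part of \<open>D\<close> inside \<open>A\<close> can be traded for \<open>B\<close>
  while the part outside stays, since a maximal trace containing \<open>B\<close> equals
  \<open>B\<close> by cardinality. Hence the part outside is a basis of the contraction.\<close>

lemma dependent_max_bases:
  assumes "y \<inter> A = {}" "\<And>I. I \<in> supp P' \<Longrightarrow> \<not> y \<subseteq> I" "D \<in> max_bases A"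
  shows "\<not> y \<subseteq> D"
proof
  assume "y \<subseteq> D"
  obtain D' where D': "D' \<in> max_bases A" "B \<subseteq> D'" "D' - A = D - A"
    using extend_max_basis[OF assms(3) G_basis(1), of B] by blast
  have "finite (D' \<inter> A)" using basisD(2)[OF max_basesD(1)[OF D'(1)]] by simp
  moreover have "B \<subseteq> D' \<inter> A" using D'(2) by blast
  ultimately have "B = D' \<inter> A" using card_subset_eq max_bases_card_eq[OF D'(1) G] by metis
  then have "(D' - A) \<union> B = D'" by blast
  then have "D' - A \<in> supp P'" unfolding supp_P' using basisD(1) max_basesD(1)[OF D'(1)] by auto
  moreover have "y \<subseteq> D' - A" using \<open>y \<subseteq> D\<close> D'(3) assms(1) by blast
  ultimately show False using assms(2) by blast
qed

text \<open>Since the circuit has an element \<open>i\<close> outside \<open>A\<close>, its part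
  inside \<open>A\<close> is independent. It can be extended within \<open>A\<close> without
  changing the part \<open>I\<close> outside; if \<open>I\<close> contained the restricted circuit,
  the resulting basis would contain the whole circuit.\<close>

lemma circuit_contract_dependent:
  assumes C: "supp (circuit_vector F P \<tau>) - A \<noteq> {}" and I: "I \<in> supp P'"
  shows "\<not> supp (circuit_vector F P \<tau>) - A \<subseteq> I"
proof
  let ?C = "supp (circuit_vector F P \<tau>)"
  assume sub: "?C - A \<subseteq> I"
  obtain i where i: "i \<in> ?C" "i \<notin> A" using C by blast
  have "?C \<inter> A \<subseteq> A \<inter> (\<tau> - {i})" using circuit_independent(2)[OF i(1)] i(2) by blast
  from extend_max_basis[OF max_basis_of_contraction[OF I] circuit_independent(1)[OF i(1)] this]
  obtain D where D: "D \<in> max_bases A" "?C \<inter> A \<subseteq> D" "D - A = (I \<union> B) - A" by blast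
  have "I \<inter> A = {}" using I by (auto simp: supp_P')
  then have "?C \<subseteq> D" using sub D(2,3) by blast
  then show False using circuit_dependent[OF _ max_basesD(1)[OF D(1)], of \<tau>] i by blast
qed

lemma circuit_vector_contract:
  assumes "\<tau> \<subseteq> E - A"
  shows "i \<notin> A \<Longrightarrow> circuit_vector F P' \<tau> i = pm (inversions \<tau> B) \<odot> circuit_vector F P (\<tau> \<union> B) i"
    and "circuit_vector F P' \<tau> = scale F (neg_one F [^] inversions \<tau> B) (remove_coords (circuit_vector F P (\<tau> \<union> B)) A)"
proof -
  show *: "circuit_vector F P' \<tau> i = pm (inversions \<tau> B) \<odot> circuit_vector F P (\<tau> \<union> B) i" if "i \<notin> A" for i
    by (rule circuit_vector_twist[where U = "E - A"])
      (use finite_ground finite_B P'_twist assms that in auto)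
  have "circuit_vector F P' \<tau> i = None" if "i \<in> A" for i
    using that assms by (intro circuit_vector_outside) blast
  then show "circuit_vector F P' \<tau> = scale F (neg_one F [^] inversions \<tau> B) (remove_coords (circuit_vector F P (\<tau> \<union> B)) A)"
    using * by (auto simp: scale_def remove_coords_def)
qed

lemma circuit_set_contract_subset:
  assumes "X \<in> circuit_set F (E - A) r' P'"
  obtains C where "C \<in> circuit_set F E r P" "X = remove_coords C A"
proof -
  obtain c \<tau> where c: "c \<in> carrier F" "\<tau> \<in> nsets (E - A) (r' + 1)" "supp (circuit_vector F P' \<tau>) \<noteq> {}"
    "X = scale F c (circuit_vector F P' \<tau>)" using assms by (rule circuit_setE)
  have \<tau>: "\<tau> \<subseteq> E - A" "finite \<tau>" "card \<tau> = r' + 1" using c(2) by (simp_all add: nsets_def)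
  have "\<tau> \<inter> B = {}" using \<tau>(1) by blast
  then have "card (\<tau> \<union> B) = r + 1" using card_Un_disjoint[OF \<tau>(2) finite_B] \<tau>(3) card_B by simp
  moreover have "\<tau> \<union> B \<subseteq> E" using \<tau>(1) A by blast
  ultimately have n: "\<tau> \<union> B \<in> nsets E (r + 1)" using \<tau>(2) finite_B by (simp add: nsets_def)
  let ?n = "neg_one F [^] inversions \<tau> B"
  have "X = remove_coords (scale F c (scale F ?n (circuit_vector F P (\<tau> \<union> B)))) A"
    unfolding c(4) circuit_vector_contract(2)[OF \<tau>(1)] remove_coords_scale ..
  also have "scale F c (scale F ?n (circuit_vector F P (\<tau> \<union> B))) = scale F (c \<otimes> ?n) (circuit_vector F P (\<tau> \<union> B))"
    using c(1) by (intro scale_scale) simp_all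
  finally have X: "X = remove_coords (scale F (c \<otimes> ?n) (circuit_vector F P (\<tau> \<union> B))) A" .
  have "supp (circuit_vector F P' \<tau>) \<subseteq> supp (circuit_vector F P (\<tau> \<union> B))"
    unfolding circuit_vector_contract(2)[OF \<tau>(1)] by auto
  then have "supp (circuit_vector F P (\<tau> \<union> B)) \<noteq> {}" using c(3) by blast
  then have "scale F (c \<otimes> ?n) (circuit_vector F P (\<tau> \<union> B)) \<in> circuit_set F E r P"
    using n c(1) by (intro circuit_setI) simp_all
  then show ?thesis using X by (rule that)
qed

lemma obtain_contract_circuit:
  assumes "supp (circuit_vector F P \<tau>) - A \<noteq> {}" "\<tau> \<subseteq> E"
  obtains X where "X \<in> circuit_set F (E - A) r' P'" "supp X \<subseteq> supp (circuit_vector F P \<tau>) - A"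
proof -
  have "supp (circuit_vector F P \<tau>) - A \<subseteq> E - A" using assms(2) by (auto simp: supp_circuit_vector)
  from P'.independent_iff[OF this] circuit_contract_dependent[OF assms(1)] that show ?thesis by blast
qed

text \<open>Three comparisons are chained. \<open>H\<close> carries the contraction circuit;
  \<open>D\<close> agrees with \<open>H\<close> outside \<open>A\<close> and contains the part of
  the given circuit inside \<open>A\<close>. Passing from \<open>H\<close> to \<open>D\<close> is a
  walk through bases of maximal trace. Over \<open>D\<close> the given circuit is the fundamental
  circuit of \<open>i\<close>, so it is determined up to scaling in the matroid itself.\<close>

lemma contract_circuits_proportional:
  assumes C: "supp (circuit_vector F P \<tau>) - A = supp (circuit_vector F P' \<tau>')" (is "?C - A = ?y")
    and ne: "supp (circuit_vector F P' \<tau>') \<noteq> {}" and \<tau>: "\<tau> \<subseteq> E" "\<tau>' \<subseteq> E - A"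
  shows "proportional_on ?y (circuit_vector F P' \<tau>') (circuit_vector F P \<tau>)"
proof -
  obtain i where i: "i \<in> ?y" using ne by blast
  then have iC: "i \<in> ?C" "i \<notin> A" using C by blast+
  have D': "\<tau>' - {i} \<in> supp P'" "?y - {i} \<subseteq> \<tau>' - {i}" "i \<in> \<tau>'" using P'.circuit_independent[OF i] by blast+
  define H where "H = \<tau>' - {i} \<union> B"
  have H: "H \<in> max_bases A" "insert i H = \<tau>' \<union> B" "i \<notin> H"
    using max_basis_of_contraction[OF D'(1)] D'(3) iC(2) by (auto simp: H_def)
  have "?C \<inter> A \<subseteq> A \<inter> (\<tau> - {i})" using circuit_independent(2)[OF iC(1)] iC(2) by blast
  from extend_max_basis[OF H(1) circuit_independent(1)[OF iC(1)] this]
  obtain D where D: "D \<in> max_bases A" "?C \<inter> A \<subseteq> D" "D - A = H - A" by blast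
  have yA: "?y \<inter> A = {}" "?y \<subseteq> E" using C \<tau>(1) by (auto simp: supp_circuit_vector)
  have yH: "?y - {i} \<subseteq> H" using D'(2) by (auto simp: H_def)
  then have yD: "?y - {i} \<subseteq> D" using D(3) yA(1) by blast
  have iD: "i \<notin> D" using D(3) H(3) iC(2) by blast
  have dep: "\<not> ?y \<subseteq> I" if "I \<in> supp P'" for I
    using circuit_contract_dependent[OF _ that, of \<tau>] C ne by simp
  have 1: "proportional_on ?y (circuit_vector F P (insert i D)) (circuit_vector F P \<tau>)"
  proof -
    have "?C \<noteq> {}" "?C \<subseteq> insert i D" using iC(1) C D(2) yD by blast+
    moreover have "insert i D - {i} \<in> supp P" using iD max_basesD(1)[OF D(1)] by simp
    ultimately obtain e where "e \<in> carrier F" "circuit_vector F P (insert i D) = scale F e (circuit_vector F P \<tau>)"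
      using same_support_proportional[OF _ _ \<tau>(1) iC(1), of "insert i D"] by blast
    then have "proportional_on ?y (circuit_vector F P \<tau>) (circuit_vector F P (insert i D))"
      unfolding proportional_on_def by auto
    then show ?thesis by (rule proportional_on_sym) simp
  qed
  have 2: "proportional_on ?y (circuit_vector F P (insert i H)) (circuit_vector F P (insert i D))"
    unfolding proportional_on_def
    using yA i dependent_max_bases[OF yA(1) dep] H(1) yH D(1) yD by (rule circuit_vectors_proportional)
  have "proportional_on ?y (circuit_vector F P (\<tau>' \<union> B)) (circuit_vector F P' \<tau>')"
    using yA(1) circuit_vector_contract(1)[OF \<tau>(2)]
    by (intro proportional_onI[of "neg_one F [^] inversions \<tau>' B"]) auto
  then have 3: "proportional_on ?y (circuit_vector F P' \<tau>') (circuit_vector F P (insert i H))"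
    unfolding H(2) by (rule proportional_on_sym) simp
  show ?thesis
    by (rule proportional_on_trans[OF proportional_on_trans[OF 3 2] 1]) simp_all
qed

text \<open>Every nonempty restricted support contains the support of a contraction circuit. This
  makes contraction circuits minimal and, together with proportionality, makes each minimal
  restriction a multiple of one of them.\<close>

theorem circuit_set_contract:
  "circuit_set F (E - A) r' P' = min_supp ((\<lambda>C. remove_coords C A) ` circuit_set F E r P)"
proof
  let ?\<X> = "(\<lambda>C. remove_coords C A) ` circuit_set F E r P"
  have below: "\<exists>X\<in>circuit_set F (E - A) r' P'. supp X \<subseteq> supp Y" if Y: "Y \<in> ?\<X>" "supp Y \<noteq> {}" for Y
  proof -
    obtain C where C: "C \<in> circuit_set F E r P" "Y = remove_coords C A" using Y(1) by blast
    obtain c \<tau> where c: "\<tau> \<in> nsets E (r + 1)" "C = scale F c (circuit_vector F P \<tau>)"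
      using C(1) by (rule circuit_setE)
    have s: "supp Y = supp (circuit_vector F P \<tau>) - A" unfolding C(2) c(2) by simp
    have "\<tau> \<subseteq> E" using c(1) by (simp add: nsets_def)
    then obtain X where "X \<in> circuit_set F (E - A) r' P'" "supp X \<subseteq> supp (circuit_vector F P \<tau>) - A"
      using obtain_contract_circuit[of \<tau>] Y(2) s by metis
    then show ?thesis using s by blast
  qed
  show "circuit_set F (E - A) r' P' \<subseteq> min_supp ?\<X>"
  proof
    fix X assume X: "X \<in> circuit_set F (E - A) r' P'"
    obtain \<tau> where \<tau>: "supp X = supp (circuit_vector F P' \<tau>)" "supp X \<noteq> {}"
      using X by (rule circuit_setE) auto
    have "X \<in> ?\<X>" using X by (rule circuit_set_contract_subset) blast
    moreover have "\<not> supp Y \<subset> supp X" if Y: "Y \<in> ?\<X>" "supp Y \<noteq> {}" for Y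
    proof
      assume lt: "supp Y \<subset> supp X"
      then obtain i where i: "i \<in> supp X" "i \<notin> supp Y" by blast
      obtain X' where X': "X' \<in> circuit_set F (E - A) r' P'" "supp X' \<subseteq> supp Y" using below[OF Y] by blast
      \<comment> \<open>Removing \<open>i\<close> from the circuit leaves an independent set, into
        which the smaller circuit \<open>X'\<close> would fit.\<close>
      have ind: "\<tau> - {i} \<in> supp P'" "supp X - {i} \<subseteq> \<tau> - {i}"
        using P'.circuit_independent[of i \<tau>] i(1) \<tau>(1) by auto
      then have "\<tau> - {i} \<subseteq> E - A" using P'.basisD(1) by blast
      from P'.independent_iff[OF this] ind(1) have "\<not> supp X' \<subseteq> \<tau> - {i}" using X'(1) by blast
      then show False using X'(2) lt i(2) ind(2) by blast
    qed
    ultimately show "X \<in> min_supp ?\<X>" using \<tau>(2) unfolding min_supp_def by blast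
  qed
  show "min_supp ?\<X> \<subseteq> circuit_set F (E - A) r' P'"
  proof
    fix Y assume "Y \<in> min_supp ?\<X>"
    then have Y: "Y \<in> ?\<X>" "supp Y \<noteq> {}" and min: "\<And>X. X \<in> ?\<X> \<Longrightarrow> supp X \<noteq> {} \<Longrightarrow> \<not> supp X \<subset> supp Y"
      unfolding min_supp_def by blast+
    obtain X where X: "X \<in> circuit_set F (E - A) r' P'" "supp X \<subseteq> supp Y" using below[OF Y] by blast
    obtain c' \<tau>' where \<tau>': "c' \<in> carrier F" "\<tau>' \<in> nsets (E - A) (r' + 1)" "supp (circuit_vector F P' \<tau>') \<noteq> {}"
      "X = scale F c' (circuit_vector F P' \<tau>')" using X(1) by (rule circuit_setE)
    have "X \<in> ?\<X>" using X(1) by (rule circuit_set_contract_subset) blast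
    then have sXY: "supp X = supp Y" using min[of X] X(2) \<tau>'(3,4) by auto
    obtain C where C: "C \<in> circuit_set F E r P" "Y = remove_coords C A" using Y(1) by blast
    obtain c \<tau> where c: "c \<in> carrier F" "\<tau> \<in> nsets E (r + 1)" "C = scale F c (circuit_vector F P \<tau>)"
      using C(1) by (rule circuit_setE)
    let ?X = "circuit_vector F P' \<tau>'"
    have sY: "supp Y = supp (circuit_vector F P \<tau>) - A" unfolding C(2) c(3) by simp
    have sX: "supp Y = supp ?X" using sXY by (simp add: \<tau>'(4))
    have "proportional_on (supp ?X) ?X (circuit_vector F P \<tau>)"
      using sX sY \<tau>'(2,3) c(2) by (intro contract_circuits_proportional) (simp_all add: nsets_def)
    moreover have "proportional_on (supp ?X) (circuit_vector F P \<tau>) Y"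
    proof (rule proportional_onI[OF c(1)])
      fix j assume "j \<in> supp ?X"
      then have "j \<notin> A" using sX sY by blast
      then show "Y j = Some c \<odot> circuit_vector F P \<tau> j" unfolding C(2) c(3) by (simp add: remove_coords_def scale_def)
    qed
    ultimately have "proportional_on (supp ?X) ?X Y" by (rule proportional_on_trans) simp
    then obtain d where "d \<in> carrier F" "Y = scale F d ?X" using sX by (rule proportional_on_supp)
    then show "Y \<in> circuit_set F (E - A) r' P'" using \<tau>'(2,3) circuit_setI by simp
  qed
qed

end

section \<open>Extension by coloops\<close>

context weak_plucker
begin

lemma supp_coloop_vector_subset:
  assumes "X \<in> supp (coloop_vector F P A)"
  shows "A \<subseteq> X" "X - A \<in> supp P" "X \<subseteq> E \<union> A"
  using assms basisD(1)[of "X - A"] by (auto simp: supp_coloop_vector)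

lemma plucker_vector_coloops:
  assumes P: "plucker_vector s F E r P" and A: "finite A" "A \<inter> E = {}"
  shows "plucker_vector s F (E \<union> A) (r + card A) (coloop_vector F P A)"
proof -
  let ?R = "coloop_vector F P A"
  have closed: "set_option (?R X) \<subseteq> carrier F" for X by (simp add: coloop_vector_def omult_closed)
  have un: "X \<union> A - A = X" if "X \<subseteq> E" for X using that A(2) by blast
  have card: "card X = card (X - A) + card A" if "A \<subseteq> X" "X \<subseteq> E \<union> A" for X
  proof -
    have "finite X" using that(2) A(1) finite_ground finite_subset by blast
    then show ?thesis using card_Diff_subset[OF A(1) that(1)] card_mono[OF _ that(1)] by simp
  qed
  have fn: "plucker_function F (E \<union> A) (r + card A) ?R"
  proof (rule plucker_functionI[OF _ _ closed])
    obtain D where D: "D \<in> supp P" using basis_nonempty by blast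
    then have "D \<union> A \<in> supp ?R" using un[OF basisD(1)[OF D]] by (simp add: supp_coloop_vector)
    then show "supp ?R \<noteq> {}" by blast
    show "supp ?R \<subseteq> nsets (E \<union> A) (r + card A)"
    proof
      fix X assume X: "X \<in> supp ?R"
      note X = supp_coloop_vector_subset[OF this]
      have "finite X" using X(3) A(1) finite_ground finite_subset by blast
      then show "X \<in> nsets (E \<union> A) (r + card A)"
        using card[OF X(1,3)] basisD(3)[OF X(2)] X(3) by (simp add: nsets_def)
    qed
  qed
  \<comment> \<open>The sign in the definition of \<open>?R\<close> meets an equal sign here, and
    the two cancel.\<close>
  have twist: "P X = pm (inversions X A) \<odot> ?R (X \<union> A)" if "X \<subseteq> E" for X
    using un[OF that] by (simp add: coloop_vector_def pm_pm_omult pm_even omult_one)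
  have rel: "plucker_relation F ?R I J"
    if IJ: "I \<subseteq> E \<union> A" "J \<subseteq> E \<union> A"
      and h: "A \<subseteq> I \<Longrightarrow> A \<subseteq> J \<Longrightarrow> plucker_relation F P (I - A) (J - A)" for I J
  proof (cases "A \<subseteq> I \<and> A \<subseteq> J")
    case True
    have sub: "I - A \<subseteq> E" "J - A \<subseteq> E" using IJ by blast+
    have "plucker_relation F P (I - A) (J - A) \<longleftrightarrow> plucker_relation F ?R ((I - A) \<union> A) ((J - A) \<union> A)"
      by (rule plucker_relation_twist[where U = E]) (use finite_ground A sub twist closed in auto)
    moreover have "(I - A) \<union> A = I" "(J - A) \<union> A = J" using True by blast+
    ultimately show ?thesis using h True by simp
  next
    case False
    \<comment> \<open>If \<open>A\<close> is not inside \<open>J\<close>, the second factor is zero.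
      If it is not inside \<open>I\<close>, a nonzero first factor forces \<open>j\<close> to be the
      missing element of \<open>A\<close>, and then \<open>A\<close> is not inside
      \<open>J - {j}\<close>.\<close>
    have none: "?R (insert j I) \<odot> ?R (J - {j}) = None" if "j \<in> J - I" for j
      using False that by (auto simp: coloop_vector_def)
    have "{j \<in> J - I. Some (plucker_sign F j I J) \<odot> (?R (insert j I) \<odot> ?R (J - {j})) \<noteq> None} = {}"
    proof (rule equals0I)
      fix j assume "j \<in> {j \<in> J - I. Some (plucker_sign F j I J) \<odot> (?R (insert j I) \<odot> ?R (J - {j})) \<noteq> None}"
      then show False using none[of j] by auto
    qed
    then show ?thesis unfolding plucker_relation_def formal_sum_def
      by (simp only: mset_set.empty image_mset_empty zero_in_null_set)
  qed
  have cards: "I - A \<subseteq> E" "J - A \<subseteq> E" "card (I - A) + 1 = r" "card (J - A) = r + 1"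
      "(J - A) - (I - A) = J - I"
    if "I \<subseteq> E \<union> A" "J \<subseteq> E \<union> A" "card I + 1 = r + card A" "card J = r + card A + 1" "A \<subseteq> I" "A \<subseteq> J" for I J
    using card[OF that(5,1)] card[OF that(6,2)] that by auto
  show ?thesis
  proof (cases s)
    case Weak
    have "matroid_bases (E \<union> A) (supp ?R)" unfolding matroid_bases_def
    proof (intro conjI ballI)
      show "finite (E \<union> A)" using finite_ground A by simp
      show "supp ?R \<noteq> {}" using fn unfolding plucker_function_def by blast
      show "supp ?R \<subseteq> Pow (E \<union> A)" using supp_coloop_vector_subset(3) by blast
      fix X Y a assume X: "X \<in> supp ?R" and Y: "Y \<in> supp ?R" and a: "a \<in> X - Y"
      note X = supp_coloop_vector_subset[OF X] and Y = supp_coloop_vector_subset[OF Y]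
      have "a \<in> (X - A) - (Y - A)" using a Y(1) by blast
      from exchange[OF X(2) Y(2) this]
      obtain b where b: "b \<in> (Y - A) - (X - A)" "insert b (X - A - {a}) \<in> supp P" by blast
      have "A \<subseteq> insert b (X - {a})" using X(1) Y(1) a by blast
      moreover have "insert b (X - {a}) - A = insert b (X - A - {a})" using b(1) by blast
      ultimately have "insert b (X - {a}) \<in> supp ?R" using b(2) by (simp add: supp_coloop_vector)
      then show "\<exists>b\<in>Y - X. insert b (X - {a}) \<in> supp ?R" using b(1) by blast
    qed
    moreover have "plucker_relation F ?R I J"
      if "I \<subseteq> E \<union> A" "J \<subseteq> E \<union> A" "card I + 1 = r + card A" "card J = r + card A + 1" "card (J - I) = 3" for I J
    proof (rule rel[OF that(1,2)])
      assume "A \<subseteq> I" "A \<subseteq> J"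
      note c = cards[OF that(1-4) this]
      show "plucker_relation F P (I - A) (J - A)" using c that(5) by (intro relation) simp_all
    qed
    ultimately show ?thesis unfolding Weak plucker_vector.simps using fn by blast
  next
    case Strong
    have "plucker_relation F ?R I J"
      if "I \<subseteq> E \<union> A" "J \<subseteq> E \<union> A" "card I + 1 = r + card A" "card J = r + card A + 1" for I J
    proof (rule rel[OF that(1,2)])
      assume "A \<subseteq> I" "A \<subseteq> J"
      from cards[OF that this] show "plucker_relation F P (I - A) (J - A)"
        using P unfolding Strong plucker_vector.simps by blast
    qed
    then show ?thesis unfolding Strong plucker_vector.simps using fn by blast
  qed
qed

text \<open>A nonzero circuit vector of the extension belongs to a set containing \<open>A\<close>.
  Such sets correspond to \<open>(r+1)\<close>-subsets of \<open>E\<close> by removing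
  \<open>A\<close>, and twisting changes the vector only by a sign.\<close>

lemma circuit_set_coloops:
  assumes A: "finite A" "A \<inter> E = {}"
  shows "circuit_set F (E \<union> A) (r + card A) (coloop_vector F P A) = circuit_set F E r P"
proof -
  let ?R = "coloop_vector F P A"
  have closed: "set_option (?R X) \<subseteq> carrier F" for X by (simp add: coloop_vector_def omult_closed)
  have un: "X \<union> A - A = X" if "X \<subseteq> E" for X using that A(2) by blast
  have twist: "P X = pm (inversions X A) \<odot> ?R (X \<union> A)" if "X \<subseteq> E" for X
    using un[OF that] by (simp add: coloop_vector_def pm_pm_omult pm_even omult_one)
  have cv: "circuit_vector F P \<tau> = scale F (neg_one F [^] inversions \<tau> A) (circuit_vector F ?R (\<tau> \<union> A))"
    if \<tau>: "\<tau> \<subseteq> E" for \<tau>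
  proof
    fix i
    show "circuit_vector F P \<tau> i = scale F (neg_one F [^] inversions \<tau> A) (circuit_vector F ?R (\<tau> \<union> A)) i"
    proof (cases "i \<in> A")
      case True
      \<comment> \<open>Coordinates in \<open>A\<close> vanish on both sides: on the left
        \<open>i\<close> is outside \<open>\<tau>\<close>, on the right the set without
        \<open>i\<close> no longer contains \<open>A\<close>.\<close>
      then have "i \<notin> \<tau>" "\<not> A \<subseteq> \<tau> \<union> A - {i}" using \<tau> A(2) by blast+
      then show ?thesis by (simp add: scale_def circuit_vector_def coloop_vector_def)
    next
      case False
      show ?thesis unfolding scale_def
        by (rule circuit_vector_twist[where U = E]) (use finite_ground A \<tau> twist closed False in auto)
    qed
  qed
  have ccl: "set_option (circuit_vector F ?R \<tau> i) \<subseteq> carrier F" for \<tau> i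
    using closed by (simp add: circuit_vector_def omult_closed)
  show ?thesis
  proof
    show "circuit_set F (E \<union> A) (r + card A) ?R \<subseteq> circuit_set F E r P"
    proof
      fix X assume "X \<in> circuit_set F (E \<union> A) (r + card A) ?R"
      then obtain c \<tau> where c: "c \<in> carrier F" "\<tau> \<in> nsets (E \<union> A) (r + card A + 1)"
        "supp (circuit_vector F ?R \<tau>) \<noteq> {}" "X = scale F c (circuit_vector F ?R \<tau>)" by (rule circuit_setE)
      obtain i where "i \<in> supp (circuit_vector F ?R \<tau>)" using c(3) by blast
      then have "A \<subseteq> \<tau>" by (auto simp: supp_circuit_vector supp_coloop_vector)
      define \<sigma> where "\<sigma> = \<tau> - A"
      have \<sigma>: "\<sigma> \<union> A = \<tau>" "\<sigma> \<subseteq> E" using \<open>A \<subseteq> \<tau>\<close> c(2) by (auto simp: \<sigma>_def nsets_def)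
      have fin: "finite \<sigma>" "\<sigma> \<inter> A = {}" using c(2) by (auto simp: \<sigma>_def nsets_def)
      have "card \<sigma> = r + 1" using card_Un_disjoint[OF fin(1) A(1) fin(2)] c(2) by (simp add: \<sigma>(1) nsets_def)
      then have n: "\<sigma> \<in> nsets E (r + 1)" using fin \<sigma> by (simp add: nsets_def)
      let ?n = "neg_one F [^] inversions \<sigma> A"
      have eq: "circuit_vector F P \<sigma> = scale F ?n (circuit_vector F ?R \<tau>)" using cv[OF \<sigma>(2)] by (simp only: \<sigma>(1))
      then have "circuit_vector F ?R \<tau> = scale F (inv ?n) (circuit_vector F P \<sigma>)"
        using ccl by (intro scale_inverse) simp_all
      then have "X = scale F (c \<otimes> inv ?n) (circuit_vector F P \<sigma>)" using c(1,4) by (simp add: scale_scale)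
      moreover have "supp (circuit_vector F P \<sigma>) \<noteq> {}" using c(3) by (simp add: eq)
      ultimately show "X \<in> circuit_set F E r P" using c(1) n circuit_setI[of "c \<otimes> inv ?n" \<sigma> E r P] by simp
    qed
    show "circuit_set F E r P \<subseteq> circuit_set F (E \<union> A) (r + card A) ?R"
    proof
      fix X assume "X \<in> circuit_set F E r P"
      then obtain c \<tau> where c: "c \<in> carrier F" "\<tau> \<in> nsets E (r + 1)"
        "supp (circuit_vector F P \<tau>) \<noteq> {}" "X = scale F c (circuit_vector F P \<tau>)" by (rule circuit_setE)
      have \<tau>: "\<tau> \<subseteq> E" "finite \<tau>" "card \<tau> = r + 1" using c(2) by (simp_all add: nsets_def)
      then have "\<tau> \<inter> A = {}" using A(2) by blast
      then have n: "\<tau> \<union> A \<in> nsets (E \<union> A) (r + card A + 1)"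
        using card_Un_disjoint[OF \<tau>(2) A(1)] \<tau> A(1) by (auto simp: nsets_def)
      let ?n = "neg_one F [^] inversions \<tau> A"
      have "X = scale F (c \<otimes> ?n) (circuit_vector F ?R (\<tau> \<union> A))"
        unfolding c(4) cv[OF \<tau>(1)] using c(1) ccl by (intro scale_scale) simp_all
      moreover have "supp (circuit_vector F ?R (\<tau> \<union> A)) \<noteq> {}" using c(3) by (simp add: cv[OF \<tau>(1)])
      ultimately show "X \<in> circuit_set F (E \<union> A) (r + card A) ?R"
        using c(1) n circuit_setI[of "c \<otimes> ?n" "\<tau> \<union> A"] by simp
    qed
  qed
qed

end

section \<open>Existence of contractions and coloop extensions\<close>

context tract
begin

lemma fmatroid_obtains:
  assumes "is_fmatroid s F M"
  obtains P where "plucker_vector s F (ground M) (mrank M) P" "plucker_class M = scaling_class F P"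
    "weak_plucker F (ground M) (mrank M) P" "circuits F M = circuit_set F (ground M) (mrank M) P"
proof -
  obtain P where P: "finite (ground M)" "plucker_vector s F (ground M) (mrank M) P" "plucker_class M = scaling_class F P"
    using assms unfolding is_fmatroid_def by blast
  interpret weak_plucker F "ground M" "mrank M" P
    by unfold_locales (rule weak_if_plucker_vector[OF P(1,2)])
  show ?thesis using that P weak_plucker_axioms circuits_eq_circuit_set[OF pf P(3)] by blast
qed

text \<open>The witness \<open>N\<close> is built from some basis of maximal trace on
  \<open>A\<close>; \<open>fmatroid_eqI\<close> shows that it is the matroid described, whichever
  basis was chosen.\<close>

lemma contraction_exists:
  fixes M :: "('i::linorder, 'a) fmatroid"
  assumes M: "is_fmatroid s F M" and A: "A \<subseteq> ground M"
  shows "is_fmatroid s F (contraction s F M A)" "ground (contraction s F M A) = ground M - A"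
proof -
  obtain P where P: "plucker_vector s F (ground M) (mrank M) P" "weak_plucker F (ground M) (mrank M) P"
      "circuits F M = circuit_set F (ground M) (mrank M) P"
    using fmatroid_obtains[OF M] by metis
  interpret weak_plucker F "ground M" "mrank M" P by (rule P(2))
  obtain G where G: "G \<in> max_bases A" by (rule obtain_max_basis)
  interpret contracted F "ground M" "mrank M" P A G by unfold_locales (rule A G)+
  define N where "N = \<lparr>ground = ground M - A, mrank = r', plucker_class = scaling_class F P'\<rparr>"
  have "is_fmatroid s F N" unfolding is_fmatroid_def N_def
    using finite_ground plucker_vector_contract[OF P(1)] by auto
  moreover have "circuits F N = circuit_set F (ground M - A) r' P'"
    using circuits_eq_circuit_set[of N P'] P'_function by (simp add: N_def)
  ultimately have N: "is_fmatroid s F N \<and> ground N = ground M - A \<and>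
      circuits F N = min_supp ((\<lambda>C. remove_coords C A) ` circuits F M)"
    by (simp add: P(3) circuit_set_contract N_def)
  have "contraction s F M A = N" unfolding contraction_def
    using N by (rule the_equality) (use N fmatroid_eqI in metis)
  then show "is_fmatroid s F (contraction s F M A)" "ground (contraction s F M A) = ground M - A"
    using N by simp_all
qed

lemma add_coloops_exists:
  fixes M :: "('i::linorder, 'a) fmatroid"
  assumes M: "is_fmatroid s F M" and A: "finite A" "A \<inter> ground M = {}"
  shows "is_fmatroid s F (add_coloops s F M A)" "ground (add_coloops s F M A) = ground M \<union> A"
proof -
  obtain P where P: "plucker_vector s F (ground M) (mrank M) P" "weak_plucker F (ground M) (mrank M) P"
      "circuits F M = circuit_set F (ground M) (mrank M) P"
    using fmatroid_obtains[OF M] by metis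
  interpret weak_plucker F "ground M" "mrank M" P by (rule P(2))
  let ?R = "coloop_vector F P A"
  define N where "N = \<lparr>ground = ground M \<union> A, mrank = mrank M + card A, plucker_class = scaling_class F ?R\<rparr>"
  have R: "plucker_vector s F (ground M \<union> A) (mrank M + card A) ?R"
    using P(1) A by (rule plucker_vector_coloops)
  have fin: "finite (ground M \<union> A)" using finite_ground A by simp
  have fm: "is_fmatroid s F N" unfolding is_fmatroid_def N_def using fin R by auto
  have "plucker_function F (ground M \<union> A) (mrank M + card A) ?R"
    using weak_if_plucker_vector[OF fin R] unfolding plucker_vector.simps by (rule conjunct1)
  then have "circuits F N = circuit_set F (ground M \<union> A) (mrank M + card A) ?R"
    using circuits_eq_circuit_set[of N ?R] by (simp add: N_def)
  then have N: "is_fmatroid s F N \<and> ground N = ground M \<union> A \<and> mrank N = mrank M + card A \<and>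
      circuits F N = circuits F M"
    using fm by (simp add: P(3) circuit_set_coloops[OF A] N_def)
  have "add_coloops s F M A = N" unfolding add_coloops_def
    using N by (rule the_equality) (use N fmatroid_eqI in metis)
  then show "is_fmatroid s F (add_coloops s F M A)" "ground (add_coloops s F M A) = ground M \<union> A"
    using N by simp_all
qed

end

section \<open>Initial vectors\<close>

context tract
begin

abbreviation trop :: "('a \<times> 'g::linordered_ab_group_add) tract" where "trop \<equiv> trop_ext F"

lemma trop_simps [simp]:
  "carrier trop = carrier F \<times> UNIV"
  "(a, \<gamma>) \<otimes>\<^bsub>trop\<^esub> (b, \<delta>) = (a \<otimes> b, \<gamma> + \<delta>)"
  "\<one>\<^bsub>trop\<^esub> = (\<one>, 0)"
  by (simp_all add: trop_ext_def)

lemma trop_null_iff: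
  "X \<in> null_set trop \<longleftrightarrow> set_mset X \<subseteq> carrier F \<times> UNIV \<and> (X = {#} \<or> image_mset fst (min_part X) \<in> null_set F)"
  by (simp add: trop_ext_def)

lemma tract_trop: "tract (trop :: ('a \<times> 'g::linordered_ab_group_add) tract)"
  by (rule tract_trop_ext) (rule tract_axioms)

lemma neg_one_trop: "neg_one (trop :: ('a \<times> 'g::linordered_ab_group_add) tract) = (neg_one F, 0)"
proof -
  interpret T: tract "trop :: ('a \<times> 'g) tract" by (rule tract_trop)
  have "{#\<one>\<^bsub>trop\<^esub>, (neg_one F, 0 :: 'g)#} \<in> null_set trop"
    using neg_one by (simp add: trop_null_iff min_part_def)
  from T.neg_one_unique[OF _ this] neg_one show ?thesis by simp
qed

lemma plucker_sign_trop: "plucker_sign (trop :: ('a \<times> 'g::linordered_ab_group_add) tract) j I J = (plucker_sign F j I J, 0)"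
proof -
  interpret T: tract "trop :: ('a \<times> 'g) tract" by (rule tract_trop)
  have "(neg_one F, 0 :: 'g) [^]\<^bsub>trop\<^esub> n = (neg_one F [^] n, 0)" for n :: nat
    by (induction n) simp_all
  then show ?thesis by (simp add: plucker_sign_def neg_one_trop)
qed

text \<open>Nullity in the tropical extension is tested on leading coefficients, and
  \<open>g\<close> selects these within the family \<open>f\<close>. The point is that selecting
  minimal terms by index agrees with selecting them in the multiset.\<close>

lemma formal_sum_trop_null:
  fixes f :: "'j \<Rightarrow> ('a \<times> 'g::linordered_ab_group_add) option"
  assumes fin: "finite A" and null: "formal_sum f A \<in> null_set trop"
    and g: "\<And>j. j \<in> A \<Longrightarrow> g j =
      (if f j \<noteq> None \<and> (\<forall>k\<in>A. f k \<noteq> None \<longrightarrow> snd (the (f j)) \<le> snd (the (f k))) then angular (f j) else None)"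
  shows "formal_sum g A \<in> null_set F"
proof -
  define S where "S = {j \<in> A. f j \<noteq> None}"
  define S' where "S' = {j \<in> S. \<forall>k\<in>S. snd (the (f j)) \<le> snd (the (f k))}"
  have finS: "finite S" "finite S'" using fin by (simp_all add: S_def S'_def)
  have gS: "{j \<in> A. g j \<noteq> None} = S'"
  proof (rule Set.set_eqI)
    fix j show "j \<in> {j \<in> A. g j \<noteq> None} \<longleftrightarrow> j \<in> S'"
      by (cases "j \<in> A"; cases "f j") (auto simp: g S'_def S_def angular_def)
  qed
  have "the (g j) = fst (the (f j))" if j: "j \<in> S'" for j
  proof -
    have "j \<in> A" "g j \<noteq> None" using j gS by blast+
    then show ?thesis using g[of j] by (auto simp: angular_def split: if_splits)
  qed
  then have sum_g: "formal_sum g A = image_mset (\<lambda>j. fst (the (f j))) (mset_set S')"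
    unfolding formal_sum_def gS using finS(2) by (intro image_mset_cong) simp
  have sum_f: "formal_sum f A = image_mset (\<lambda>j. the (f j)) (mset_set S)"
    unfolding formal_sum_def S_def ..
  have "min_part (formal_sum f A) = image_mset (\<lambda>j. the (f j)) (mset_set S')"
    unfolding sum_f min_part_def S'_def using finS(1) by (simp add: filter_mset_image_mset)
  then have "image_mset fst (min_part (formal_sum f A)) = formal_sum g A"
    unfolding sum_g by (simp add: image_mset.compositionality comp_def)
  moreover have "formal_sum g A = {#}" if "formal_sum f A = {#}"
  proof -
    have "S = {}" using that finS(1) by (simp add: sum_f mset_set_empty_iff)
    then show ?thesis by (simp add: sum_g S'_def)
  qed
  ultimately show ?thesis using null zero_in_null_set by (auto simp: trop_null_iff)
qed

end

lemma opt_mult_trop_Some: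
  "opt_mult (trop_ext F) (Some (a, \<gamma>)) (Some (b, \<delta>)) = Some (a \<otimes>\<^bsub>F\<^esub> b, \<gamma> + \<delta>)"
  by (simp add: trop_ext_def)

text \<open>Meaningful on the support only, since \<open>the None\<close> is unspecified.
  Quantifying over \<open>supp P\<close> replaces the comparisons with infinity.\<close>

definition shifted_val :: "('i \<Rightarrow> 'g::linordered_ab_group_add) \<Rightarrow> ('i set \<Rightarrow> ('f \<times> 'g) option) \<Rightarrow> 'i set \<Rightarrow> 'g" where
  "shifted_val u P X = snd (the (P X)) - (\<Sum>i\<in>X. u i)"

lemma initial_vector_eq:
  assumes "supp P \<subseteq> nsets E r"
  shows "initial_vector E r u P X =
    (if X \<in> supp P \<and> (\<forall>Y\<in>supp P. shifted_val u P X \<le> shifted_val u P Y) then angular (P X) else None)"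
proof (cases "P X")
  case None
  then show ?thesis by (simp add: initial_vector_def angular_def)
next
  case (Some p)
  then have X: "X \<in> supp P" by (simp add: supp_def)
  have "le_infty (diff_infty (absval (P X)) (\<Sum>i\<in>X. u i)) (diff_infty (absval (P Y)) (\<Sum>j\<in>Y. u j)) \<longleftrightarrow>
      (Y \<in> supp P \<longrightarrow> shifted_val u P X \<le> shifted_val u P Y)" for Y
    using Some by (cases "P Y") (simp_all add: absval_def diff_infty_def shifted_val_def supp_def)
  then show ?thesis using X assms unfolding initial_vector_def by auto
qed

section \<open>Initial vectors of a fixed tropical Pluecker vector\<close>

locale trop_plucker = base: tract F for F (structure) +
  fixes E :: "'i::linorder set" and r :: nat and P :: "'i set \<Rightarrow> ('a \<times> 'g::linordered_ab_group_add) option"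
  assumes weak_trop: "plucker_vector Weak (trop_ext F) E r P"
begin

sublocale T: weak_plucker "trop_ext F :: ('a \<times> 'g) tract" E r P
  using base.tract_trop weak_trop by (intro weak_plucker.intro weak_plucker_axioms.intro)

abbreviation "Pu u \<equiv> initial_vector E r u P"

lemma supp_P: "supp P \<subseteq> nsets E r"
  by (fact T.uniform)

lemma Pu_eq: "Pu u X =
    (if X \<in> supp P \<and> (\<forall>Y\<in>supp P. shifted_val u P X \<le> shifted_val u P Y) then angular (P X) else None)"
  using supp_P by (rule initial_vector_eq)

lemma supp_Pu: "supp (Pu u) = {X \<in> supp P. \<forall>Y\<in>supp P. shifted_val u P X \<le> shifted_val u P Y}"
  by (auto simp: supp_def[of "Pu u"] Pu_eq angular_def) (auto simp: supp_def)

lemma Pu_function: "plucker_function F E r (Pu u)"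
proof (rule base.plucker_functionI)
  obtain X where "X \<in> supp P" "\<And>Y. Y \<in> supp P \<Longrightarrow> shifted_val u P X \<le> shifted_val u P Y"
    using finite_obtains_min[OF T.finite_bases T.basis_nonempty, of "shifted_val u P"] by blast
  then show "supp (Pu u) \<noteq> {}" unfolding supp_Pu by blast
  show "supp (Pu u) \<subseteq> nsets E r" unfolding supp_Pu using supp_P by blast
  show "set_option (Pu u X) \<subseteq> carrier F" for X
  proof (cases "P X")
    case (Some p)
    have "p \<in> carrier (trop_ext F)" using T.P_closed[of X] unfolding Some by simp
    then have "fst p \<in> carrier F" by (auto simp: trop_ext_def)
    then show ?thesis using Some by (auto simp: Pu_eq angular_def)
  qed (simp add: Pu_eq angular_def)
qed

text \<open>\<open>insert j I\<close> and \<open>J - {j}\<close> together contain the elements of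
  \<open>I\<close> and \<open>J\<close>, with multiplicity, so the weights add up to one constant
  for all \<open>j\<close>. Terms of a relation can therefore be compared through their shifted
  values.\<close>

lemma term_val:
  fixes u :: "'i \<Rightarrow> 'g"
  assumes fin: "finite I" "finite J" and j: "j \<in> J - I"
    and s: "insert j I \<in> supp P" "J - {j} \<in> supp P"
  obtains a where "opt_mult (trop_ext F) (Some (plucker_sign (trop_ext F) j I J))
      (opt_mult (trop_ext F) (P (insert j I)) (P (J - {j}))) =
      Some (a, shifted_val u P (insert j I) + shifted_val u P (J - {j}) + ((\<Sum>i\<in>I. u i) + (\<Sum>i\<in>J. u i)))"
    "Some a = opt_mult F (Some (plucker_sign F j I J)) (opt_mult F (angular (P (insert j I))) (angular (P (J - {j}))))"
proof -
  obtain p \<gamma> where p: "P (insert j I) = Some (p, \<gamma>)" using s(1) by (auto simp: supp_def)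
  obtain q \<delta> where q: "P (J - {j}) = Some (q, \<delta>)" using s(2) by (auto simp: supp_def)
  have "shifted_val u P (insert j I) + shifted_val u P (J - {j}) + (sum u I + sum u J) = \<gamma> + \<delta>"
    using fin j by (simp add: shifted_val_def p q sum.remove[of J j u])
  then show ?thesis
    by (intro that[of "plucker_sign F j I J \<otimes> (p \<otimes> q)"])
      (simp_all add: p q base.plucker_sign_trop opt_mult_trop_Some angular_def del: opt_mult_Some,
        simp_all)
qed

lemma initial_plucker_relation:
  fixes u :: "'i \<Rightarrow> 'g"
  assumes fin: "finite I" "finite J" and rel: "plucker_relation (trop_ext F) P I J"
  shows "plucker_relation F (Pu u) I J"
proof -
  define f where "f j = opt_mult (trop_ext F) (Some (plucker_sign (trop_ext F) j I J))
      (opt_mult (trop_ext F) (P (insert j I)) (P (J - {j})))" for j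
  define g where "g j = opt_mult F (Some (plucker_sign F j I J)) (opt_mult F (Pu u (insert j I)) (Pu u (J - {j})))" for j
  let ?v = "shifted_val u P"
  let ?c = "(\<Sum>i\<in>I. u i) + (\<Sum>i\<in>J. u i)"
  have f_null: "formal_sum f (J - I) \<in> null_set (trop_ext F)"
    using rel unfolding plucker_relation_def f_def .
  have "formal_sum g (J - I) \<in> null_set F"
  proof (cases "\<exists>j\<in>J - I. g j \<noteq> None")
    case False
    then have "{j \<in> J - I. g j \<noteq> None} = {}" by blast
    then have "formal_sum g (J - I) = {#}" unfolding formal_sum_def by (simp only: mset_set.empty image_mset_empty)
    then show ?thesis using base.zero_in_null_set by simp
  next
    case True
    then obtain j0 where j0: "j0 \<in> J - I" "g j0 \<noteq> None" by blast
    then have min0: "insert j0 I \<in> supp (Pu u)" "J - {j0} \<in> supp (Pu u)" by (auto simp: g_def supp_def)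
    \<comment> \<open>One surviving term shows that the minimum \<open>m\<close> over all bases is
      attained by both of its factors, so the least term value is \<open>m + m + ?c\<close>. A sum
      of two values that are at least \<open>m\<close> equals \<open>m + m\<close> only if both are
      \<open>m\<close>, which identifies the leading terms.\<close>
    define m where "m = ?v (insert j0 I)"
    have m: "X \<in> supp P \<Longrightarrow> m \<le> ?v X" for X using min0(1) unfolding supp_Pu m_def by blast
    have m': "?v (J - {j0}) = m"
    proof (rule antisym)
      show "?v (J - {j0}) \<le> m" using min0 unfolding supp_Pu m_def by blast
      show "m \<le> ?v (J - {j0})" using min0(2) m unfolding supp_Pu by blast
    qed
    have Pu: "Pu u X = (if X \<in> supp P \<and> ?v X \<le> m then angular (P X) else None)" for X
    proof -
      have "(\<forall>Y\<in>supp P. ?v X \<le> ?v Y) \<longleftrightarrow> ?v X \<le> m"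
        using m min0(1) order_trans unfolding m_def supp_Pu by blast
      then show ?thesis unfolding Pu_eq by simp
    qed
    have f_iff: "f j \<noteq> None \<longleftrightarrow> insert j I \<in> supp P \<and> J - {j} \<in> supp P" for j
      by (simp add: f_def supp_def)
    have val: "snd (the (f j)) = ?v (insert j I) + ?v (J - {j}) + ?c"
      and ang: "angular (f j) = opt_mult F (Some (plucker_sign F j I J)) (opt_mult F (angular (P (insert j I))) (angular (P (J - {j}))))"
      if j: "j \<in> J - I" "f j \<noteq> None" for j
    proof -
      have s: "insert j I \<in> supp P" "J - {j} \<in> supp P" using j(2) unfolding f_iff by blast+
      obtain a where a: "f j = Some (a, ?v (insert j I) + ?v (J - {j}) + ?c)"
        "Some a = opt_mult F (Some (plucker_sign F j I J)) (opt_mult F (angular (P (insert j I))) (angular (P (J - {j}))))"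
        using term_val[OF fin j(1) s, of u] unfolding f_def by blast
      show "snd (the (f j)) = ?v (insert j I) + ?v (J - {j}) + ?c" by (simp add: a(1))
      show "angular (f j) = opt_mult F (Some (plucker_sign F j I J)) (opt_mult F (angular (P (insert j I))) (angular (P (J - {j}))))"
        unfolding a(2)[symmetric] by (simp add: a(1) angular_def)
    qed
    have fj0: "f j0 \<noteq> None" using min0 unfolding f_iff supp_Pu by blast
    have v0: "snd (the (f j0)) = m + m + ?c" using val[OF j0(1) fj0] m' by (simp add: m_def)
    have g: "g j = (if f j \<noteq> None \<and> (\<forall>k\<in>J - I. f k \<noteq> None \<longrightarrow> snd (the (f j)) \<le> snd (the (f k))) then angular (f j) else None)"
      if j: "j \<in> J - I" for j
    proof (cases "f j = None")
      case True
      then show ?thesis using f_iff[of j] by (auto simp: g_def Pu)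
    next
      case False
      then have s: "insert j I \<in> supp P" "J - {j} \<in> supp P" using f_iff by blast+
      have low: "m + m + ?c \<le> snd (the (f k))" if "k \<in> J - I" "f k \<noteq> None" for k
        unfolding val[OF that] using f_iff[of k] that(2) by (intro add_mono m) auto
      have min_iff: "(\<forall>k\<in>J - I. f k \<noteq> None \<longrightarrow> snd (the (f j)) \<le> snd (the (f k))) \<longleftrightarrow> snd (the (f j)) \<le> m + m + ?c"
        using low j0(1) fj0 v0 order_trans by metis
      have "snd (the (f j)) \<le> m + m + ?c \<longleftrightarrow> ?v (insert j I) + ?v (J - {j}) \<le> m + m"
        unfolding val[OF j False] by simp
      also have "\<dots> \<longleftrightarrow> ?v (insert j I) \<le> m \<and> ?v (J - {j}) \<le> m"
      proof
        assume le: "?v (insert j I) + ?v (J - {j}) \<le> m + m"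
        have "?v (insert j I) + m \<le> m + m" using add_left_mono[OF m[OF s(2)]] le by (rule order_trans)
        moreover have "m + ?v (J - {j}) \<le> m + m" using add_right_mono[OF m[OF s(1)]] le by (rule order_trans)
        ultimately show "?v (insert j I) \<le> m \<and> ?v (J - {j}) \<le> m" by simp
      qed (simp add: add_mono)
      finally have iff: "snd (the (f j)) \<le> m + m + ?c \<longleftrightarrow> ?v (insert j I) \<le> m \<and> ?v (J - {j}) \<le> m" .
      show ?thesis unfolding min_iff iff ang[OF j False] g_def Pu using s False by auto
    qed
    show ?thesis using base.formal_sum_trop_null[OF _ f_null g] fin by simp
  qed
  then show ?thesis unfolding plucker_relation_def g_def .
qed

text \<open>If the term at \<open>a\<close> were strictly smaller in value than all others, the
  leading part would be a single coefficient, which is not null. So some other index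
  \<open>b\<close> has a term of no larger value, and the common constant cancels.\<close>

lemma local_valuated_exchange:
  fixes u :: "'i \<Rightarrow> 'g"
  assumes XY: "X \<in> supp P" "Y \<in> supp P" "card (X - Y) = 2"
  shows "valuated_exchange (supp P) (shifted_val u P) X Y"
  unfolding valuated_exchange_def
proof
  fix a assume a: "a \<in> X - Y"
  let ?I = "X - {a}" and ?J = "insert a Y" and ?v = "shifted_val u P"
  define f where "f j = opt_mult (trop_ext F) (Some (plucker_sign (trop_ext F) j ?I ?J))
      (opt_mult (trop_ext F) (P (insert j ?I)) (P (?J - {j})))" for j
  have fin: "finite ?I" "finite ?J" using T.basisD(2)[OF XY(1)] T.basisD(2)[OF XY(2)] by simp_all
  have null: "formal_sum f (?J - ?I) \<in> null_set (trop_ext F)"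
    using T.local_relation[OF XY a] unfolding plucker_relation_def f_def .
  have diff: "?J - ?I = insert a (Y - X)" using a by blast
  have fa: "insert a ?I = X" "?J - {a} = Y" using a by auto
  have f_iff: "f j \<noteq> None \<longleftrightarrow> insert j ?I \<in> supp P \<and> ?J - {j} \<in> supp P" for j
    by (simp add: f_def supp_def)
  have fa_some: "f a \<noteq> None" unfolding f_iff fa using XY by blast
  have val: "snd (the (f j)) = ?v (insert j ?I) + ?v (?J - {j}) + (sum u ?I + sum u ?J)"
    if j: "j \<in> ?J - ?I" "f j \<noteq> None" for j
  proof -
    have s: "insert j ?I \<in> supp P" "?J - {j} \<in> supp P" using j(2) unfolding f_iff by blast+
    obtain a' where "f j = Some (a', ?v (insert j ?I) + ?v (?J - {j}) + (sum u ?I + sum u ?J))"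
      using term_val[OF fin j(1) s, of u] unfolding f_def by blast
    then show ?thesis by simp
  qed
  obtain b where b: "b \<in> Y - X" "f b \<noteq> None" "snd (the (f b)) \<le> snd (the (f a))"
  proof (rule ccontr)
    assume "\<not> thesis"
    then have gt: "snd (the (f a)) < snd (the (f b))" if "b \<in> Y - X" "f b \<noteq> None" for b
      using that \<open>\<And>b. \<lbrakk>b \<in> Y - X; f b \<noteq> None; snd (the (f b)) \<le> snd (the (f a))\<rbrakk> \<Longrightarrow> thesis\<close> not_le by blast
    define g where "g j = (if f j \<noteq> None \<and> (\<forall>k\<in>?J - ?I. f k \<noteq> None \<longrightarrow> snd (the (f j)) \<le> snd (the (f k)))
      then angular (f j) else None)" for j
    have "formal_sum g (?J - ?I) \<in> null_set F"
      using fin(2) by (intro base.formal_sum_trop_null[OF _ null]) (simp_all only: g_def finite_Diff)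
    moreover have "{j \<in> ?J - ?I. g j \<noteq> None} = {a}"
    proof -
      have "snd (the (f a)) \<le> snd (the (f k))" if "k \<in> ?J - ?I" "f k \<noteq> None" for k
        using that gt[of k] less_imp_le unfolding diff by blast
      then have "g a \<noteq> None" using fa_some by (auto simp: g_def angular_def)
      moreover have "g k = None" if "k \<in> Y - X" for k
      proof (cases "f k = None")
        case False
        then have "\<not> snd (the (f k)) \<le> snd (the (f a))" using gt[OF that] by (simp add: not_le)
        then show ?thesis using fa_some unfolding g_def diff by auto
      qed (simp add: g_def)
      ultimately show ?thesis unfolding diff by (auto simp del: not_None_eq)
    qed
    ultimately show False using formal_sum_single[of "?J - ?I" g a] base.null_singleton by metis
  qed
  have "b \<in> ?J - ?I" "a \<in> ?J - ?I" using b(1) unfolding diff by blast+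
  with b have "?v (insert b ?I) + ?v (?J - {b}) \<le> ?v X + ?v Y"
    using val[of b] val[of a] fa_some unfolding fa by simp
  moreover have "?J - {b} = insert a (Y - {b})" using a b(1) by blast
  ultimately show "\<exists>b\<in>Y - X. insert b (X - {a}) \<in> supp P \<and> insert a (Y - {b}) \<in> supp P \<and>
      ?v (insert b (X - {a})) + ?v (insert a (Y - {b})) \<le> ?v X + ?v Y"
    using b f_iff[of b] by (intro bexI[of _ b]) simp_all
qed

lemma matroid_bases_initial: "matroid_bases E (supp (Pu u))"
  unfolding supp_Pu by (rule T.matroid_bases_minimizers[OF local_valuated_exchange])

theorem plucker_vector_initial:
  assumes P: "plucker_vector s (trop_ext F) E r P"
  shows "plucker_vector s F E r (Pu u)"
proof -
  have rel: "plucker_relation F (Pu u) I J" if "I \<subseteq> E" "J \<subseteq> E" "plucker_relation (trop_ext F) P I J" for I J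
    using that finite_subset[OF _ T.finite_ground] by (intro initial_plucker_relation) simp_all
  show ?thesis
  proof (cases s)
    case Weak
    show ?thesis
      unfolding Weak plucker_vector.simps using Pu_function matroid_bases_initial rel T.relation by blast
  next
    case Strong
    have "plucker_relation (trop_ext F) P I J"
      if "I \<subseteq> E" "J \<subseteq> E" "card I + 1 = r" "card J = r + 1" for I J
      using P that unfolding Strong plucker_vector.simps by blast
    then show ?thesis unfolding Strong plucker_vector.simps using Pu_function rel by blast
  qed
qed

text \<open>Multiplication by \<open>c\<close> shifts all values on the support equally and keeps
  the minimizers; only the coefficient \<open>fst c\<close> remains visible.\<close>

lemma initial_vector_scale:
  assumes c: "c \<in> carrier (trop_ext F)"
  shows "initial_vector E r u (scale (trop_ext F) c P) = scale F (fst c) (Pu u)"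
proof
  fix X
  have sc: "shifted_val u (scale (trop_ext F) c P) Y = snd c + shifted_val u P Y" if "Y \<in> supp P" for Y
  proof -
    obtain p \<gamma> where "P Y = Some (p, \<gamma>)" using \<open>Y \<in> supp P\<close> by (auto simp: supp_def)
    then show ?thesis by (cases c) (simp add: shifted_val_def scale_def trop_ext_def)
  qed
  have "angular (scale (trop_ext F) c P X) = opt_mult F (Some (fst c)) (angular (P X))"
    by (cases c; cases "P X") (auto simp: scale_def angular_def trop_ext_def)
  moreover have "supp (scale (trop_ext F) c P) \<subseteq> nsets E r" using supp_P by simp
  note initial_vector_eq[OF this, of u X]
  ultimately show "initial_vector E r u (scale (trop_ext F) c P) X = scale F (fst c) (Pu u) X"
    using sc by (cases "X \<in> supp P") (simp_all add: scale_def[of F] Pu_eq)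
qed

end

section \<open>Passage to scaling classes and to infinite weights\<close>

context tract
begin

text \<open>Each term contains two values of \<open>P\<close>, so the sum is scaled by the square of
  \<open>c\<close>.\<close>

lemma plucker_relation_scale:
  assumes c: "c \<in> carrier F" and closed: "\<And>X. set_option (P X) \<subseteq> carrier F" and rel: "plucker_relation F P I J"
  shows "plucker_relation F (scale F c P) I J"
proof -
  define f where "f j = Some (plucker_sign F j I J) \<odot> (P (insert j I) \<odot> P (J - {j}))" for j
  have "Some (plucker_sign F j I J) \<odot> (scale F c P (insert j I) \<odot> scale F c P (J - {j})) =
      Some (c \<otimes> c) \<odot> f j" for j
    using c closed[of "insert j I"] closed[of "J - {j}"] neg_one_pow_closed
    by (cases "P (insert j I)"; cases "P (J - {j})") (simp_all add: f_def scale_def plucker_sign_def m_ac)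
  then have "formal_sum (\<lambda>j. Some (plucker_sign F j I J) \<odot> (scale F c P (insert j I) \<odot> scale F c P (J - {j}))) (J - I) =
      image_mset (\<lambda>a. c \<otimes> c \<otimes> a) (formal_sum f (J - I))"
    by (simp add: formal_sum_scale)
  moreover have "formal_sum f (J - I) \<in> null_set F" using rel unfolding plucker_relation_def f_def .
  ultimately show ?thesis unfolding plucker_relation_def using null_set_scale[of _ "c \<otimes> c"] c by simp
qed

lemma plucker_vector_scale:
  assumes P: "plucker_vector s F E r P" and c: "c \<in> carrier F"
  shows "plucker_vector s F E r (scale F c P)"
proof -
  have pf: "plucker_function F E r P" using P by (cases s) simp_all
  note closed = plucker_function_closed[OF pf]
  have pf': "plucker_function F E r (scale F c P)"
    using pf closed c by (intro plucker_functionI scale_closed) (simp_all add: plucker_function_def)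
  note rel = plucker_relation_scale[OF c closed]
  show ?thesis
  proof (cases s)
    case Weak
    have "plucker_relation F (scale F c P) I J"
      if "I \<subseteq> E" "J \<subseteq> E" "card I + 1 = r" "card J = r + 1" "card (J - I) = 3" for I J
      using P that unfolding Weak plucker_vector.simps by (intro rel) (elim conjE, simp)
    moreover have "matroid_bases E (supp P)" using P unfolding Weak plucker_vector.simps by (elim conjE)
    ultimately show ?thesis using pf' unfolding Weak plucker_vector.simps supp_scale by blast
  next
    case Strong
    have "plucker_relation F (scale F c P) I J"
      if "I \<subseteq> E" "J \<subseteq> E" "card I + 1 = r" "card J = r + 1" for I J
      using P that unfolding Strong plucker_vector.simps by (intro rel) (elim conjE, simp)
    then show ?thesis using pf' unfolding Strong plucker_vector.simps by blast
  qed
qed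

lemma is_fmatroid_initial_matroid_fin:
  fixes M :: "('i::linorder, 'a \<times> 'g::linordered_ab_group_add) fmatroid"
  assumes M: "is_fmatroid s trop M"
  shows "is_fmatroid s F (initial_matroid_fin F M u)"
    and "P \<in> plucker_class M \<Longrightarrow> plucker_vector s F (ground M) (mrank M) (initial_vector (ground M) (mrank M) u P)"
    and "P \<in> plucker_class M \<Longrightarrow>
      initial_vector (ground M) (mrank M) u P \<in> plucker_class (initial_matroid_fin F M u)"
proof -
  interpret T: tract "trop :: ('a \<times> 'g) tract" by (rule tract_trop)
  obtain Q where Q: "plucker_vector s trop (ground M) (mrank M) Q" "plucker_class M = scaling_class trop Q"
    "weak_plucker trop (ground M) (mrank M) Q"
    using T.fmatroid_obtains[OF M] by metis
  interpret Q: weak_plucker "trop :: ('a \<times> 'g) tract" "ground M" "mrank M" Q by (rule Q(3))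
  interpret trop_plucker F "ground M" "mrank M" Q
    using tract_axioms Q.weak by (intro trop_plucker.intro trop_plucker_axioms.intro)
  let ?in = "\<lambda>P. initial_vector (ground M) (mrank M) u P"
  have PV: "plucker_vector s F (ground M) (mrank M) (?in Q)" using Q(1) by (rule plucker_vector_initial)
  have closed: "set_option (?in Q X) \<subseteq> carrier F" for X using plucker_function_closed[OF Pu_function] .
  have cls: "scaling_class F (?in P) = scaling_class F (?in Q)" and pv: "\<exists>c\<in>carrier F. ?in P = scale F c (?in Q)"
    if P: "P \<in> plucker_class M" for P
  proof -
    obtain c where c: "c \<in> carrier trop" "P = scale trop c Q"
      using P unfolding Q(2) scaling_class_def by blast
    have f: "fst c \<in> carrier F" using c(1) by auto
    have eq: "?in P = scale F (fst c) (?in Q)" unfolding c(2) using c(1) by (rule initial_vector_scale)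
    then show "scaling_class F (?in P) = scaling_class F (?in Q)"
      using f closed by (simp add: scaling_class_scale)
    show "\<exists>c\<in>carrier F. ?in P = scale F c (?in Q)" using f eq by blast
  qed
  have "Q = scale trop \<one>\<^bsub>trop\<^esub> Q" by (rule T.scale_one[symmetric]) (rule Q.P_closed)
  then have "Q \<in> plucker_class M" unfolding Q(2) scaling_class_def using T.one_closed by blast
  then have cl: "plucker_class (initial_matroid_fin F M u) = scaling_class F (?in Q)"
    unfolding initial_matroid_fin_def fmatroid.select_convs using cls by blast
  then show "is_fmatroid s F (initial_matroid_fin F M u)"
    using PV Q.finite_ground unfolding is_fmatroid_def by (auto simp: initial_matroid_fin_def)
  assume P: "P \<in> plucker_class M"
  then show "?in P \<in> plucker_class (initial_matroid_fin F M u)"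
    using pv[OF P] unfolding cl scaling_class_def by blast
  show "plucker_vector s F (ground M) (mrank M) (?in P)"
    using pv[OF P] plucker_vector_scale[OF PV] by auto
qed

text \<open>Contraction removes \<open>Z\<close> from the ground set, so \<open>Z\<close> is
  disjoint from it and can be added as coloops, which restores the original ground set.\<close>

theorem is_fmatroid_initial_matroid:
  fixes M :: "('i::linorder, 'a \<times> 'g::linordered_ab_group_add) fmatroid"
  assumes M: "is_fmatroid s trop M"
  shows "is_fmatroid s F (initial_matroid s F M u)" "ground (initial_matroid s F M u) = ground M"
proof -
  interpret T: tract "trop :: ('a \<times> 'g) tract" by (rule tract_trop)
  define Z where "Z = {i \<in> ground M. u i = None}"
  have Z: "Z \<subseteq> ground M" "finite Z" using M by (auto simp: Z_def is_fmatroid_def)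
  let ?N = "initial_matroid_fin F (contraction s trop M Z) (\<lambda>i. the (u i))"
  have N: "is_fmatroid s F ?N" "ground ?N = ground M - Z"
    using is_fmatroid_initial_matroid_fin(1)[OF T.contraction_exists(1)[OF M Z(1)]] T.contraction_exists(2)[OF M Z(1)]
    by (simp_all add: initial_matroid_fin_def)
  have "Z \<inter> ground ?N = {}" unfolding N(2) by blast
  note ex = add_coloops_exists[OF N(1) Z(2) this]
  have eq: "initial_matroid s F M u = add_coloops s F ?N Z"
    by (simp add: initial_matroid_def Z_def Let_def)
  show "is_fmatroid s F (initial_matroid s F M u)" unfolding eq by (rule ex(1))
  show "ground (initial_matroid s F M u) = ground M" unfolding eq ex(2) N(2) using Z(1) by blast
qed

end

theorem proposition3p3:
  fixes s :: strength
    and F :: "('f, 'm) tract_scheme"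
    and E :: "'i::linorder set"
    and r :: nat
    and M :: "('i, 'f \<times> 'g::linordered_ab_group_add) fmatroid"
    and P :: "'i set \<Rightarrow> ('f \<times> 'g) option"
  assumes "tract F"
    and "finite E"
    and "is_fmatroid s (trop_ext F) M"
    and "ground M = E"
    and "mrank M = r"
    and "P \<in> plucker_class M"
  shows "(\<forall>u :: 'i \<Rightarrow> 'g.
            plucker_vector s F E r (initial_vector E r u P) \<and>
            is_fmatroid s F (initial_matroid_fin F M u) \<and>
            initial_vector E r u P \<in> plucker_class (initial_matroid_fin F M u)) \<and>
         (\<forall>u :: 'i \<Rightarrow> 'g option.
            is_fmatroid s F (initial_matroid s F M u) \<and>
            ground (initial_matroid s F M u) = E)"
proof -
  interpret tract F by fact
  show ?thesis
    using is_fmatroid_initial_matroid_fin[OF assms(3)] is_fmatroid_initial_matroid[OF assms(3)] assms(4-6)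
    by blast
qed

end
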